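(* Let $\lambda\in\mathbb{R}^n$ and define $X(t)=(x^m_i(t))=S^\lambda_tX(0)$ for $t\ge 0$, where $X(0)\in\mathcal{T}_\lambda$. Let $M(t)=g_\lambda(X(t))$, $b(t)=f^{-1}(X(t))$, and $$L(t)=L_1(u^1)L_2(u^2)\cdots L_{n-1}(u^{n-1}),\qquad u^m_i=e^{x^{m+1}_{i+1}(t)-x^m_i(t)},\quad 1\le i\le m<n.$$ Let $Q=\Pi_-(M)$ and $P=M-Q$. Then: (i) For all $t\ge 0$, $$M(t)=L(t)^{-1}\epsilon_\lambda L(t),$$ and we have the Gauss decompositions $$b(t)\bar w_0=L(t)R(t),\qquad e^{tM(0)}=n(t)r(t),$$ where $n(t)=L(0)^{-1}L(t)$, $R(t)\in B$, $r(t)=R(t)R(0)^{-1}$, and these satisfy $$\dot L=LQ,\qquad \dot R=PR,\qquad \dot n=nQ,\qquad \dot r=Pr.$$ In particular, $M(t)$ defines a solution to the Toda flow on $\mathcal{M}_\lambda$. (ii) The eigenvalues $\lambda_1,\dots,\lambda_n$ are given by $$\lambda_1=\dot x^1_1,\qquad \lambda_m=\sum_{i=1}^m\dot x^m_i-\sum_{i=1}^{m-1}\dot x^{m-1}_i,\quad 2\le m\le n.$$ (iii) Writing $x=x(t)=x^n(t)=(x^n_1(t),\dots,x^n_n(t))$, $$\mathcal{F}(X)=(n-1)\dot x_1+(n-3)\dot x_2+\cdots+(1-n)\dot x_n$$ and $$\dot x=-\nabla_xu_\lambda(x).$$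
   Context: Let $n$ be a positive integer. $B$ and $N_-$ denote the subgroups of upper triangular and lower uni-triangular matrices in $GL(n,\mathbb{C})$. $\mathcal{T}=\{X=(x^m_i)_{1\le i\le m\le n}\}=\mathbb{R}^{n(n+1)/2}$ is the set of triangles ($m$ is an upper index), and $x^m=(x^m_1,\dots,x^m_m)$. The set $\mathcal{P}$ and the map $f$: for $b\in B$ let $\Delta^m_k(b)=\det[b_{ij}]_{1\le i\le k,\ m-k+1\le j\le m}$, and $\mathcal{P}=\{b\in B:\Delta^m_k(b)>0,\ 1\le k\le m\le n\}$. The map $f:\mathcal{P}\to\mathcal{T}$, $f(b)=(x^m_i)$, defined by $x^m_1+\cdots+x^m_k=\log\Delta^m_k(b)$ for $1\le k\le m\le n$, is a bijection. Matrices: $e_i$ (resp. $f_i$), $1\le i\le n-1$, is the $n\times n$ matrix with a single nonzero entry, equal to $1$, in position $(i,i+1)$ (resp. $(i+1,i)$). $\bar s_i=(I-e_i)(I+f_i)(I-e_i)$, and $\bar w_0=\bar s_{i_1}\cdots\bar s_{i_r}$ where $s_{i_1}\cdots s_{i_r}$ is any reduced decomposition of the longest element $w_0\in S_n$ in the adjacent transpositions $s_i=(i,i+1)$ (the result does not depend on the choice). $l_i(a)=I+af_i$ and, for $u\in\mathbb{C}^m$, $1\le m<n$, $L_m(u)=l_m(u_m)l_{m-1}(u_{m-1})\cdots l_1(u_1)$. $\epsilon_\lambda$ is the $n\times n$ matrix with diagonal entries $\lambda_1,\dots,\lambda_n$, entries $1$ in positions $(i,i+1)$, and zeros elsewhere.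 $\Pi_-(A)$ is the strictly lower triangular part of a square matrix $A$. A Gauss decomposition is a factorisation as a product of an element of $N_-$ and an element of $B$. The flow $S^\lambda_t$ on $\mathcal{T}$: $S^\lambda_tX(0)=X(t)$, $t\ge 0$, where $X(t)$ solves $$\dot x^1_1=\lambda_1;$$ $$\dot x^m_1=\dot x^{m-1}_1+e^{x^m_2-x^{m-1}_1},\qquad \dot x^m_m=\lambda_m-e^{x^m_m-x^{m-1}_{m-1}},\qquad 2\le m\le n;$$ $$\dot x^m_i=\dot x^{m-1}_i+e^{x^m_{i+1}-x^{m-1}_i}-e^{x^m_i-x^{m-1}_{i-1}},\qquad 1<i<m\le n.$$ The functions $\mathcal{F}$, $\mathcal{F}_\lambda$, $u_\lambda$: for $X\in\mathcal{T}$, $$\mathcal{F}(X)=\sum_{1\le i\le m<n}\left(e^{x^{m+1}_{i+1}-x^m_i}+e^{x^m_i-x^{m+1}_i}\right),\qquad \mathcal{F}_\lambda(X)=\sum_{m=1}^n\lambda_m\left(\sum_{i=1}^{m-1}x^{m-1}_i-\sum_{i=1}^mx^m_i\right)+\mathcal{F}(X)$$ (with $\mathcal{F}=0$ if $n=1$). For $x\in\mathbb{R}^n$, let $\mathcal{T}(x)$ be the set of $X\in\mathcal{T}$ with bottom row $x^n=x$. It is known that $\mathcal{F}_\lambda$ is strictly convex on $\mathcal{T}(x)$ with a unique critical point, a minimum, denoted $X^*_\lambda(x)$. Set $u_\lambda(x)=\mathcal{F}_\lambda(X^*_\lambda(x))$. The set $\mathcal{T}_\lambda$ consists of those $X\in\mathcal{T}$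 satisfying the critical point equations $\lambda_m+l^m_i=\lambda_{m+1}+r^m_i$ for all $1\le i\le m<n$, where $$l^m_i=e^{x^{m+1}_{i+1}-x^m_i}+e^{x^{m-1}_i-x^m_i}\ (1\le i<m<n),\qquad l^m_m=e^{x^{m+1}_{m+1}-x^m_m}\ (1\le m<n),$$ $$r^m_i=e^{x^m_i-x^{m+1}_i}+e^{x^m_i-x^{m-1}_{i-1}}\ (1<i\le m<n),\qquad r^m_1=e^{x^m_1-x^{m+1}_1}\ (1\le m<n).$$ Equivalently, $X=X^*_\lambda(x^n)$. Toda flow (opposite sign): $\mathcal{M}$ is the set of complex $n\times n$ tridiagonal Hessenberg matrices (tridiagonal with all superdiagonal entries equal to $1$), and $\mathcal{M}_\lambda\subset\mathcal{M}$ the subset of those with eigenvalues $\lambda_1,\dots,\lambda_n$. A path $M(t)\in\mathcal{M}$ is a solution to the Toda flow if $\dot M=[M,Q]=MQ-QM$ with $Q=\Pi_-(M)$. The map $g_\lambda:\mathcal{T}\to\mathcal{M}$ sends $X=(x^m_i)$ to the tridiagonal matrix $M$ with diagonal $(p_1,\dots,p_n)$, superdiagonal entries all $1$, and subdiagonal entries $M_{i+1,i}=-q_i$, where $q_i=e^{x^n_{i+1}-x^n_i}$ for $1\le i\le n-1$ and $p_i=p^n_i$, with $p^m_i$ defined recursively by $p^1_1=\lambda_1$ and, for $2\le m\le n$, $$p^m_1=p^{m-1}_1+e^{x^m_2-x^{m-1}_1},\qquad p^m_m=\lambda_m-e^{x^m_m-x^{m-1}_{m-1}},\qquad p^m_i=p^{m-1}_i+e^{x^m_{i+1}-x^{m-1}_i}-e^{x^m_i-x^{m-1}_{i-1}}\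 (1<i<m).$$ *)

theory Defs
  imports
    "HOL-Analysis.Derivative"
    "HOL-Combinatorics.Permutations"
    "Jordan_Normal_Form.Gauss_Jordan_Elimination"
    "Jordan_Normal_Form.Char_Poly"
begin

text \<open>Triangles are written \<open>X m i\<close> for \<open>x\<^sup>m\<^sub>i\<close> with the usual indices starting from 1, and vectors
  \<open>\<lambda>\<close>, \<open>x\<close>, \<open>u\<close> are functions on the indices 1, 2, ... . Matrices are those of
  \<open>Jordan_Normal_Form.Matrix\<close>, whose rows and columns are numbered from 0: the entry in position
  \<open>(i, j)\<close> of the usual numbering is \<open>A $$ (i - 1, j - 1)\<close>.\<close>

type_synonym triangle = "nat \<Rightarrow> nat \<Rightarrow> real"

text \<open>Entries outside the triangle are 0, so that equality of triangles is equality of functions.\<close>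

definition triangles :: "nat \<Rightarrow> triangle set" where
  "triangles n = {X. \<forall>m i. \<not> (1 \<le> i \<and> i \<le> m \<and> m \<le> n) \<longrightarrow> X m i = 0}"

definition triangles_over :: "nat \<Rightarrow> (nat \<Rightarrow> real) \<Rightarrow> triangle set" where
  "triangles_over n x = {X \<in> triangles n. \<forall>i\<in>{1..n}. X n i = x i}"

definition borel_group :: "nat \<Rightarrow> complex mat set" where
  "borel_group n = {A \<in> carrier_mat n n. upper_triangular A \<and> invertible_mat A}"

definition lower_unitri :: "nat \<Rightarrow> complex mat set" where
  "lower_unitri n = {A \<in> carrier_mat n n.
     (\<forall>i<n. A $$ (i, i) = 1) \<and> (\<forall>i<n. \<forall>j<n. i < j \<longrightarrow> A $$ (i, j) = 0)}"

definition gauss_decomposition :: "nat \<Rightarrow> complex mat \<Rightarrow> complex mat \<Rightarrow> complex mat \<Rightarrow> bool" where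
  "gauss_decomposition n A L R \<longleftrightarrow> L \<in> lower_unitri n \<and> R \<in> borel_group n \<and> A = L * R"

definition inv_mat :: "complex mat \<Rightarrow> complex mat" where
  "inv_mat A = the (mat_inverse A)"

definition strict_lower_part :: "complex mat \<Rightarrow> complex mat" where
  "strict_lower_part A = mat (dim_row A) (dim_col A) (\<lambda>(i, j). if j < i then A $$ (i, j) else 0)"

definition ordered_prod :: "nat \<Rightarrow> complex mat list \<Rightarrow> complex mat" where
  "ordered_prod n As = foldr (*) As (1\<^sub>m n)"

definition exp_mat :: "complex mat \<Rightarrow> complex mat" where
  "exp_mat A = mat (dim_row A) (dim_col A) (\<lambda>ij. \<Sum>k. (A ^\<^sub>m k) $$ ij / fact k)"

text \<open>All paths are considered on \<open>{0..}\<close> only, so derivatives at time 0 are one-sided.\<close>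

definition has_mat_derivative :: "nat \<Rightarrow> (real \<Rightarrow> complex mat) \<Rightarrow> complex mat \<Rightarrow> real \<Rightarrow> bool" where
  "has_mat_derivative n A D t \<longleftrightarrow> (\<forall>i<n. \<forall>j<n.
     ((\<lambda>s. A s $$ (i, j)) has_vector_derivative D $$ (i, j)) (at t within {0..}))"

definition tri_deriv :: "(real \<Rightarrow> triangle) \<Rightarrow> real \<Rightarrow> triangle" where
  "tri_deriv X t m i = vector_derivative (\<lambda>s. X s m i) (at t within {0..})"

definition e_mat :: "nat \<Rightarrow> nat \<Rightarrow> complex mat" where
  "e_mat n i = mat n n (\<lambda>(r, c). if r = i - 1 \<and> c = i then 1 else 0)"

definition f_mat :: "nat \<Rightarrow> nat \<Rightarrow> complex mat" where
  "f_mat n i = mat n n (\<lambda>(r, c). if r = i \<and> c = i - 1 then 1 else 0)"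

definition l_mat :: "nat \<Rightarrow> nat \<Rightarrow> complex \<Rightarrow> complex mat" where
  "l_mat n i a = 1\<^sub>m n + a \<cdot>\<^sub>m f_mat n i"

definition L_mat :: "nat \<Rightarrow> nat \<Rightarrow> (nat \<Rightarrow> complex) \<Rightarrow> complex mat" where
  "L_mat n m u = ordered_prod n (map (\<lambda>i. l_mat n i (u i)) (rev [1..<m + 1]))"

definition eps_mat :: "nat \<Rightarrow> (nat \<Rightarrow> real) \<Rightarrow> complex mat" where
  "eps_mat n lam = mat n n (\<lambda>(r, c).
     if r = c then complex_of_real (lam (r + 1)) else if c = r + 1 then 1 else 0)"

definition word_perm :: "nat list \<Rightarrow> nat \<Rightarrow> nat" where
  "word_perm is = foldr (\<circ>) (map (\<lambda>i. Transposition.transpose i (i + 1)) is) id"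

definition is_word :: "nat \<Rightarrow> (nat \<Rightarrow> nat) \<Rightarrow> nat list \<Rightarrow> bool" where
  "is_word n w is \<longleftrightarrow> set is \<subseteq> {1..<n} \<and> word_perm is = w"

definition perm_length :: "nat \<Rightarrow> (nat \<Rightarrow> nat) \<Rightarrow> nat" where
  "perm_length n w = (LEAST r. \<exists>is. is_word n w is \<and> length is = r)"

definition reduced_word :: "nat \<Rightarrow> (nat \<Rightarrow> nat) \<Rightarrow> nat list \<Rightarrow> bool" where
  "reduced_word n w is \<longleftrightarrow> is_word n w is \<and> length is = perm_length n w"

definition longest_perm :: "nat \<Rightarrow> (nat \<Rightarrow> nat) \<Rightarrow> bool" where
  "longest_perm n w \<longleftrightarrow> w permutes {1..n} \<and>
     (\<forall>v. v permutes {1..n} \<longrightarrow> perm_length n v \<le> perm_length n w)"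

definition s_bar :: "nat \<Rightarrow> nat \<Rightarrow> complex mat" where
  "s_bar n i = (1\<^sub>m n - e_mat n i) * (1\<^sub>m n + f_mat n i) * (1\<^sub>m n - e_mat n i)"

definition w0_bar :: "nat \<Rightarrow> complex mat" where
  "w0_bar n = (THE W. \<exists>w is. longest_perm n w \<and> reduced_word n w is \<and>
     W = ordered_prod n (map (s_bar n) is))"

definition minor :: "nat \<Rightarrow> nat \<Rightarrow> complex mat \<Rightarrow> complex" where
  "minor m k b = det (mat k k (\<lambda>(i, j). b $$ (i, m - k + j)))"

definition P_set :: "nat \<Rightarrow> complex mat set" where
  "P_set n = {b \<in> borel_group n. \<forall>m k. 1 \<le> k \<and> k \<le> m \<and> m \<le> n \<longrightarrow>
     minor m k b \<in> \<real> \<and> 0 < Re (minor m k b)}"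

definition f_map :: "nat \<Rightarrow> complex mat \<Rightarrow> triangle" where
  "f_map n b = (THE X. X \<in> triangles n \<and> (\<forall>m k. 1 \<le> k \<and> k \<le> m \<and> m \<le> n \<longrightarrow>
     (\<Sum>i=1..k. X m i) = ln (Re (minor m k b))))"

definition flow_solution :: "nat \<Rightarrow> (nat \<Rightarrow> real) \<Rightarrow> (real \<Rightarrow> triangle) \<Rightarrow> bool" where
  "flow_solution n lam X \<longleftrightarrow> (\<forall>t\<ge>0.
     X t \<in> triangles n \<and>
     (\<forall>m i. 1 \<le> i \<and> i \<le> m \<and> m \<le> n \<longrightarrow>
        (\<lambda>s. X s m i) differentiable (at t within {0..})) \<and>
     tri_deriv X t 1 1 = lam 1 \<and>
     (\<forall>m. 2 \<le> m \<and> m \<le> n \<longrightarrow>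
        tri_deriv X t m 1 = tri_deriv X t (m - 1) 1 + exp (X t m 2 - X t (m - 1) 1) \<and>
        tri_deriv X t m m = lam m - exp (X t m m - X t (m - 1) (m - 1))) \<and>
     (\<forall>m i. 1 < i \<and> i < m \<and> m \<le> n \<longrightarrow>
        tri_deriv X t m i = tri_deriv X t (m - 1) i
          + exp (X t m (i + 1) - X t (m - 1) i) - exp (X t m i - X t (m - 1) (i - 1))))"

definition flow :: "nat \<Rightarrow> (nat \<Rightarrow> real) \<Rightarrow> real \<Rightarrow> triangle \<Rightarrow> triangle" where
  "flow n lam t X0 = (THE X1. \<exists>X. flow_solution n lam X \<and> X 0 = X0 \<and> X t = X1)"

definition F_fun :: "nat \<Rightarrow> triangle \<Rightarrow> real" where
  "F_fun n X = (\<Sum>m=1..<n. \<Sum>i=1..m.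
     exp (X (m + 1) (i + 1) - X m i) + exp (X m i - X (m + 1) i))"

definition F_lam :: "nat \<Rightarrow> (nat \<Rightarrow> real) \<Rightarrow> triangle \<Rightarrow> real" where
  "F_lam n lam X = (\<Sum>m=1..n. lam m * ((\<Sum>i=1..m - 1. X (m - 1) i) - (\<Sum>i=1..m. X m i)))
     + F_fun n X"

text \<open>A critical point of the restriction to a set of triangles with fixed bottom row: the partial
  derivatives in the entries above the bottom row vanish.\<close>

definition critical_point :: "nat \<Rightarrow> (nat \<Rightarrow> real) \<Rightarrow> triangle \<Rightarrow> bool" where
  "critical_point n lam X \<longleftrightarrow> (\<forall>m i. 1 \<le> i \<and> i \<le> m \<and> m < n \<longrightarrow>
     ((\<lambda>s. F_lam n lam (X(m := (X m)(i := s)))) has_real_derivative 0) (at (X m i)))"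

definition X_star :: "nat \<Rightarrow> (nat \<Rightarrow> real) \<Rightarrow> (nat \<Rightarrow> real) \<Rightarrow> triangle" where
  "X_star n lam x = (THE X. X \<in> triangles_over n x \<and> critical_point n lam X)"

definition u_fun :: "nat \<Rightarrow> (nat \<Rightarrow> real) \<Rightarrow> (nat \<Rightarrow> real) \<Rightarrow> real" where
  "u_fun n lam x = F_lam n lam (X_star n lam x)"

definition l_term :: "triangle \<Rightarrow> nat \<Rightarrow> nat \<Rightarrow> real" where
  "l_term X m i = exp (X (m + 1) (i + 1) - X m i)
     + (if i < m then exp (X (m - 1) i - X m i) else 0)"

definition r_term :: "triangle \<Rightarrow> nat \<Rightarrow> nat \<Rightarrow> real" where
  "r_term X m i = exp (X m i - X (m + 1) i)
     + (if 1 < i then exp (X m i - X (m - 1) (i - 1)) else 0)"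

definition T_lam :: "nat \<Rightarrow> (nat \<Rightarrow> real) \<Rightarrow> triangle set" where
  "T_lam n lam = {X \<in> triangles n. \<forall>m i. 1 \<le> i \<and> i \<le> m \<and> m < n \<longrightarrow>
     lam m + l_term X m i = lam (m + 1) + r_term X m i}"

text \<open>The gradient is the vector of partial derivatives.\<close>

definition has_gradient :: "nat \<Rightarrow> ((nat \<Rightarrow> real) \<Rightarrow> real) \<Rightarrow> (nat \<Rightarrow> real) \<Rightarrow> (nat \<Rightarrow> real) \<Rightarrow> bool" where
  "has_gradient n u g x \<longleftrightarrow>
     (\<forall>i\<in>{1..n}. ((\<lambda>s. u (x(i := s))) has_real_derivative g i) (at (x i)))"

definition tridiag_hessenberg :: "nat \<Rightarrow> complex mat set" where
  "tridiag_hessenberg n = {A \<in> carrier_mat n n. \<forall>i<n. \<forall>j<n.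
     (j = i + 1 \<longrightarrow> A $$ (i, j) = 1) \<and> (i + 1 < j \<or> j + 1 < i \<longrightarrow> A $$ (i, j) = 0)}"

text \<open>Eigenvalues are counted with algebraic multiplicity.\<close>

definition M_lam :: "nat \<Rightarrow> (nat \<Rightarrow> real) \<Rightarrow> complex mat set" where
  "M_lam n lam = {A \<in> tridiag_hessenberg n.
     char_poly A = (\<Prod>i=1..n. [:- complex_of_real (lam i), 1:])}"

definition toda_solution :: "nat \<Rightarrow> (real \<Rightarrow> complex mat) \<Rightarrow> bool" where
  "toda_solution n M \<longleftrightarrow> (\<forall>t\<ge>0. M t \<in> tridiag_hessenberg n \<and>
     has_mat_derivative n M
       (M t * strict_lower_part (M t) - strict_lower_part (M t) * M t) t)"

primrec p_fun :: "(nat \<Rightarrow> real) \<Rightarrow> triangle \<Rightarrow> nat \<Rightarrow> nat \<Rightarrow> real" where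
  "p_fun lam X 0 i = 0"
| "p_fun lam X (Suc m) i =
     (if m = 0 then lam 1
      else if i = 1 then p_fun lam X m 1 + exp (X (Suc m) 2 - X m 1)
      else if i = Suc m then lam (Suc m) - exp (X (Suc m) (Suc m) - X m m)
      else p_fun lam X m i + exp (X (Suc m) (i + 1) - X m i) - exp (X (Suc m) i - X m (i - 1)))"

definition g_map :: "nat \<Rightarrow> (nat \<Rightarrow> real) \<Rightarrow> triangle \<Rightarrow> complex mat" where
  "g_map n lam X = mat n n (\<lambda>(r, c).
     if r = c then complex_of_real (p_fun lam X n (r + 1))
     else if c = r + 1 then 1
     else if r = c + 1 then - complex_of_real (exp (X n (c + 2) - X n (c + 1)))
     else 0)"

end

(* Write u^m_i = exp (x^(m+1)_(i+1) - x^m_i) and let K_m be the identity matrix with -u^m_1, ..., -u^m_m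
   added below the diagonal, so that L_m(u^m) is the inverse of K_m. Let M_m be the tridiagonal matrix
   built from row m, with M_1 = eps and M_n = M. On T_lam the critical point equations say exactly that
   M_(m+1) K_m = K_m M_m, which gives L M = eps L; along the flow they also give
   K_m' = K_m Q_m - Q_(m+1) K_m, whence L' = L Q. T_lam is invariant because the defects of its equations
   satisfy, row by row and from right to left, homogeneous linear equations. The matrix whose m-th column
   is exp(x^m_1) L_1 ... L_(m-1) e_1 has the minors prescribed by X, hence it is b, and b' = eps b.
   The columns of L^(-1) b w0 are products of at most j - 1 bidiagonal matrices applied to e_1, hence this
   matrix is upper triangular. Finally, u_lam is squeezed between an affine function, by convexity of
   F_lam, and the smooth function obtained by moving only the bottom row of the critical triangle. *)

theory Submission
  imports Defs "HOL-Analysis.Henstock_Kurzweil_Integration" "HOL-Analysis.Function_Topology"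
begin

section \<open>The flow and the invariance of the critical set\<close>

text \<open>Several objects of the statement are definite descriptions: \<open>flow\<close>,
  \<open>f_map\<close>, \<open>X_star\<close>, \<open>w0_bar\<close>. They mean nothing until
  existence and uniqueness are settled, which accounts for the global solvability of the flow, the
  combinatorics of reduced words, the injectivity of \<open>f_map\<close> and a compactness
  argument. The flow stays elementary because it is triangular: the velocity of x^m_i involves row m
  - 1, the entry to its right in row m, and itself only through a term - h exp (x^m_i) with h \<ge>
  0, so each entry solves a scalar equation without blow-up in positive time. The critical equations
  are used in the form p^m_i = lam_(m+1) + v^m_i - u^m_i, where p^m_i is the velocity of x^m_i and
  v^m_i = exp (x^m_i - x^(m+1)_i). The matrices K_m are preferred to L_m(u^m) because they have two
  diagonals, while the entries of L_m(u^m) are products of the u. Finally, u_lam is needed at bottom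
  rows off the trajectory, where no smooth dependence of the minimiser is at hand; the squeeze
  replaces an implicit function argument.\<close>

lemma half_line_antiderivative:
  fixes f :: "real \<Rightarrow> real"
  assumes f: "continuous_on {0..} f"
  obtains F where "F 0 = 0"
    and "\<And>t. 0 \<le> t \<Longrightarrow> (F has_real_derivative f t) (at t within {0..})"
    and "\<And>t. \<forall>s\<ge>0. 0 \<le> f s \<Longrightarrow> 0 \<le> F t"
proof (rule that[of "\<lambda>t. integral {0..t} f"])
  let ?F = "\<lambda>t. integral {0..t} f"
  show "?F 0 = 0" by simp
  show "(?F has_real_derivative f t) (at t within {0..})" if t: "0 \<le> t" for t
  proof -
    \<comment> \<open>The interval ends at \<open>t+1\<close> because integrating up to
      \<open>t\<close> only would give a left-hand derivative at \<open>t\<close>.\<close>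
    have "continuous_on {0..t+1} f" using f by (rule continuous_on_subset) auto
    then have "(?F has_vector_derivative f t) (at t within {0..t+1})"
      by (rule integral_has_vector_derivative) (use t in auto)
    moreover have "at t within {0..t+1} = at t within {0..}"
      by (rule at_within_nhd[of t "{..<t+1}"]) auto
    ultimately show ?thesis by (simp add: has_real_derivative_iff_has_vector_derivative)
  qed
  \<comment> \<open>For negative \<open>t\<close> the interval is empty and the integral is 0, so
    the sign is available at every real time.\<close>
  show "0 \<le> ?F t" if "\<forall>s\<ge>0. 0 \<le> f s" for t
  proof (rule integral_nonneg)
    show "f integrable_on {0..t}"
      by (rule integrable_continuous_interval, rule continuous_on_subset[OF f]) auto
  qed (use that in auto)
qed

text \<open>The integrating factor \<open>exp (- A s)\<close> makes the product constant. It serves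
  both the uniqueness of the flow and the invariance of the critical equations.\<close>

lemma linear_ode_zero:
  fixes d a :: "real \<Rightarrow> real"
  assumes a: "continuous_on {0..} a" and d0: "d 0 = 0"
    and d: "\<And>t. 0 \<le> t \<Longrightarrow> (d has_real_derivative a t * d t) (at t within {0..})"
    and t: "0 \<le> t"
  shows "d t = 0"
proof -
  obtain A where A: "\<And>t. 0 \<le> t \<Longrightarrow> (A has_real_derivative a t) (at t within {0..})"
    using half_line_antiderivative[OF a] by metis
  have "\<exists>c. \<forall>s\<in>{0..}. exp (- A s) * d s = c"
  proof (rule has_field_derivative_zero_constant)
    show "((\<lambda>s. exp (- A s) * d s) has_real_derivative 0) (at s within {0..})"
      if "s \<in> {0..}" for s
      using that by (auto intro!: derivative_eq_intros A d simp: algebra_simps)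
  qed simp
  then have "exp (- A t) * d t = exp (- A 0) * d 0"
    using t by auto
  then show ?thesis using d0 by simp
qed

text \<open>The substitution \<open>z = exp (- y)\<close> turns \<open>y' = g - h exp y\<close> into the linear equation
  \<open>z' = h - g z\<close>, whose positive solutions exist for all times.\<close>

lemma exp_ode_exists:
  fixes g h :: "real \<Rightarrow> real"
  assumes g: "continuous_on {0..} g" and h: "continuous_on {0..} h"
    and h_nonneg: "\<And>t. 0 \<le> t \<Longrightarrow> 0 \<le> h t"
  obtains y where "y 0 = y0"
    and "\<And>t. 0 \<le> t \<Longrightarrow> (y has_real_derivative g t - h t * exp (y t)) (at t within {0..})"
proof -
  obtain G where G0: "G 0 = 0"
    and G: "\<And>t. 0 \<le> t \<Longrightarrow> (G has_real_derivative g t) (at t within {0..})"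
    using half_line_antiderivative[OF g] by metis
  have "continuous_on {0..} G"
    by (rule DERIV_continuous_on[where D = g]) (use G in auto)
  then have "continuous_on {0..} (\<lambda>t. exp (G t) * h t)"
    by (intro continuous_intros h)
  then obtain H where H0: "H 0 = 0"
    and H: "\<And>t. 0 \<le> t \<Longrightarrow> (H has_real_derivative exp (G t) * h t) (at t within {0..})"
    and Hn: "\<And>t. \<forall>s\<ge>0. 0 \<le> exp (G s) * h s \<Longrightarrow> 0 \<le> H t"
    by (rule half_line_antiderivative) blast
  have pos: "0 < exp (- y0) + H t" for t
    using Hn[of t] h_nonneg by (intro add_pos_nonneg) auto
  show ?thesis
  proof
    \<comment> \<open>This is \<open>- ln z\<close> for the variation of constants solution z = exp
      (- G) (exp (- y0) + H) of the linear equation; \<open>pos\<close> keeps the logarithm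
      defined.\<close>
    let ?y = "\<lambda>t. G t - ln (exp (- y0) + H t)"
    show "?y 0 = y0" by (simp add: G0 H0)
    show "(?y has_real_derivative g t - h t * exp (?y t)) (at t within {0..})" if "0 \<le> t" for t
    proof -
      have "(?y has_real_derivative g t - inverse (exp (- y0) + H t) * (0 + exp (G t) * h t))
          (at t within {0..})"
        by (intro DERIV_diff DERIV_chain2[OF DERIV_ln] DERIV_add DERIV_const G H that pos)
      moreover have "exp (?y t) = exp (G t) / (exp (- y0) + H t)"
        using pos[of t] by (simp add: exp_diff)
      ultimately show ?thesis by (simp add: divide_inverse mult_ac)
    qed
  qed
qed

text \<open>In the variable \<open>exp (- y)\<close> the equation is affine with inhomogeneous term
  \<open>h\<close>, which cancels from the difference of two solutions and leaves d' = - g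
  d.\<close>

lemma exp_ode_unique:
  fixes g h :: "real \<Rightarrow> real"
  assumes g: "continuous_on {0..} g"
    and y: "\<And>t. 0 \<le> t \<Longrightarrow> (y has_real_derivative g t - h t * exp (y t)) (at t within {0..})"
    and w: "\<And>t. 0 \<le> t \<Longrightarrow> (w has_real_derivative g t - h t * exp (w t)) (at t within {0..})"
    and init: "y 0 = w 0" and t: "0 \<le> t"
  shows "y t = w t"
proof -
  have "exp (- y t) - exp (- w t) = 0"
  proof (rule linear_ode_zero[where a = "\<lambda>t. - g t" and d = "\<lambda>t. exp (- y t) - exp (- w t)"])
    show "((\<lambda>t. exp (- y t) - exp (- w t)) has_real_derivative - g s * (exp (- y s) - exp (- w s)))
        (at s within {0..})" if "0 \<le> s" for s
      using that
      by (auto intro!: derivative_eq_intros y w simp: algebra_simps exp_minus)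
  qed (use g init t in \<open>auto intro!: continuous_intros\<close>)
  then show ?thesis by simp
qed

section \<open>The flow as an explicit triangular system, solved entry by entry\<close>

text \<open>The flow prescribes the velocities of a row through those of the row above. Unfolding
  this recursion produces exactly the numbers \<open>p_fun\<close>, so the implicit system becomes
  explicit and can be treated one entry at a time.\<close>

definition flow_at :: "(nat \<Rightarrow> real) \<Rightarrow> (real \<Rightarrow> triangle) \<Rightarrow> nat \<Rightarrow> nat \<Rightarrow> bool" where
  "flow_at lam X m i \<longleftrightarrow> (\<forall>t\<ge>0.
     ((\<lambda>s. X s m i) has_real_derivative p_fun lam (X t) m i) (at t within {0..}))"

lemma flow_atD:
  "flow_at lam X m i \<Longrightarrow> 0 \<le> t \<Longrightarrow>
    ((\<lambda>s. X s m i) has_real_derivative p_fun lam (X t) m i) (at t within {0..})"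
  by (simp add: flow_at_def)

text \<open>With conditional terms the ends of a row obey the same formula as its interior, so later
  proofs split on \<open>i < m\<close> and \<open>1 < i\<close> only.\<close>

lemma p_fun_rec:
  assumes "1 \<le> i" "i \<le> m"
  shows "p_fun lam X m i =
    (if i < m then p_fun lam X (m - 1) i + exp (X m (i + 1) - X (m - 1) i) else lam m)
    - (if 1 < i then exp (X m i - X (m - 1) (i - 1)) else 0)"
  using assms by (cases m) (auto simp: numeral_2_eq_2)

lemma p_fun_cong:
  assumes "\<And>m' j. 1 \<le> j \<Longrightarrow> j \<le> m' \<Longrightarrow> m' \<le> m \<Longrightarrow> X m' j = Y m' j"
    and "1 \<le> i" "i \<le> m"
  shows "p_fun lam X m i = p_fun lam Y m i"
  using assms
proof (induction m arbitrary: i)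
  case (Suc m)
  have "p_fun lam X m i = p_fun lam Y m i" if "i \<le> m"
    using Suc.IH[of i] Suc.prems that by auto
  then show ?case
    unfolding p_fun_rec[OF Suc.prems(2,3)] using Suc.prems by auto
qed simp

lemma continuous_on_p_fun:
  assumes "\<And>m' j. 1 \<le> j \<Longrightarrow> j \<le> m' \<Longrightarrow> m' \<le> m \<Longrightarrow> continuous_on S (\<lambda>s. X s m' j)"
    and "1 \<le> i" "i \<le> m"
  shows "continuous_on S (\<lambda>s. p_fun lam (X s) m i)"
  using assms
proof (induction m arbitrary: i)
  case (Suc m)
  have "continuous_on S (\<lambda>s. p_fun lam (X s) m i)" if "i \<le> m"
    using Suc.IH[of i] Suc.prems that by auto
  then show ?case
    unfolding p_fun_rec[OF Suc.prems(2,3)] using Suc.prems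
    by (cases "i < Suc m"; cases "1 < i") (auto intro!: continuous_intros)
qed simp

text \<open>Makes derivatives within \<open>{0..}\<close> unique, also at the end point 0; the value
  of \<open>tri_deriv\<close> and every comparison of matrix derivatives rest on this.\<close>

lemma within_half_line_nontrivial: "0 \<le> t \<Longrightarrow> at t within {0::real..} \<noteq> bot"
  using at_le[of "{t<..}" "{0..}" t] trivial_limit_at_right_real[of t]
  by (auto simp: greaterThan_subset_iff subset_iff bot.extremum_unique)

lemma flow_at_continuous: "flow_at lam X m i \<Longrightarrow> continuous_on {0..} (\<lambda>s. X s m i)"
  unfolding flow_at_def by (rule DERIV_continuous_on) auto

lemma flow_at_tri_deriv:
  "flow_at lam X m i \<Longrightarrow> 0 \<le> t \<Longrightarrow> tri_deriv X t m i = p_fun lam (X t) m i"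
  unfolding flow_at_def tri_deriv_def has_real_derivative_iff_has_vector_derivative
  by (intro vector_derivative_within within_half_line_nontrivial) auto

lemma flow_solution_iff:
  assumes n: "1 \<le> n"
  shows "flow_solution n lam X \<longleftrightarrow>
    (\<forall>t\<ge>0. X t \<in> triangles n) \<and> (\<forall>m i. 1 \<le> i \<and> i \<le> m \<and> m \<le> n \<longrightarrow> flow_at lam X m i)"
proof (intro iffI conjI allI impI)
  assume fs: "flow_solution n lam X"
  show "X t \<in> triangles n" if "0 \<le> t" for t
    using fs that unfolding flow_solution_def by auto
  fix m i assume mi: "1 \<le> i \<and> i \<le> m \<and> m \<le> n"
  show "flow_at lam X m i"
    unfolding flow_at_def
  proof (intro allI impI)
    fix t :: real assume t: "0 \<le> t"
    have start: "tri_deriv X t 1 1 = lam 1"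
      using fs t unfolding flow_solution_def by blast
    have edge: "tri_deriv X t m 1 = tri_deriv X t (m - 1) 1 + exp (X t m 2 - X t (m - 1) 1) \<and>
        tri_deriv X t m m = lam m - exp (X t m m - X t (m - 1) (m - 1))" if "2 \<le> m" "m \<le> n" for m
      using fs t that unfolding flow_solution_def by blast
    have inner: "tri_deriv X t m i = tri_deriv X t (m - 1) i
          + exp (X t m (i + 1) - X t (m - 1) i) - exp (X t m i - X t (m - 1) (i - 1))"
      if "1 < i" "i < m" "m \<le> n" for m i
      using fs t that unfolding flow_solution_def by blast
    have D: "tri_deriv X t m i = p_fun lam (X t) m i" if "1 \<le> i" "i \<le> m" "m \<le> n" for m i
      using that
    proof (induction m arbitrary: i)
      case (Suc m)
      show ?case
      proof (cases "m = 0")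
        case True
        then show ?thesis using start Suc.prems by (cases "i = 1") auto
      next
        case False
        consider "i = 1" | "i = Suc m" | "1 < i" "i < Suc m" using Suc.prems by linarith
        then show ?thesis
        proof cases
          case 1
          have "tri_deriv X t (Suc m) 1 = tri_deriv X t m 1 + exp (X t (Suc m) 2 - X t m 1)"
            using edge[of "Suc m"] Suc.prems False by simp
          then show ?thesis using 1 False Suc by auto
        next
          case 2
          have "tri_deriv X t (Suc m) (Suc m) = lam (Suc m) - exp (X t (Suc m) (Suc m) - X t m m)"
            using edge[of "Suc m"] Suc.prems False by simp
          then show ?thesis using 2 False by auto
        next
          case 3
          have "tri_deriv X t (Suc m) i = tri_deriv X t m i
            + exp (X t (Suc m) (i + 1) - X t m i) - exp (X t (Suc m) i - X t m (i - 1))"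
            using inner[of i "Suc m"] Suc.prems 3 by simp
          then show ?thesis using 3 False Suc by auto
        qed
      qed
    qed simp
    have "(\<lambda>s. X s m i) differentiable (at t within {0..})"
      using fs t mi unfolding flow_solution_def by blast
    then have "((\<lambda>s. X s m i) has_vector_derivative tri_deriv X t m i) (at t within {0..})"
      unfolding tri_deriv_def by (simp add: vector_derivative_works)
    then show "((\<lambda>s. X s m i) has_real_derivative p_fun lam (X t) m i) (at t within {0..})"
      using D mi by (simp add: has_real_derivative_iff_has_vector_derivative)
  qed
next
  assume "(\<forall>t\<ge>0. X t \<in> triangles n) \<and> (\<forall>m i. 1 \<le> i \<and> i \<le> m \<and> m \<le> n \<longrightarrow> flow_at lam X m i)"
  then have tri: "\<And>t. 0 \<le> t \<Longrightarrow> X t \<in> triangles n"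
    and fa: "\<And>m i. 1 \<le> i \<Longrightarrow> i \<le> m \<Longrightarrow> m \<le> n \<Longrightarrow> flow_at lam X m i" by auto
  have diff: "(\<lambda>s. X s m i) differentiable (at t within {0..})"
    if "0 \<le> t" "1 \<le> i" "i \<le> m" "m \<le> n" for t m i
    using fa[OF that(2-4)] that(1) unfolding flow_at_def
    by (meson has_field_derivative_imp_has_derivative differentiableI)
  have D: "tri_deriv X t m i = p_fun lam (X t) m i" if "0 \<le> t" "1 \<le> i" "i \<le> m" "m \<le> n" for t m i
    using flow_at_tri_deriv[OF fa] that by blast
  show "flow_solution n lam X"
    unfolding flow_solution_def
  proof (intro allI impI conjI; (elim conjE)?)
    fix t :: real and m i
    assume t: "0 \<le> t"
    show "X t \<in> triangles n" by (rule tri[OF t])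
    show "tri_deriv X t 1 1 = lam 1" using D[of t 1 1] t n by simp
    show "(\<lambda>s. X s m i) differentiable (at t within {0..})" if "1 \<le> i" "i \<le> m" "m \<le> n"
      using diff t that by blast
    show "tri_deriv X t m 1 = tri_deriv X t (m - 1) 1 + exp (X t m 2 - X t (m - 1) 1)"
      if "2 \<le> m" "m \<le> n"
      using that t D[of t 1 m] D[of t 1 "m - 1"] p_fun_rec[of 1 m lam "X t"]
      by (simp add: numeral_2_eq_2)
    show "tri_deriv X t m m = lam m - exp (X t m m - X t (m - 1) (m - 1))"
      if "2 \<le> m" "m \<le> n"
      using that t D[of t m m] p_fun_rec[of m m lam "X t"] by simp
    show "tri_deriv X t m i = tri_deriv X t (m - 1) i
          + exp (X t m (i + 1) - X t (m - 1) i) - exp (X t m i - X t (m - 1) (i - 1))"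
      if "1 < i" "i < m" "m \<le> n"
      using that t D[of t i m] D[of t i "m - 1"] p_fun_rec[of i m lam "X t"] by simp
  qed
qed

text \<open>An entry depends on the row above and on its right neighbour, so a row is filled from
  right to left; \<open>k\<close> counts the entries already in place.\<close>

lemma flow_row_exists:
  assumes rows: "\<And>m' i. 1 \<le> i \<Longrightarrow> i \<le> m' \<Longrightarrow> m' < m \<Longrightarrow> flow_at lam X m' i" and "k \<le> m"
  shows "\<exists>Y. (\<forall>t m' i. \<not> (m' = m \<and> m - k < i \<and> i \<le> m) \<longrightarrow> Y t m' i = X t m' i) \<and>
    (\<forall>i. m - k < i \<and> i \<le> m \<longrightarrow> flow_at lam Y m i \<and> Y 0 m i = X0 m i)"
  using \<open>k \<le> m\<close>
proof (induction k)
  case 0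
  show ?case by (intro exI[of _ X]) auto
next
  case (Suc k)
  obtain Y where "\<forall>t m' i. \<not> (m' = m \<and> m - k < i \<and> i \<le> m) \<longrightarrow> Y t m' i = X t m' i"
    and "\<forall>i. m - k < i \<and> i \<le> m \<longrightarrow> flow_at lam Y m i \<and> Y 0 m i = X0 m i"
    using Suc.IH Suc_leD[OF Suc.prems] by blast
  then have Y: "\<And>t m' i. \<not> (m' = m \<and> m - k < i \<and> i \<le> m) \<Longrightarrow> Y t m' i = X t m' i"
    and Yf: "\<And>i. m - k < i \<Longrightarrow> i \<le> m \<Longrightarrow> flow_at lam Y m i \<and> Y 0 m i = X0 m i"
    by blast+
  define j where "j = m - k"
  have j: "1 \<le> j" "j \<le> m" using Suc.prems by (auto simp: j_def)
  have Yrow: "Y t m' = X t m'" if "m' < m" for t m'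
    using Y that by auto
  have Yflow: "flow_at lam Y m' i" if "1 \<le> i" "i \<le> m'" "m' < m" for m' i
  proof -
    have "p_fun lam (Y t) m' i = p_fun lam (X t) m' i" for t
      by (rule p_fun_cong) (use Yrow that in auto)
    then show ?thesis using rows[OF that] Yrow[OF that(3)] by (simp add: flow_at_def)
  qed
  \<comment> \<open>The velocity of entry \<open>j\<close> splits as \<open>g - h * exp y\<close>:
    \<open>g\<close> and \<open>h\<close> contain only entries already constructed, and
    \<open>y\<close> stands for entry \<open>j\<close> itself.\<close>
  define g where "g = (\<lambda>t. if j < m then p_fun lam (Y t) (m - 1) j + exp (Y t m (j + 1) - Y t (m - 1) j) else lam m)"
  define h where "h = (\<lambda>t. if 1 < j then exp (- Y t (m - 1) (j - 1)) else 0)"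
  have g: "continuous_on {0..} g"
  proof (cases "j < m")
    case True
    then have "continuous_on {0..} (\<lambda>t. p_fun lam (Y t) (m - 1) j)"
      using j by (intro continuous_on_p_fun flow_at_continuous[OF Yflow]) auto
    moreover have "continuous_on {0..} (\<lambda>t. Y t m (j + 1))"
      by (rule flow_at_continuous, use Yf[of "j + 1"] True in \<open>auto simp: j_def\<close>)
    moreover have "continuous_on {0..} (\<lambda>t. Y t (m - 1) j)"
      using True j by (intro flow_at_continuous[OF Yflow]) auto
    ultimately show ?thesis
      using True by (auto simp: g_def intro!: continuous_intros)
  qed (simp add: g_def)
  have h: "continuous_on {0..} h"
    using j by (cases "1 < j") (auto simp: h_def intro!: continuous_intros flow_at_continuous[OF Yflow])
  have h_nonneg: "0 \<le> h t" for t by (simp add: h_def)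
  obtain y where y0: "y 0 = X0 m j"
    and y: "\<And>t. 0 \<le> t \<Longrightarrow> (y has_real_derivative g t - h t * exp (y t)) (at t within {0..})"
    by (rule exp_ode_exists[OF g h h_nonneg, of "X0 m j"]) blast
  define Z where "Z = (\<lambda>t. (Y t)(m := (Y t m)(j := y t)))"
  have Zrow': "Z t m' = Y t m'" if "m' \<noteq> m" for t m'
    using that by (simp add: Z_def)
  then have Zrow: "Z t m' = Y t m'" if "m' < m" for t m'
    using that by simp
  have Zm: "Z t m i = (if i = j then y t else Y t m i)" for t i
    by (simp add: Z_def)
  have Zp: "p_fun lam (Z t) (m - 1) i = p_fun lam (Y t) (m - 1) i" if "1 \<le> i" "i < m" for t i
    by (rule p_fun_cong) (use Zrow j that in auto)
  have Zlow: "Z t (m - 1) = Y t (m - 1)" for t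
    using Zrow j by auto
  show ?case
  proof (intro exI[of _ Z] conjI allI impI)
    show "Z t m' i = X t m' i" if "\<not> (m' = m \<and> m - Suc k < i \<and> i \<le> m)" for t m' i
      using that Y[of m' i t] Zm[of t i] Zrow'[of m' t] Suc.prems
      by (cases "m' = m") (auto simp: j_def)
    fix i assume i: "m - Suc k < i \<and> i \<le> m"
    show "Z 0 m i = X0 m i"
      using i y0 Yf[of i] Zm[of 0 i] by (cases "i = j") (auto simp: j_def)
    show "flow_at lam Z m i"
    proof (cases "i = j")
      case True
      have "p_fun lam (Z t) m j = g t - h t * exp (y t)" for t
      proof -
        have "h t * exp (y t) = (if 1 < j then exp (y t - Y t (m - 1) (j - 1)) else 0)"
          by (simp add: h_def mult_exp_exp)
        then show ?thesis
          unfolding p_fun_rec[OF j] using j by (simp add: Zp Zlow Zm g_def del: One_nat_def)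
      qed
      then show ?thesis unfolding True flow_at_def using y by (simp add: Zm)
    next
      case False
      then have ij: "j < i" using i by (auto simp: j_def)
      then have "p_fun lam (Z t) m i = p_fun lam (Y t) m i" for t
        using j i by (simp add: p_fun_rec[of i m] Zp Zlow Zm del: One_nat_def)
      moreover have "flow_at lam Y m i" using Yf[of i] ij i by (simp add: j_def)
      ultimately show ?thesis using False by (simp add: flow_at_def Zm)
    qed
  qed
qed

lemma flow_rows_exist:
  "\<exists>Y. (\<forall>m i. 1 \<le> i \<and> i \<le> m \<and> m \<le> n \<longrightarrow> flow_at lam Y m i \<and> Y 0 m i = X0 m i) \<and>
    (\<forall>t m i. \<not> (1 \<le> i \<and> i \<le> m \<and> m \<le> n) \<longrightarrow> Y t m i = 0)"
proof (induction n)
  case 0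
  show ?case by (intro exI[of _ "\<lambda>_ _ _. 0"]) auto
next
  case (Suc n)
  then obtain X where X: "\<And>m i. 1 \<le> i \<Longrightarrow> i \<le> m \<Longrightarrow> m \<le> n \<Longrightarrow> flow_at lam X m i \<and> X 0 m i = X0 m i"
    and X_out: "\<And>t m i. \<not> (1 \<le> i \<and> i \<le> m \<and> m \<le> n) \<Longrightarrow> X t m i = 0" by blast
  have "\<exists>Y. (\<forall>t m' i. \<not> (m' = Suc n \<and> Suc n - Suc n < i \<and> i \<le> Suc n) \<longrightarrow> Y t m' i = X t m' i) \<and>
    (\<forall>i. Suc n - Suc n < i \<and> i \<le> Suc n \<longrightarrow> flow_at lam Y (Suc n) i \<and> Y 0 (Suc n) i = X0 (Suc n) i)"
    by (rule flow_row_exists) (use X in auto)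
  then obtain Y where "\<forall>t m' i. \<not> (m' = Suc n \<and> Suc n - Suc n < i \<and> i \<le> Suc n) \<longrightarrow> Y t m' i = X t m' i"
    and "\<forall>i. Suc n - Suc n < i \<and> i \<le> Suc n \<longrightarrow> flow_at lam Y (Suc n) i \<and> Y 0 (Suc n) i = X0 (Suc n) i"
    by blast
  then have Y: "\<And>t m' i. \<not> (m' = Suc n \<and> 0 < i \<and> i \<le> Suc n) \<Longrightarrow> Y t m' i = X t m' i"
    and Yf: "\<And>i. 0 < i \<Longrightarrow> i \<le> Suc n \<Longrightarrow> flow_at lam Y (Suc n) i \<and> Y 0 (Suc n) i = X0 (Suc n) i"
    by simp_all
  have "flow_at lam Y m i" if "1 \<le> i" "i \<le> m" "m \<le> n" for m i
  proof -
    have "p_fun lam (Y t) m i = p_fun lam (X t) m i" for t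
      by (rule p_fun_cong) (use Y that in auto)
    moreover have "Y t m i = X t m i" for t using Y that by auto
    ultimately show ?thesis using X that by (simp add: flow_at_def)
  qed
  then show ?case
    using X Y Yf X_out by (intro exI[of _ Y]) (auto simp: le_Suc_eq)
qed

lemma flow_at_unique:
  assumes X: "\<And>m i. 1 \<le> i \<Longrightarrow> i \<le> m \<Longrightarrow> m \<le> n \<Longrightarrow> flow_at lam X m i"
    and Y: "\<And>m i. 1 \<le> i \<Longrightarrow> i \<le> m \<Longrightarrow> m \<le> n \<Longrightarrow> flow_at lam Y m i"
    and init: "\<And>m i. 1 \<le> i \<Longrightarrow> i \<le> m \<Longrightarrow> m \<le> n \<Longrightarrow> X 0 m i = Y 0 m i"
    and "1 \<le> i" "i \<le> m" "m \<le> n" "0 \<le> t"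
  shows "X t m i = Y t m i"
  using assms(4-)
proof (induction m arbitrary: i t rule: less_induct)
  case (less m)
  have low: "X t m' i = Y t m' i" if "1 \<le> i" "i \<le> m'" "m' < m" "0 \<le> t" for t m' i
    using less.IH[OF that(3,1,2) _ that(4)] that less.prems by auto
  have p_low: "p_fun lam (X t) (m - 1) i = p_fun lam (Y t) (m - 1) i"
    if "1 \<le> i" "i < m" "0 \<le> t" for t i
    by (rule p_fun_cong) (use low that in auto)
  have "X t m (m - k) = Y t m (m - k)" if "k < m" "0 \<le> t" for k t
    using that
  proof (induction k arbitrary: t rule: less_induct)
    case (less k)
    define j where "j = m - k"
    have j: "1 \<le> j" "j \<le> m" using less.prems by (auto simp: j_def)
    have next_eq: "X t m (j + 1) = Y t m (j + 1)" if "j < m" "0 \<le> t" for t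
      using less.IH[of "k - 1" t] less.prems that by (auto simp: j_def Suc_diff_le)
    define g where "g = (\<lambda>t. if j < m then p_fun lam (X t) (m - 1) j
      + exp (X t m (j + 1) - X t (m - 1) j) else lam m)"
    define h where "h = (\<lambda>t. if 1 < j then exp (- X t (m - 1) (j - 1)) else 0)"
    have cont: "continuous_on {0..} (\<lambda>t. X t m' i)" if "1 \<le> i" "i \<le> m'" "m' \<le> m" for m' i
      using X that \<open>m \<le> n\<close> by (intro flow_at_continuous[of lam]) auto
    have g: "continuous_on {0..} g"
      using j by (cases "j < m") (auto simp: g_def intro!: continuous_intros continuous_on_p_fun cont)
    have "X t m j = Y t m j"
    proof (rule exp_ode_unique[OF g, where h = h and y = "\<lambda>t. X t m j" and w = "\<lambda>t. Y t m j"])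
      fix s :: real assume s: "0 \<le> s"
      have "p_fun lam (X s) m j = g s - h s * exp (X s m j)"
        using j by (simp add: p_fun_rec[of j m] g_def h_def mult_exp_exp)
      then show "((\<lambda>t. X t m j) has_real_derivative g s - h s * exp (X s m j)) (at s within {0..})"
        using flow_atD[OF X[of j m] s] j \<open>m \<le> n\<close> by simp
      \<comment> \<open>\<open>g\<close> and \<open>h\<close> are built from \<open>X\<close>; they
        also drive \<open>Y\<close>, because the row above and the entry to the right already
        agree.\<close>
      have "p_fun lam (Y s) m j = g s - h s * exp (Y s m j)"
        unfolding p_fun_rec[OF j]
        using j s p_low[of j s] low[of "j - 1" "m - 1" s] low[of j "m - 1" s] next_eq[of s]
        by (cases "j < m"; cases "1 < j") (simp_all add: g_def h_def mult_exp_exp del: One_nat_def)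
      then show "((\<lambda>t. Y t m j) has_real_derivative g s - h s * exp (Y s m j)) (at s within {0..})"
        using flow_atD[OF Y[of j m] s] j \<open>m \<le> n\<close> by simp
    qed (use init j \<open>m \<le> n\<close> less.prems in auto)
    then show ?case by (simp add: j_def)
  qed
  from this[of "m - i" t] show ?case using less.prems by auto
qed

text \<open>\<open>flow\<close> describes the value at time \<open>t\<close> of any solution. It is
  pinned down by one solution on the whole half line together with uniqueness; entries outside the
  triangle are 0 in both.\<close>

lemma flow_eq:
  assumes n: "1 \<le> n" and X0: "X0 \<in> triangles n"
  obtains Y where "\<And>m i. 1 \<le> i \<Longrightarrow> i \<le> m \<Longrightarrow> m \<le> n \<Longrightarrow> flow_at lam Y m i"
    and "\<And>t. Y t \<in> triangles n" and "Y 0 = X0"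
    and "\<And>t. 0 \<le> t \<Longrightarrow> flow n lam t X0 = Y t"
proof -
  obtain Y where "\<forall>m i. 1 \<le> i \<and> i \<le> m \<and> m \<le> n \<longrightarrow> flow_at lam Y m i \<and> Y 0 m i = X0 m i"
    and out': "\<forall>t m i. \<not> (1 \<le> i \<and> i \<le> m \<and> m \<le> n) \<longrightarrow> Y t m i = 0"
    using flow_rows_exist by blast
  then have Y: "\<And>m i. 1 \<le> i \<Longrightarrow> i \<le> m \<Longrightarrow> m \<le> n \<Longrightarrow> flow_at lam Y m i"
    and Y0: "\<And>m i. 1 \<le> i \<Longrightarrow> i \<le> m \<Longrightarrow> m \<le> n \<Longrightarrow> Y 0 m i = X0 m i"
    by blast+
  note out = out'[rule_format]
  have tri: "Y t \<in> triangles n" for t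
    unfolding triangles_def using out' by blast
  have init: "Y 0 = X0"
  proof (intro ext)
    show "Y 0 m i = X0 m i" for m i
    proof (cases "1 \<le> i \<and> i \<le> m \<and> m \<le> n")
      case False
      then have "X0 m i = 0" using X0 unfolding triangles_def mem_Collect_eq by blast
      then show ?thesis using out[OF False] by simp
    qed (simp add: Y0)
  qed
  have "flow n lam t X0 = Y t" if t: "0 \<le> t" for t
    unfolding flow_def
  proof (rule the_equality)
    show "\<exists>X. flow_solution n lam X \<and> X 0 = X0 \<and> X t = Y t"
      using Y tri init by (auto simp: flow_solution_iff[OF n])
    fix Z assume "\<exists>X. flow_solution n lam X \<and> X 0 = X0 \<and> X t = Z"
    then obtain X where X: "\<And>m i. 1 \<le> i \<Longrightarrow> i \<le> m \<Longrightarrow> m \<le> n \<Longrightarrow> flow_at lam X m i"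
      and Xt: "X t \<in> triangles n" "X 0 = X0" "X t = Z"
      using t by (auto simp: flow_solution_iff[OF n])
    have "X t m i = Y t m i" for m i
    proof (cases "1 \<le> i \<and> i \<le> m \<and> m \<le> n")
      case True
      then show ?thesis
        using flow_at_unique[OF X Y _ _ _ _ t, where m = m and i = i] Xt(2) init by simp
    next
      case False
      then have "X t m i = 0" using Xt(1) unfolding triangles_def mem_Collect_eq by blast
      then show ?thesis using out[OF False] by simp
    qed
    then show "Z = Y t" using Xt(3) by auto
  qed
  then show thesis using that Y tri init by blast
qed


section \<open>Toda variables of the rows and the critical equations\<close>

definition tri_u :: "triangle \<Rightarrow> nat \<Rightarrow> nat \<Rightarrow> real" where
  "tri_u X m i = exp (X (m + 1) (i + 1) - X m i)"

definition tri_v :: "triangle \<Rightarrow> nat \<Rightarrow> nat \<Rightarrow> real" where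
  "tri_v X m i = exp (X m i - X (m + 1) i)"

definition tri_q :: "triangle \<Rightarrow> nat \<Rightarrow> nat \<Rightarrow> real" where
  "tri_q X m i = exp (X m (i + 1) - X m i)"

text \<open>The exponents telescope. The first two relations write the subdiagonals q of rows m and
  m + 1 through the same u and v of row m; the third will make the second subdiagonal of the matrix
  identities vanish.\<close>

lemma tri_uv_shift: "tri_u X m i * tri_v X m (i + 1) = tri_q X m i"
  and tri_uv: "tri_u X m i * tri_v X m i = tri_q X (m + 1) i"
  and tri_uq: "tri_u X m (i + 1) * tri_q X m i = tri_q X (m + 1) (i + 1) * tri_u X m i"
  by (simp_all add: tri_u_def tri_v_def tri_q_def mult_exp_exp)

lemma p_fun_u:
  assumes "1 \<le> i" "i \<le> m"
  shows "p_fun lam X m i = (if i < m then p_fun lam X (m - 1) i + tri_u X (m - 1) i else lam m)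
    - (if 1 < i then tri_u X (m - 1) (i - 1) else 0)"
  using assms by (simp add: p_fun_rec[OF assms] tri_u_def)

text \<open>The critical equation of the entry with the contributions of row m - 1 absorbed into the
  velocity \<open>p_fun\<close>. The defect of this form can be differentiated along the
  flow.\<close>

definition crit_at :: "(nat \<Rightarrow> real) \<Rightarrow> triangle \<Rightarrow> nat \<Rightarrow> nat \<Rightarrow> bool" where
  "crit_at lam X m i \<longleftrightarrow> p_fun lam X m i = lam (m + 1) + tri_v X m i - tri_u X m i"

text \<open>The recursion adds \<open>tri_u\<close> to the value from the row above, and the
  critical equation there subtracts it. What remains is a closed formula in two neighbouring
  differences.\<close>

lemma p_fun_crit:
  assumes "1 \<le> i" "i \<le> m" and "i < m \<Longrightarrow> crit_at lam X (m - 1) i"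
  shows "p_fun lam X m i = lam m + (if i < m then tri_v X (m - 1) i else 0)
    - (if 1 < i then tri_u X (m - 1) (i - 1) else 0)"
  using assms(3) assms(1,2) unfolding p_fun_u[OF assms(1,2)] crit_at_def
  by (cases "i < m") auto

lemma crit_at_iff_lr:
  assumes "1 \<le> i" "i \<le> m" and "i < m \<Longrightarrow> crit_at lam X (m - 1) i"
  shows "crit_at lam X m i \<longleftrightarrow> lam m + l_term X m i = lam (m + 1) + r_term X m i"
proof -
  have "l_term X m i = tri_u X m i + (if i < m then tri_v X (m - 1) i else 0)"
    using assms(1,2) by (simp add: l_term_def tri_u_def tri_v_def)
  moreover have "r_term X m i = tri_v X m i + (if 1 < i then tri_u X (m - 1) (i - 1) else 0)"
    using assms(1,2) by (simp add: r_term_def tri_u_def tri_v_def)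
  moreover have "p_fun lam X m i = lam m + (if i < m then tri_v X (m - 1) i else 0)
    - (if 1 < i then tri_u X (m - 1) (i - 1) else 0)"
    by (rule p_fun_crit) (use assms in auto)
  ultimately show ?thesis
    unfolding crit_at_def by auto
qed

text \<open>The two forms of an equation agree only where the equation in the row above holds, hence
  the induction on rows in one direction.\<close>

lemma T_lam_iff_crit:
  "X \<in> T_lam n lam \<longleftrightarrow>
    X \<in> triangles n \<and> (\<forall>m i. 1 \<le> i \<and> i \<le> m \<and> m < n \<longrightarrow> crit_at lam X m i)"
proof
  assume X: "X \<in> T_lam n lam"
  have "crit_at lam X m i" if "1 \<le> i" "i \<le> m" "m < n" for m i
    using that
  proof (induction m arbitrary: i)
    case (Suc m)
    have "crit_at lam X (Suc m) i \<longleftrightarrow>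
        lam (Suc m) + l_term X (Suc m) i = lam (Suc m + 1) + r_term X (Suc m) i"
      by (rule crit_at_iff_lr) (use Suc in auto)
    then show ?case
      using X Suc.prems unfolding T_lam_def by simp
  qed simp
  then show "X \<in> triangles n \<and> (\<forall>m i. 1 \<le> i \<and> i \<le> m \<and> m < n \<longrightarrow> crit_at lam X m i)"
    using X by (simp add: T_lam_def)
next
  assume X: "X \<in> triangles n \<and> (\<forall>m i. 1 \<le> i \<and> i \<le> m \<and> m < n \<longrightarrow> crit_at lam X m i)"
  have "lam m + l_term X m i = lam (m + 1) + r_term X m i" if "1 \<le> i" "i \<le> m" "m < n" for m i
  proof -
    have "crit_at lam X m i \<longleftrightarrow> lam m + l_term X m i = lam (m + 1) + r_term X m i"
      using that X[THEN conjunct2, rule_format, of i "m - 1"] by (intro crit_at_iff_lr) (auto simp: less_imp_diff_less)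
    then show ?thesis using that X by blast
  qed
  then show "X \<in> T_lam n lam" using X by (simp add: T_lam_def)
qed

lemma tri_u_deriv:
  assumes "flow_at lam X (m + 1) (i + 1)" "flow_at lam X m i" "0 \<le> t"
  shows "((\<lambda>s. tri_u (X s) m i) has_real_derivative
    tri_u (X t) m i * (p_fun lam (X t) (m + 1) (i + 1) - p_fun lam (X t) m i)) (at t within {0..})"
  unfolding tri_u_def
  by (intro DERIV_chain2[OF DERIV_exp] DERIV_diff flow_atD assms)

lemma tri_v_deriv:
  assumes "flow_at lam X (m + 1) i" "flow_at lam X m i" "0 \<le> t"
  shows "((\<lambda>s. tri_v (X s) m i) has_real_derivative
    tri_v (X t) m i * (p_fun lam (X t) m i - p_fun lam (X t) (m + 1) i)) (at t within {0..})"
  unfolding tri_v_def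
  by (intro DERIV_chain2[OF DERIV_exp] DERIV_diff flow_atD assms)

text \<open>This is the diagonal part of the Toda equations for row \<open>m\<close>. Row
  \<open>m - 1\<close> has to be critical at all times, since the closed formula for
  \<open>p_fun\<close> is differentiated in time.\<close>

lemma p_fun_deriv:
  assumes fl: "\<And>m' j. 1 \<le> j \<Longrightarrow> j \<le> m' \<Longrightarrow> m' \<le> m \<Longrightarrow> flow_at lam X m' j"
    and cr: "\<And>s j. 0 \<le> s \<Longrightarrow> 1 \<le> j \<Longrightarrow> j < m \<Longrightarrow> crit_at lam (X s) (m - 1) j"
    and i: "1 \<le> i" "i \<le> m" and t: "0 \<le> t"
  shows "((\<lambda>s. p_fun lam (X s) m i) has_real_derivative
    (if 1 < i then tri_q (X t) m (i - 1) else 0) - (if i < m then tri_q (X t) m i else 0))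
    (at t within {0..})"
proof -
  let ?p = "p_fun lam (X t)" and ?u = "tri_u (X t) (m - 1)" and ?v = "tri_v (X t) (m - 1)"
  have v: "((\<lambda>s. if i < m then tri_v (X s) (m - 1) i else 0) has_real_derivative
      (if i < m then ?v i * (?p (m - 1) i - ?p m i) else 0)) (at t within {0..})"
    using tri_v_deriv[of lam X "m - 1" i t] fl[of i m] fl[of i "m - 1"] i t by (cases "i < m") simp_all
  have u: "((\<lambda>s. if 1 < i then tri_u (X s) (m - 1) (i - 1) else 0) has_real_derivative
      (if 1 < i then ?u (i - 1) * (?p m i - ?p (m - 1) (i - 1)) else 0)) (at t within {0..})"
    using tri_u_deriv[of lam X "m - 1" "i - 1" t] fl[of i m] fl[of "i - 1" "m - 1"] i t
    by (cases "1 < i") simp_all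
  have D: "((\<lambda>s. lam m + (if i < m then tri_v (X s) (m - 1) i else 0)
      - (if 1 < i then tri_u (X s) (m - 1) (i - 1) else 0)) has_real_derivative
    0 + (if i < m then ?v i * (?p (m - 1) i - ?p m i) else 0)
      - (if 1 < i then ?u (i - 1) * (?p m i - ?p (m - 1) (i - 1)) else 0)) (at t within {0..})"
    by (intro DERIV_diff DERIV_add DERIV_const u v)
  have D': "((\<lambda>s. p_fun lam (X s) m i) has_real_derivative
    0 + (if i < m then ?v i * (?p (m - 1) i - ?p m i) else 0)
      - (if 1 < i then ?u (i - 1) * (?p m i - ?p (m - 1) (i - 1)) else 0)) (at t within {0..})"
    by (rule has_field_derivative_transform_within[OF D, of 1])
      (use t i cr p_fun_crit[OF i] in auto)
  have p1: "?p (m - 1) i - ?p m i = (if 1 < i then ?u (i - 1) else 0) - ?u i" if "i < m"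
    using that p_fun_u[OF i] by simp
  have p2: "?p m i - ?p (m - 1) (i - 1) = (if i < m then ?v i else 0) - ?v (i - 1)" if "1 < i"
    using that cr[OF t, of "i - 1"] p_fun_crit[OF i cr[OF t i(1)]] i
    by (simp add: crit_at_def)
  have q1: "?u i * ?v i = tri_q (X t) m i"
    using tri_uv[of "X t" "m - 1" i] i by simp
  have q2: "?u (i - 1) * ?v (i - 1) = tri_q (X t) m (i - 1)"
    using tri_uv[of "X t" "m - 1" "i - 1"] i by simp
  \<comment> \<open>The mixed products \<open>?u (i - 1) * ?v i\<close> cancel, and the two
    remaining ones are \<open>tri_q\<close> at i - 1 and at i.\<close>
  show ?thesis
    by (rule DERIV_cong[OF D'])
      (cases "i < m"; cases "1 < i"; simp add: p1 p2 q1[symmetric] q2[symmetric] algebra_simps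
        del: One_nat_def)
qed

text \<open>The outer induction supplies critical rows up to \<open>m - 1\<close> at all times, as
  \<open>p_fun_deriv\<close> for row \<open>m\<close> demands. The defect also involves row m + 1,
  through u and v; the velocities there come from the recursion.\<close>

lemma crit_at_invariant:
  assumes fl: "\<And>m i. 1 \<le> i \<Longrightarrow> i \<le> m \<Longrightarrow> m \<le> n \<Longrightarrow> flow_at lam X m i"
    and init: "\<And>m i. 1 \<le> i \<Longrightarrow> i \<le> m \<Longrightarrow> m < n \<Longrightarrow> crit_at lam (X 0) m i"
    and "1 \<le> i" "i \<le> m" "m < n" "0 \<le> t"
  shows "crit_at lam (X t) m i"
  using assms(3-)
proof (induction m arbitrary: i t rule: less_induct)
  case (less m)
  have low: "crit_at lam (X s) (m - 1) j" if "0 \<le> s" "1 \<le> j" "j < m" for s j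
    using less.IH[of "m - 1" j s] less.prems that by simp
  have step: "crit_at lam (X t) m j"
    if j: "1 \<le> j" "j \<le> m" and t: "0 \<le> t"
      and nxt: "\<And>s. 0 \<le> s \<Longrightarrow> j < m \<Longrightarrow> crit_at lam (X s) m (j + 1)" for j t
  proof -
    let ?p = "\<lambda>s. p_fun lam (X s)" and ?u = "\<lambda>s. tri_u (X s) m" and ?v = "\<lambda>s. tri_v (X s) m"
      and ?q = "\<lambda>s. tri_q (X s) m"
    \<comment> \<open>the defect satisfies \<open>E' = - u E\<close> because the one to its right vanishes\<close>
    let ?E = "\<lambda>s. ?p s m j - lam (m + 1) - ?v s j + ?u s j"
    have "?E t = 0"
    proof (rule linear_ode_zero[where a = "\<lambda>s. - ?u s j" and d = ?E])
      have "continuous_on {0..} (\<lambda>s. X s (m + 1) (j + 1))" "continuous_on {0..} (\<lambda>s. X s m j)"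
        using fl j less.prems by (intro flow_at_continuous[of lam]; simp)+
      then show "continuous_on {0..} (\<lambda>s. - ?u s j)"
        unfolding tri_u_def by (intro continuous_intros)
      show "?E 0 = 0"
        using init[of j m] j less.prems by (simp add: crit_at_def)
      fix s :: real assume s: "0 \<le> s"
      have D: "(?E has_real_derivative
          ((if 1 < j then ?q s (j - 1) else 0) - (if j < m then ?q s j else 0)) - 0
          - ?v s j * (?p s m j - ?p s (m + 1) j) + ?u s j * (?p s (m + 1) (j + 1) - ?p s m j))
          (at s within {0..})"
        using j s low fl less.prems
        by (intro DERIV_add DERIV_diff DERIV_const p_fun_deriv tri_v_deriv tri_u_deriv) simp_all
      have p1: "?p s (m + 1) j = ?p s m j + ?u s j - (if 1 < j then ?u s (j - 1) else 0)"
        using p_fun_u[of j "m + 1" lam "X s"] j by simp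
      \<comment> \<open>Only here does the right neighbour enter: its critical equation turns
        p^m_(j+1) + u^m_(j+1) into lam_(m+1) + v^m_(j+1). At the right end j = m the recursion
        yields lam_(m+1) directly.\<close>
      have p2: "?p s (m + 1) (j + 1) = lam (m + 1) + (if j < m then ?v s (j + 1) else 0) - ?u s j"
        using p_fun_u[of "j + 1" "m + 1" lam "X s"] nxt[OF s] j by (auto simp: crit_at_def)
      have q1: "?q s j = ?u s j * ?v s (j + 1)"
        by (simp add: tri_uv_shift[symmetric])
      have q2: "?q s (j - 1) = ?u s (j - 1) * ?v s j"
        using tri_uv_shift[of "X s" m "j - 1"] j by simp
      show "(?E has_real_derivative - ?u s j * ?E s) (at s within {0..})"
        by (rule DERIV_cong[OF D], unfold p1 p2 q1 q2)
          (cases "j < m"; cases "1 < j"; simp add: algebra_simps)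
    qed (rule t)
    then show ?thesis by (simp add: crit_at_def)
  qed
  have "crit_at lam (X t) m (m - k)" if "k < m" "0 \<le> t" for k t
    using that
  proof (induction k arbitrary: t)
    case (Suc k)
    show ?case
      by (rule step) (use Suc in \<open>auto simp: Suc_diff_Suc\<close>)
  next
    case 0
    show ?case by (rule step) (use 0 in auto)
  qed
  from this[of "m - i" t] show ?case using less.prems by auto
qed

section \<open>The matrix of the longest permutation\<close>

definition inversions :: "nat \<Rightarrow> (nat \<Rightarrow> nat) \<Rightarrow> (nat \<times> nat) set" where
  "inversions n w = {(x, y). 1 \<le> x \<and> x < y \<and> y \<le> n \<and> w y < w x}"

lemma inversions_subset: "inversions n w \<subseteq> {(x, y). 1 \<le> x \<and> x < y \<and> y \<le> n}"
  by (auto simp: inversions_def)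

lemma finite_index_pairs: "finite {(x, y). 1 \<le> x \<and> x < y \<and> y \<le> (n::nat)}"
  by (rule finite_subset[of _ "{1..n} \<times> {1..n}"]) auto

lemma finite_inversions: "finite (inversions n w)"
  using finite_subset[OF inversions_subset finite_index_pairs] .

lemma adjacent_transpose_permutes:
  "1 \<le> i \<Longrightarrow> i < n \<Longrightarrow> Transposition.transpose i (i + 1) permutes {1..n::nat}"
  by (rule permutes_swap_id) auto

text \<open>No number lies strictly between i and i + 1, so exchanging them can reverse only the
  order of this pair.\<close>

lemma transpose_less_iff:
  fixes p q i :: nat
  assumes "{p, q} \<noteq> {i, i + 1}"
  shows "Transposition.transpose i (i + 1) p < Transposition.transpose i (i + 1) q \<longleftrightarrow> p < q"
  using assms by (auto simp: Transposition.transpose_def doubleton_eq_iff)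

lemma inversions_transpose_ascent:
  assumes w: "inj w" and a: "w a = i" and b: "w b = i + 1"
    and ab: "1 \<le> a" "a < b" "b \<le> n"
  shows "inversions n (Transposition.transpose i (i + 1) \<circ> w) = insert (a, b) (inversions n w)"
    and "(a, b) \<notin> inversions n w"
proof -
  let ?s = "Transposition.transpose i (i + 1)"
  have other: "?s (w y) < ?s (w x) \<longleftrightarrow> w y < w x" if "x < y" "(x, y) \<noteq> (a, b)" for x y
  proof (rule transpose_less_iff)
    show "{w y, w x} \<noteq> {i, i + 1}"
      using that ab injD[OF w] a b by (metis doubleton_eq_iff less_asym)
  qed
  have ab': "?s (w b) < ?s (w a)" by (simp add: a b)
  show "inversions n (?s \<circ> w) = insert (a, b) (inversions n w)"
    using other ab ab' by (auto simp: inversions_def)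
  show "(a, b) \<notin> inversions n w" by (simp add: inversions_def a b)
qed

lemma inversions_transpose_descent:
  assumes w: "inj w" and a: "w a = i" and b: "w b = i + 1"
    and ba: "1 \<le> b" "b < a" "a \<le> n"
  shows "card (inversions n w) = Suc (card (inversions n (Transposition.transpose i (i + 1) \<circ> w)))"
proof -
  let ?s = "Transposition.transpose i (i + 1)"
  have "inj (?s \<circ> w)" using w by (simp add: inj_compose)
  from inversions_transpose_ascent[OF this _ _ ba, of i]
  have "inversions n (?s \<circ> (?s \<circ> w)) = insert (b, a) (inversions n (?s \<circ> w))"
    and "(b, a) \<notin> inversions n (?s \<circ> w)"
    by (simp_all add: a b)
  moreover have "?s \<circ> (?s \<circ> w) = w" by (simp add: fun_eq_iff)
  ultimately show ?thesis by (simp add: finite_inversions)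
qed

lemma permutes_ascending_id:
  assumes v: "v permutes {1..n::nat}" and asc: "\<And>i. 1 \<le> i \<Longrightarrow> i < n \<Longrightarrow> v i < v (i + 1)"
  shows "v = id"
proof -
  have range: "1 \<le> v i" "v i \<le> n" if "1 \<le> i" "i \<le> n" for i
    using permutes_in_image[OF v, of i] that by auto
  have ge: "1 \<le> i \<Longrightarrow> i \<le> n \<Longrightarrow> i \<le> v i" for i
  proof (induction i)
    case (Suc i)
    then show ?case using asc[of i] range[of "Suc i"] by (cases "i = 0") auto
  qed simp
  have le: "k < n \<Longrightarrow> v (n - k) \<le> n - k" for k
  proof (induction k)
    case (Suc k)
    have "v (n - Suc k) < v (n - Suc k + 1)" by (rule asc) (use Suc.prems in auto)
    moreover have "n - Suc k + 1 = n - k" using Suc.prems by simp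
    ultimately show ?case using Suc by simp
  qed (use range[of n] in auto)
  have "v i = i" for i
  proof (cases "1 \<le> i \<and> i \<le> n")
    case True
    then show ?thesis using ge[of i] le[of "n - i"] by auto
  next
    case False
    then show ?thesis using v by (auto intro: permutes_not_in)
  qed
  then show ?thesis by auto
qed

lemma is_word_Nil: "is_word n w [] \<longleftrightarrow> w = id"
  by (auto simp: is_word_def word_perm_def)

lemma is_word_Cons:
  "is_word n w (i # is) \<longleftrightarrow> 1 \<le> i \<and> i < n \<and>
    (\<exists>w'. is_word n w' is \<and> w = Transposition.transpose i (i + 1) \<circ> w')"
  by (auto simp: is_word_def word_perm_def)

lemma is_word_permutes: "is_word n w is \<Longrightarrow> w permutes {1..n}"
proof (induction "is" arbitrary: w)
  case (Cons i "is")
  then show ?case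
    by (auto simp: is_word_Cons intro: permutes_compose adjacent_transpose_permutes[simplified])
qed (simp add: is_word_Nil permutes_id)

lemma permutes_adjacent_values:
  assumes "w permutes {1..n::nat}" "1 \<le> i" "i < n"
  obtains a b where "a \<in> {1..n}" "b \<in> {1..n}" "w a = i" "w b = i + 1" "a \<noteq> b"
proof
  let ?a = "inv_into UNIV w i" and ?b = "inv_into UNIV w (i + 1)"
  show "?a \<in> {1..n}" "?b \<in> {1..n}"
    using assms(2,3) by (simp_all only: permutes_in_image[OF permutes_inv[OF assms(1)]]) simp_all
  show "w ?a = i" "w ?b = i + 1"
    by (simp_all only: permutes_inverses(1)[OF assms(1)])
  then show "?a \<noteq> ?b" by auto
qed

lemma inversions_Cons:
  assumes w: "w permutes {1..n}" and i: "1 \<le> i" "i < n"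
  shows "card (inversions n (Transposition.transpose i (i + 1) \<circ> w)) \<le> Suc (card (inversions n w))"
proof -
  obtain a b where ab: "a \<in> {1..n}" "b \<in> {1..n}" "w a = i" "w b = i + 1" "a \<noteq> b"
    using permutes_adjacent_values[OF w i] .
  have inj: "inj w" using w by (rule permutes_inj)
  show ?thesis
  proof (cases "a < b")
    case True
    then show ?thesis
      using inversions_transpose_ascent[OF inj ab(3,4), of n] ab by (simp add: finite_inversions)
  next
    case False
    then show ?thesis
      using inversions_transpose_descent[OF inj ab(3,4), of n] ab by simp
  qed
qed

lemma inversions_id: "inversions n id = {}"
  by (auto simp: inversions_def)

lemma word_length_ge: "is_word n w is \<Longrightarrow> card (inversions n w) \<le> length is"
proof (induction "is" arbitrary: w)
  case (Cons i "is")
  then obtain w' where i: "1 \<le> i" "i < n" and w': "is_word n w' is"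
    and w: "w = Transposition.transpose i (i + 1) \<circ> w'"
    by (auto simp: is_word_Cons)
  have "card (inversions n w) \<le> Suc (card (inversions n w'))"
    unfolding w by (rule inversions_Cons[OF is_word_permutes[OF w'] i])
  then show ?case using Cons.IH[OF w'] by simp
qed (simp add: is_word_Nil inversions_id)

text \<open>Bubble sort: while some value i + 1 stands to the left of i, composing with the
  transposition removes exactly one inversion. When no such i is left the inverse is increasing,
  hence the identity.\<close>

lemma word_exists:
  "w permutes {1..n} \<Longrightarrow> \<exists>is. is_word n w is \<and> length is = card (inversions n w)"
proof (induction "card (inversions n w)" arbitrary: w rule: less_induct)
  case less
  note w = less.prems
  show ?case
  proof (cases "\<exists>i. 1 \<le> i \<and> i < n \<and> inv_into UNIV w (i + 1) < inv_into UNIV w i")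
    case True
    then obtain i where i: "1 \<le> i" "i < n" "inv_into UNIV w (i + 1) < inv_into UNIV w i" by auto
    let ?w = "Transposition.transpose i (i + 1) \<circ> w"
    have "inv_into UNIV w i \<in> {1..n}" "inv_into UNIV w (i + 1) \<in> {1..n}"
      using i by (simp_all only: permutes_in_image[OF permutes_inv[OF w]]) simp_all
    then have card: "card (inversions n w) = Suc (card (inversions n ?w))"
      using inversions_transpose_descent[OF permutes_inj[OF w], of "inv_into UNIV w i" i "inv_into UNIV w (i + 1)" n] i(3)
      by (simp add: permutes_inverses(1)[OF w])
    have "?w permutes {1..n}"
      using w adjacent_transpose_permutes[OF i(1,2)] by (rule permutes_compose)
    then obtain "is" where "is": "is_word n ?w is" "length is = card (inversions n ?w)"
      using less.hyps[of ?w] card by auto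
    have "is_word n w (i # is)"
      unfolding is_word_Cons using i "is"(1) by (intro conjI exI[of _ ?w]) (auto simp: fun_eq_iff)
    then show ?thesis using "is"(2) card by (intro exI[of _ "i # is"]) simp
  next
    case False
    have "inv_into UNIV w = id"
    proof (rule permutes_ascending_id[OF permutes_inv[OF w]])
      fix i assume i: "1 \<le> i" "i < n"
      have "inv_into UNIV w i \<noteq> inv_into UNIV w (i + 1)"
        using permutes_inverses(1)[OF w] by (metis add_cancel_left_right zero_neq_one)
      then show "inv_into UNIV w i < inv_into UNIV w (i + 1)" using False i by force
    qed
    then have "w = id" using permutes_inv_inv[OF w] by (simp add: inv_id)
    then show ?thesis by (intro exI[of _ "[]"]) (simp add: is_word_Nil inversions_id)
  qed
qed

lemma perm_length_eq_inversions:
  assumes "w permutes {1..n}"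
  shows "perm_length n w = card (inversions n w)"
  unfolding perm_length_def
  by (rule Least_equality) (use word_exists[OF assms] word_length_ge in auto)

definition reversal :: "nat \<Rightarrow> nat \<Rightarrow> nat" where
  "reversal n j = (if 1 \<le> j \<and> j \<le> n then n + 1 - j else j)"

lemma reversal_permutes: "reversal n permutes {1..n}"
proof (rule bij_imp_permutes)
  show "bij_betw (reversal n) {1..n} {1..n}"
    by (rule bij_betw_byWitness[where f' = "reversal n"]) (auto simp: reversal_def)
qed (auto simp: reversal_def)

lemma inversions_reversal: "inversions n (reversal n) = {(x, y). 1 \<le> x \<and> x < y \<and> y \<le> n}"
  by (auto simp: inversions_def reversal_def)

text \<open>Length counts inversions, so a longest permutation inverts every pair; composed with the
  reversal it is increasing and therefore the identity.\<close>

lemma longest_perm_iff: "longest_perm n w \<longleftrightarrow> w = reversal n"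
proof
  assume "w = reversal n"
  then show "longest_perm n w"
    unfolding longest_perm_def
    using reversal_permutes card_mono[OF finite_index_pairs inversions_subset]
    by (auto simp: perm_length_eq_inversions inversions_reversal)
next
  assume lw: "longest_perm n w"
  then have w: "w permutes {1..n}" by (simp add: longest_perm_def)
  have "card (inversions n (reversal n)) \<le> card (inversions n w)"
    using lw reversal_permutes w unfolding longest_perm_def
    by (metis perm_length_eq_inversions)
  then have all: "inversions n w = {(x, y). 1 \<le> x \<and> x < y \<and> y \<le> n}"
    using card_subset_eq[OF finite_index_pairs inversions_subset]
      card_mono[OF finite_index_pairs inversions_subset] by (simp add: inversions_reversal le_antisym)
  have rr: "reversal n \<circ> reversal n = id"
    by (auto simp: reversal_def fun_eq_iff)
  have "w \<circ> reversal n = id"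
  proof (rule permutes_ascending_id[OF permutes_compose[OF reversal_permutes w]])
    fix i assume i: "1 \<le> i" "i < n"
    then have "(n - i, n + 1 - i) \<in> inversions n w" by (auto simp: all)
    then show "(w \<circ> reversal n) i < (w \<circ> reversal n) (i + 1)"
      using i by (simp add: inversions_def reversal_def)
  qed
  then have "w \<circ> (reversal n \<circ> reversal n) = reversal n"
    by (simp add: o_assoc)
  then show "w = reversal n" by (simp add: rr)
qed

text \<open>The lift of a permutation to the signed permutation matrix that the products of the
  matrices \<open>s_bar\<close> along its reduced words produce.\<close>

definition signed_perm_mat :: "nat \<Rightarrow> (nat \<Rightarrow> nat) \<Rightarrow> complex mat" where
  "signed_perm_mat n w = mat n n (\<lambda>(r, c).
     if r + 1 = w (c + 1) then (- 1) ^ card {x. (x, c + 1) \<in> inversions n w} else 0)"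

lemma single_entry_mult:
  fixes A :: "'a::comm_ring_1 mat"
  assumes "A \<in> carrier_mat n n" "r < n" "c < n" "p < n" "q < n"
  shows "(mat n n (\<lambda>(r, c). if r = p \<and> c = q then 1 else 0) * A) $$ (r, c) =
    (if r = p then A $$ (q, c) else 0)"
proof -
  have "(mat n n (\<lambda>(r, c). if r = p \<and> c = q then 1 else 0) * A) $$ (r, c) =
      (\<Sum>k = 0..<n. (if r = p \<and> k = q then 1 else 0) * A $$ (k, c))"
    using assms by (simp add: scalar_prod_def)
  also have "\<dots> = (\<Sum>k = 0..<n. if k = q then (if r = p then A $$ (k, c) else 0) else 0)"
    by (rule sum.cong) auto
  also have "\<dots> = (if r = p then A $$ (q, c) else 0)"
    using assms by simp
  finally show ?thesis .
qed

lemma e_mat_carrier [simp]: "e_mat n i \<in> carrier_mat n n"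
  and f_mat_carrier [simp]: "f_mat n i \<in> carrier_mat n n"
  and s_bar_carrier [simp]: "s_bar n i \<in> carrier_mat n n"
  by (auto simp: e_mat_def f_mat_def s_bar_def)

lemma s_bar_mult:
  assumes A: "A \<in> carrier_mat n n" and i: "1 \<le> i" "i < n" and rc: "r < n" "c < n"
  shows "(s_bar n i * A) $$ (r, c) =
    (if r = i - 1 then - A $$ (i, c) else if r = i then A $$ (i - 1, c) else A $$ (r, c))"
proof -
  let ?E = "1\<^sub>m n - e_mat n i" and ?F = "1\<^sub>m n + f_mat n i"
  have c: "?E \<in> carrier_mat n n" "?F \<in> carrier_mat n n"
    by (auto intro!: minus_carrier_mat add_carrier_mat)
  have E: "(?E * B) $$ (r, c) = B $$ (r, c) - (if r = i - 1 then B $$ (i, c) else 0)"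
    if B: "B \<in> carrier_mat n n" and "r < n" for B r
  proof -
    have "?E * B = B - e_mat n i * B"
      using B by (simp add: minus_mult_distrib_mat[of _ n n _ _ n])
    moreover have "(e_mat n i * B) $$ (r, c) = (if r = i - 1 then B $$ (i, c) else 0)"
      unfolding e_mat_def using single_entry_mult[OF B \<open>r < n\<close> rc(2)] i by simp
    moreover have "(B - e_mat n i * B) $$ (r, c) = B $$ (r, c) - (e_mat n i * B) $$ (r, c)"
      using that rc by (intro index_minus_mat) (auto simp: e_mat_def)
    ultimately show ?thesis by simp
  qed
  have F: "(?F * B) $$ (r, c) = B $$ (r, c) + (if r = i then B $$ (i - 1, c) else 0)"
    if B: "B \<in> carrier_mat n n" and "r < n" for B r
  proof -
    have "?F * B = B + f_mat n i * B"
      using B by (simp add: add_mult_distrib_mat[of _ n n _ _ n])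
    moreover have "(f_mat n i * B) $$ (r, c) = (if r = i then B $$ (i - 1, c) else 0)"
      unfolding f_mat_def using single_entry_mult[OF B \<open>r < n\<close> rc(2)] i by simp
    moreover have "(B + f_mat n i * B) $$ (r, c) = B $$ (r, c) + (f_mat n i * B) $$ (r, c)"
      using that rc by (intro index_add_mat) (auto simp: f_mat_def)
    ultimately show ?thesis by simp
  qed
  have assoc: "s_bar n i * A = ?E * (?F * (?E * A))"
    unfolding s_bar_def
    using assoc_mult_mat[OF mult_carrier_mat[OF c] c(1) A] assoc_mult_mat[OF c mult_carrier_mat[OF c(1) A]]
    by simp
  have c2: "?E * A \<in> carrier_mat n n" "?F * (?E * A) \<in> carrier_mat n n"
    by (intro mult_carrier_mat[of _ n n _ n] c A)+
  show ?thesis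
    unfolding assoc using i rc by (auto simp: E[OF c2(2)] F[OF c2(1)] E[OF A])
qed

text \<open>\<open>s_bar\<close> exchanges two rows and negates the entry that moves up. That entry
  sits in column b, which is also the column gaining the inversion (a, b), so the sign rule
  persists. In the opposite case b < a the negated column and the column losing an inversion would
  differ.\<close>

lemma s_bar_signed_perm_mat:
  assumes w: "w permutes {1..n}" and i: "1 \<le> i" "i < n"
    and ab: "1 \<le> a" "a < b" "b \<le> n" "w a = i" "w b = i + 1"
  shows "s_bar n i * signed_perm_mat n w
    = signed_perm_mat n (Transposition.transpose i (i + 1) \<circ> w)"
proof (rule eq_matI)
  let ?s = "Transposition.transpose i (i + 1)"
  let ?S = "signed_perm_mat n"
  have cS: "?S v \<in> carrier_mat n n" for v by (simp add: signed_perm_mat_def)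
  have inj: "inj w" using w by (rule permutes_inj)
  have a': "w y = i \<longleftrightarrow> y = a" and b': "w y = i + 1 \<longleftrightarrow> y = b" for y
    using ab injD[OF inj] by metis+
  have invs: "inversions n (?s \<circ> w) = insert (a, b) (inversions n w)" "(a, b) \<notin> inversions n w"
    using inversions_transpose_ascent[OF inj ab(4,5,1,2,3)] by auto
  have fin: "finite {x. (x, y) \<in> inversions n w}" for y
    by (rule finite_subset[of _ "fst ` inversions n w"]) (auto simp: finite_inversions image_iff, force)
  have cnt_other: "{x. (x, y) \<in> inversions n (?s \<circ> w)} = {x. (x, y) \<in> inversions n w}" if "y \<noteq> b" for y
    using that unfolding invs(1) by auto
  have "{x. (x, b) \<in> inversions n (?s \<circ> w)} = insert a {x. (x, b) \<in> inversions n w}"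
    unfolding invs(1) by auto
  then have cnt_b: "card {x. (x, b) \<in> inversions n (?s \<circ> w)} = Suc (card {x. (x, b) \<in> inversions n w})"
    using fin invs(2) by simp
  fix r c assume "r < dim_row (?S (?s \<circ> w))" "c < dim_col (?S (?s \<circ> w))"
  then have rc: "r < n" "c < n" by (simp_all add: signed_perm_mat_def)
  have lhs: "(s_bar n i * ?S w) $$ (r, c) =
    (if r = i - 1 then - ?S w $$ (i, c) else if r = i then ?S w $$ (i - 1, c) else ?S w $$ (r, c))"
    by (rule s_bar_mult[OF cS i rc])
  consider "c + 1 = a" | "c + 1 = b" | "c + 1 \<noteq> a" "c + 1 \<noteq> b" by blast
  then show "(s_bar n i * ?S w) $$ (r, c) = ?S (?s \<circ> w) $$ (r, c)"
  proof cases
    case 1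
    then have "w (c + 1) = i" "c + 1 \<noteq> b" using ab by auto
    then show ?thesis
      unfolding lhs using rc i cnt_other[of "c + 1"] by (auto simp: signed_perm_mat_def)
  next
    case 2
    then have "w (c + 1) = i + 1" using ab by auto
    then show ?thesis
      unfolding lhs using rc i cnt_b 2 by (auto simp: signed_perm_mat_def)
  next
    case 3
    then have "w (c + 1) \<noteq> i" "w (c + 1) \<noteq> i + 1" using a' b' by auto
    then show ?thesis
      unfolding lhs using rc i cnt_other[of "c + 1"] 3
      by (auto simp: signed_perm_mat_def Transposition.transpose_def)
  qed
qed (auto simp: signed_perm_mat_def s_bar_def e_mat_def)

lemma signed_perm_mat_id: "signed_perm_mat n id = 1\<^sub>m n"
  by (rule eq_matI) (simp_all add: signed_perm_mat_def inversions_id)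

text \<open>The lower bound on word lengths forces the tail of a reduced word to be reduced and each
  letter to create an inversion, so only length-increasing steps occur. As the result depends on
  \<open>w\<close> alone, so does the product, without any appeal to braid relations.\<close>

lemma reduced_word_prod:
  "is_word n w is \<Longrightarrow> length is = card (inversions n w) \<Longrightarrow>
    ordered_prod n (map (s_bar n) is) = signed_perm_mat n w"
proof (induction "is" arbitrary: w)
  case Nil
  then show ?case
    by (simp add: is_word_Nil ordered_prod_def signed_perm_mat_id[unfolded id_def] id_def)
next
  case (Cons i "is")
  then obtain w' where i: "1 \<le> i" "i < n" and w': "is_word n w' is"
    and w: "w = Transposition.transpose i (i + 1) \<circ> w'"
    by (auto simp: is_word_Cons)
  have perm: "w' permutes {1..n}" using w' by (rule is_word_permutes)
  have "card (inversions n w) \<le> Suc (card (inversions n w'))"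
    unfolding w by (rule inversions_Cons[OF perm i])
  then have len: "length is = card (inversions n w')"
    using word_length_ge[OF w'] Cons.prems(2) by simp
  obtain a b where ab: "a \<in> {1..n}" "b \<in> {1..n}" "w' a = i" "w' b = i + 1" "a \<noteq> b"
    using permutes_adjacent_values[OF perm i] .
  have "a < b"
  proof (rule ccontr)
    assume "\<not> a < b"
    then have "card (inversions n w') = Suc (card (inversions n w))"
      unfolding w using inversions_transpose_descent[OF permutes_inj[OF perm] ab(3,4), of n] ab by simp
    then show False using len Cons.prems(2) by simp
  qed
  have "ordered_prod n (map (s_bar n) (i # is)) = s_bar n i * signed_perm_mat n w'"
    using Cons.IH[OF w' len] by (simp add: ordered_prod_def)
  also have "\<dots> = signed_perm_mat n w"
    unfolding w using ab \<open>a < b\<close> by (intro s_bar_signed_perm_mat[OF perm i]) auto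
  finally show ?case .
qed

lemma ordered_prod_carrier:
  "(\<And>A. A \<in> set As \<Longrightarrow> A \<in> carrier_mat n n) \<Longrightarrow> ordered_prod n As \<in> carrier_mat n n"
  by (induction As) (auto simp: ordered_prod_def intro!: mult_carrier_mat[of _ n n _ n])

lemma det_ordered_prod:
  assumes "\<And>A. A \<in> set As \<Longrightarrow> A \<in> carrier_mat n n" "\<And>A. A \<in> set As \<Longrightarrow> det A = 1"
  shows "det (ordered_prod n As) = 1"
  using assms
proof (induction As)
  case (Cons A As)
  have "ordered_prod n As \<in> carrier_mat n n"
    by (rule ordered_prod_carrier) (use Cons in auto)
  then have "det (A * ordered_prod n As) = det A * det (ordered_prod n As)"
    using Cons.prems(1) by (intro det_mult) auto
  then show ?case using Cons by (simp add: ordered_prod_def)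
qed (simp add: ordered_prod_def)

lemma prod_list_diag_mat_one:
  assumes "\<And>i. i < n \<Longrightarrow> A $$ (i, i) = 1" "A \<in> carrier_mat n n"
  shows "prod_list (diag_mat A) = (1::'a::comm_ring_1)"
proof -
  have "diag_mat A = replicate n 1"
    using assms by (intro nth_equalityI) (auto simp: diag_mat_def)
  then show ?thesis by simp
qed

lemma det_s_bar:
  assumes "1 \<le> i"
  shows "det (s_bar n i) = 1"
proof -
  have E: "1\<^sub>m n - e_mat n i \<in> carrier_mat n n" and F: "1\<^sub>m n + f_mat n i \<in> carrier_mat n n"
    by (auto intro!: minus_carrier_mat add_carrier_mat)
  have "upper_triangular (1\<^sub>m n - e_mat n i)"
    by (rule upper_triangularI) (use assms in \<open>auto simp: e_mat_def\<close>)
  then have "det (1\<^sub>m n - e_mat n i) = prod_list (diag_mat (1\<^sub>m n - e_mat n i))"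
    using E by (rule det_upper_triangular)
  also have "\<dots> = 1"
    by (rule prod_list_diag_mat_one[OF _ E]) (use assms in \<open>auto simp: e_mat_def\<close>)
  finally have detE: "det (1\<^sub>m n - e_mat n i) = 1" .
  have "det (1\<^sub>m n + f_mat n i) = prod_list (diag_mat (1\<^sub>m n + f_mat n i))"
    by (rule det_lower_triangular[OF _ F]) (auto simp: f_mat_def)
  also have "\<dots> = 1"
    by (rule prod_list_diag_mat_one[OF _ F]) (use assms in \<open>auto simp: f_mat_def\<close>)
  finally have detF: "det (1\<^sub>m n + f_mat n i) = 1" .
  show ?thesis
    unfolding s_bar_def
    using det_mult[OF mult_carrier_mat[OF E F] E] det_mult[OF E F] detE detF by simp
qed

definition w0_mat :: "nat \<Rightarrow> complex mat" where
  "w0_mat n = mat n n (\<lambda>(r, c). if r + c + 1 = n then (- 1) ^ c else 0)"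

text \<open>Position c + 1 of the reversal closes c inversions, whence the sign (-1)^c. The
  determinant is read off the factorisation into \<open>s_bar\<close>; it is later applied in every
  size k to the minors.\<close>

lemma w0_bar_eq: "w0_bar n = w0_mat n" and det_w0_bar: "det (w0_bar n) = 1"
proof -
  obtain "is" where "is": "is_word n (reversal n) is" "length is = card (inversions n (reversal n))"
    using word_exists[OF reversal_permutes] by blast
  have w: "w0_bar n = signed_perm_mat n (reversal n)"
    unfolding w0_bar_def
  proof (rule the_equality)
    show "\<exists>w is. longest_perm n w \<and> reduced_word n w is \<and>
        signed_perm_mat n (reversal n) = ordered_prod n (map (s_bar n) is)"
      using "is" reduced_word_prod[OF "is"]
      by (intro exI[of _ "reversal n"] exI[of _ "is"])
        (simp add: longest_perm_iff reduced_word_def perm_length_eq_inversions[OF reversal_permutes])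
    show "W = signed_perm_mat n (reversal n)"
      if "\<exists>w is. longest_perm n w \<and> reduced_word n w is \<and> W = ordered_prod n (map (s_bar n) is)" for W
      using that
      by (auto simp: longest_perm_iff reduced_word_def perm_length_eq_inversions[OF reversal_permutes]
          reduced_word_prod)
  qed
  have "set is \<subseteq> {1..<n}" using "is"(1) by (simp add: is_word_def)
  then show "det (w0_bar n) = 1"
    unfolding w reduced_word_prod[OF "is", symmetric]
    by (intro det_ordered_prod) (auto intro!: det_s_bar)
  have "signed_perm_mat n (reversal n) = mat n n (\<lambda>(r, c). if r + c + 1 = n then (- 1) ^ c else 0)"
  proof (rule eq_matI)
    fix r c
    assume "r < dim_row (mat n n (\<lambda>(r, c). if r + c + 1 = n then (- 1) ^ c else (0::complex)))"
      "c < dim_col (mat n n (\<lambda>(r, c). if r + c + 1 = n then (- 1) ^ c else (0::complex)))"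
    then have rc: "r < n" "c < n" by auto
    have "{x. (x, c + 1) \<in> inversions n (reversal n)} = {1..c}"
      using rc by (auto simp: inversions_reversal)
    moreover have "r + 1 = reversal n (c + 1) \<longleftrightarrow> r + c + 1 = n"
      using rc by (auto simp: reversal_def)
    ultimately show "signed_perm_mat n (reversal n) $$ (r, c) =
        mat n n (\<lambda>(r, c). if r + c + 1 = n then (- 1) ^ c else 0) $$ (r, c)"
      using rc by (simp add: signed_perm_mat_def)
  qed (auto simp: signed_perm_mat_def)
  then show "w0_bar n = w0_mat n" by (simp add: w w0_mat_def)
qed

section \<open>Bidiagonal factors and the Toda matrix\<close>

lemma index_mult_mat_sum:
  fixes A :: "'a::comm_semiring_0 mat"
  assumes "A \<in> carrier_mat n n" "B \<in> carrier_mat n n" "i < n" "j < n"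
  shows "(A * B) $$ (i, j) = (\<Sum>k<n. A $$ (i, k) * B $$ (k, j))"
  using assms by (simp add: scalar_prod_def atLeast0LessThan)

lemma has_mat_derivative_cong:
  assumes "has_mat_derivative n A D t" "\<And>s. 0 \<le> s \<Longrightarrow> A s = B s" "0 \<le> t"
  shows "has_mat_derivative n B D t"
  unfolding has_mat_derivative_def
proof (intro allI impI)
  fix i j assume "i < n" "j < n"
  then show "((\<lambda>s. B s $$ (i, j)) has_vector_derivative D $$ (i, j)) (at t within {0..})"
    using assms unfolding has_mat_derivative_def
    by (intro has_vector_derivative_transform[of t "{0..}" "\<lambda>s. B s $$ (i, j)" "\<lambda>s. A s $$ (i, j)"]) auto
qed

lemma has_mat_derivative_const:
  "A \<in> carrier_mat n n \<Longrightarrow> has_mat_derivative n (\<lambda>s. A) (0\<^sub>m n n) t"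
  unfolding has_mat_derivative_def by simp

lemma has_mat_derivative_mult:
  assumes "\<And>s. A s \<in> carrier_mat n n" "\<And>s. B s \<in> carrier_mat n n"
    and "A' \<in> carrier_mat n n" "B' \<in> carrier_mat n n"
    and "has_mat_derivative n A A' t" "has_mat_derivative n B B' t"
  shows "has_mat_derivative n (\<lambda>s. A s * B s) (A' * B t + A t * B') t"
  unfolding has_mat_derivative_def
proof (intro allI impI)
  fix i j assume ij: "i < n" "j < n"
  have "((\<lambda>s. \<Sum>k<n. A s $$ (i, k) * B s $$ (k, j)) has_vector_derivative
      (\<Sum>k<n. A t $$ (i, k) * B' $$ (k, j) + A' $$ (i, k) * B t $$ (k, j))) (at t within {0..})"
    using assms(5,6) ij unfolding has_mat_derivative_def
    by (intro has_vector_derivative_sum has_vector_derivative_mult) auto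
  moreover have "(A' * B t + A t * B') $$ (i, j) =
      (\<Sum>k<n. A t $$ (i, k) * B' $$ (k, j) + A' $$ (i, k) * B t $$ (k, j))"
  proof -
    have c: "A t * B' \<in> carrier_mat n n" "A' * B t \<in> carrier_mat n n"
      using assms(1-4) by (auto intro!: mult_carrier_mat[of _ n n _ n])
    then have "(A' * B t + A t * B') $$ (i, j) = (A' * B t) $$ (i, j) + (A t * B') $$ (i, j)"
      using ij by (intro index_add_mat) auto
    then show ?thesis
      using assms(1-4) ij by (simp add: index_mult_mat_sum[of _ n] sum.distrib del: index_mult_mat)
  qed
  ultimately show "((\<lambda>s. (A s * B s) $$ (i, j)) has_vector_derivative
      (A' * B t + A t * B') $$ (i, j)) (at t within {0..})"
    using assms(1,2) ij by (simp add: index_mult_mat_sum[of _ n] del: index_mult_mat index_add_mat)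
qed

lemma has_mat_derivative_unique:
  assumes "has_mat_derivative n A D t" "has_mat_derivative n A E t" "0 \<le> t"
    and "D \<in> carrier_mat n n" "E \<in> carrier_mat n n"
  shows "D = E"
proof (rule eq_matI)
  fix i j assume "i < dim_row E" "j < dim_col E"
  then show "D $$ (i, j) = E $$ (i, j)"
    using assms vector_derivative_unique_within[OF within_half_line_nontrivial[OF assms(3)]]
    unfolding has_mat_derivative_def by blast
qed (use assms in auto)

lemma lower_unitri_carrier: "A \<in> lower_unitri n \<Longrightarrow> A \<in> carrier_mat n n"
  by (simp add: lower_unitri_def)

lemma lower_unitri_one: "1\<^sub>m n \<in> lower_unitri n"
  by (auto simp: lower_unitri_def)

lemma lower_unitri_mult:
  assumes A: "A \<in> lower_unitri n" and B: "B \<in> lower_unitri n"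
  shows "A * B \<in> lower_unitri n"
proof -
  have c: "A \<in> carrier_mat n n" "B \<in> carrier_mat n n"
    using A B by (auto simp: lower_unitri_def)
  have zero: "A $$ (i, k) * B $$ (k, j) = 0" if "i < n" "j < n" "k < n" "i < k \<or> k < j" for i j k
    using A B that by (auto simp: lower_unitri_def)
  have "(A * B) $$ (i, j) = 0" if "i < n" "j < n" "i < j" for i j
    unfolding index_mult_mat_sum[OF c that(1,2)]
  proof (rule sum.neutral, rule ballI)
    fix k assume "k \<in> {..<n}"
    moreover have "i < k \<or> k < j" using that(3) by linarith
    ultimately show "A $$ (i, k) * B $$ (k, j) = 0" using zero that(1,2) by simp
  qed
  moreover have "(A * B) $$ (i, i) = 1" if "i < n" for i
  proof -
    have "(A * B) $$ (i, i) = (\<Sum>k<n. if k = i then 1 else 0)"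
      unfolding index_mult_mat_sum[OF c that that]
      by (rule sum.cong) (use zero[of i i] that A B in \<open>auto simp: lower_unitri_def nat_neq_iff\<close>)
    then show ?thesis using that by simp
  qed
  ultimately show ?thesis using c by (auto simp: lower_unitri_def)
qed

section \<open>Bidiagonal matrices and the products of the factors\<close>

text \<open>With rows numbered from 0, row \<open>r\<close> carries \<open>u r\<close>: the place
  (r, r - 1) is the position (r + 1, r) occupied by the entry of \<open>f_mat n r\<close>.\<close>

definition bidiag_mat :: "nat \<Rightarrow> nat \<Rightarrow> (nat \<Rightarrow> complex) \<Rightarrow> complex mat" where
  "bidiag_mat n m u = mat n n (\<lambda>(r, c). if r = c then 1 else if r = c + 1 \<and> r \<le> m then - u r else 0)"

lemma bidiag_mat_carrier [simp]: "bidiag_mat n m u \<in> carrier_mat n n"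
  by (simp add: bidiag_mat_def)

lemma bidiag_mat_lower_unitri: "bidiag_mat n m u \<in> lower_unitri n"
  by (auto simp: bidiag_mat_def lower_unitri_def)

lemma bidiag_mat_mult:
  assumes A: "A \<in> carrier_mat n n" and rc: "r < n" "c < n"
  shows "(bidiag_mat n m u * A) $$ (r, c) =
    A $$ (r, c) - (if 1 \<le> r \<and> r \<le> m then u r * A $$ (r - 1, c) else 0)"
proof -
  have "(bidiag_mat n m u * A) $$ (r, c) = (\<Sum>k<n. (if k = r then A $$ (k, c) else 0)
      - (if k = r - 1 then (if 1 \<le> r \<and> r \<le> m then u r * A $$ (k, c) else 0) else 0))"
    unfolding index_mult_mat_sum[OF bidiag_mat_carrier A rc]
    by (rule sum.cong) (use rc in \<open>auto simp: bidiag_mat_def\<close>)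
  then show ?thesis using rc by (simp add: sum_subtractf less_imp_diff_less)
qed

lemma mult_bidiag_mat:
  assumes A: "A \<in> carrier_mat n n" and rc: "r < n" "c < n" and m: "m < n"
  shows "(A * bidiag_mat n m u) $$ (r, c) =
    A $$ (r, c) - (if c + 1 \<le> m then A $$ (r, c + 1) * u (c + 1) else 0)"
proof -
  have "(A * bidiag_mat n m u) $$ (r, c) = (\<Sum>k<n. (if k = c then A $$ (r, k) else 0)
      - (if k = c + 1 then (if c + 1 \<le> m then A $$ (r, k) * u k else 0) else 0))"
    unfolding index_mult_mat_sum[OF A bidiag_mat_carrier rc]
    by (rule sum.cong) (use rc in \<open>auto simp: bidiag_mat_def\<close>)
  then show ?thesis using rc m by (simp add: sum_subtractf)
qed

lemma l_mat_carrier [simp]: "l_mat n i a \<in> carrier_mat n n"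
  by (simp add: l_mat_def f_mat_def)

lemma l_mat_mult:
  assumes A: "A \<in> carrier_mat n n" and i: "1 \<le> i" "i < n" and rc: "r < n" "c < n"
  shows "(l_mat n i a * A) $$ (r, c) = A $$ (r, c) + (if r = i then a * A $$ (i - 1, c) else 0)"
proof -
  have "(l_mat n i a * A) $$ (r, c) = (\<Sum>k<n. (if k = r then A $$ (k, c) else 0)
      + (if k = i - 1 then (if r = i then a * A $$ (k, c) else 0) else 0))"
    unfolding index_mult_mat_sum[OF l_mat_carrier A rc]
    by (rule sum.cong) (use rc i in \<open>auto simp: l_mat_def f_mat_def\<close>)
  then show ?thesis using rc i by (simp add: sum.distrib less_imp_diff_less)
qed

lemma L_mat_0: "L_mat n 0 u = 1\<^sub>m n"
  by (simp add: L_mat_def ordered_prod_def)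

lemma L_mat_Suc: "L_mat n (Suc m) u = l_mat n (Suc m) (u (Suc m)) * L_mat n m u"
  by (simp add: L_mat_def ordered_prod_def)

lemma L_mat_carrier [simp]: "L_mat n m u \<in> carrier_mat n n"
  by (induction m) (auto simp: L_mat_0 L_mat_Suc intro!: mult_carrier_mat[of _ n n _ n])

text \<open>Both factors act by row operations: the new row of \<open>bidiag_mat\<close> subtracts
  exactly the multiple of the preceding row that the new \<open>l_mat\<close> adds.\<close>

lemma bidiag_mult_L_mat:
  assumes "m < n"
  shows "bidiag_mat n m u * L_mat n m u = 1\<^sub>m n"
  using assms
proof (induction m)
  case 0
  have "bidiag_mat n 0 u = 1\<^sub>m n" by (rule eq_matI) (auto simp: bidiag_mat_def)
  then show ?case by (simp add: L_mat_0)
next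
  case (Suc m)
  show ?case
  proof (rule eq_matI)
    fix r c assume "r < dim_row (1\<^sub>m n :: complex mat)" "c < dim_col (1\<^sub>m n :: complex mat)"
    then have rc: "r < n" "c < n" by simp_all
    have L: "L_mat n (Suc m) u $$ (r, c) =
        L_mat n m u $$ (r, c) + (if r = Suc m then u (Suc m) * L_mat n m u $$ (m, c) else 0)"
      if "r < n" for r
      unfolding L_mat_Suc using l_mat_mult[OF L_mat_carrier _ Suc.prems that rc(2)] by simp
    have "(bidiag_mat n (Suc m) u * L_mat n (Suc m) u) $$ (r, c) =
        (bidiag_mat n m u * L_mat n m u) $$ (r, c)"
      unfolding bidiag_mat_mult[OF L_mat_carrier rc] using rc by (auto simp: L le_Suc_eq)
    also have "\<dots> = 1\<^sub>m n $$ (r, c)" using Suc by simp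
    finally show "(bidiag_mat n (Suc m) u * L_mat n (Suc m) u) $$ (r, c) = 1\<^sub>m n $$ (r, c)" .
  qed (auto simp: bidiag_mat_def carrier_matD[OF L_mat_carrier])
qed

lemma L_mat_mult_bidiag:
  "m < n \<Longrightarrow> L_mat n m u * bidiag_mat n m u = 1\<^sub>m n"
  by (rule mat_mult_left_right_inverse[OF bidiag_mat_carrier L_mat_carrier bidiag_mult_L_mat])

lemma l_mat_lower_unitri:
  assumes "1 \<le> i"
  shows "l_mat n i a \<in> lower_unitri n"
  using assms by (auto simp: l_mat_def f_mat_def lower_unitri_def)

lemma L_mat_lower_unitri: "L_mat n m u \<in> lower_unitri n"
  by (induction m)
    (simp_all add: L_mat_0 L_mat_Suc lower_unitri_one lower_unitri_mult l_mat_lower_unitri)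

abbreviation tri_uc :: "triangle \<Rightarrow> nat \<Rightarrow> nat \<Rightarrow> complex" where
  "tri_uc X m \<equiv> (\<lambda>i. complex_of_real (tri_u X m i))"

primrec lower_prod :: "nat \<Rightarrow> triangle \<Rightarrow> nat \<Rightarrow> complex mat" where
  "lower_prod n X 0 = 1\<^sub>m n"
| "lower_prod n X (Suc m) = lower_prod n X m * L_mat n (Suc m) (tri_uc X (Suc m))"

text \<open>The inverse is defined as a product of bidiagonal matrices in reverse order, so that its
  time derivative follows from the product rule.\<close>

primrec lower_prod_inv :: "nat \<Rightarrow> triangle \<Rightarrow> nat \<Rightarrow> complex mat" where
  "lower_prod_inv n X 0 = 1\<^sub>m n"
| "lower_prod_inv n X (Suc m) = bidiag_mat n (Suc m) (tri_uc X (Suc m)) * lower_prod_inv n X m"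

lemma lower_prod_unitri: "lower_prod n X m \<in> lower_unitri n"
  by (induction m) (auto intro: lower_unitri_one lower_unitri_mult L_mat_lower_unitri)

lemma lower_prod_inv_unitri: "lower_prod_inv n X m \<in> lower_unitri n"
  by (induction m) (auto intro: lower_unitri_one lower_unitri_mult bidiag_mat_lower_unitri)

lemmas lower_prod_carrier [simp] = lower_unitri_carrier[OF lower_prod_unitri]
lemmas lower_prod_inv_carrier [simp] = lower_unitri_carrier[OF lower_prod_inv_unitri]

lemma ordered_prod_snoc:
  assumes "\<And>B. B \<in> set As \<Longrightarrow> B \<in> carrier_mat n n" "A \<in> carrier_mat n n"
  shows "ordered_prod n (As @ [A]) = ordered_prod n As * A"
  using assms
proof (induction As)
  case (Cons B As)
  have "ordered_prod n As \<in> carrier_mat n n"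
    by (rule ordered_prod_carrier) (use Cons in auto)
  then have "B * ordered_prod n As * A = B * (ordered_prod n As * A)"
    using Cons.prems by (intro assoc_mult_mat[of _ n n _ n _ n]) auto
  then show ?case using Cons by (simp add: ordered_prod_def)
qed (simp add: ordered_prod_def)

lemma lower_prod_eq:
  "ordered_prod n (map (\<lambda>m. L_mat n m (tri_uc X m)) [1..<Suc m]) = lower_prod n X m"
proof (induction m)
  case (Suc m)
  have "ordered_prod n (map (\<lambda>m. L_mat n m (tri_uc X m)) [1..<Suc m] @ [L_mat n (Suc m) (tri_uc X (Suc m))])
      = ordered_prod n (map (\<lambda>m. L_mat n m (tri_uc X m)) [1..<Suc m]) * L_mat n (Suc m) (tri_uc X (Suc m))"
    by (rule ordered_prod_snoc) auto
  then show ?case using Suc by simp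
qed (simp add: ordered_prod_def)

lemma lower_prod_inverse:
  "m < n \<Longrightarrow> lower_prod_inv n X m * lower_prod n X m = 1\<^sub>m n"
proof (induction m)
  case (Suc m)
  let ?K = "bidiag_mat n (Suc m) (tri_uc X (Suc m))" and ?T = "L_mat n (Suc m) (tri_uc X (Suc m))"
  let ?L = "lower_prod n X m" and ?I = "lower_prod_inv n X m"
  have "?K * ?I * (?L * ?T) = ?K * (?I * ?L) * ?T"
    by (simp add: assoc_mult_mat[of _ n n _ n _ n] mult_carrier_mat[of _ n n _ n])
  also have "\<dots> = 1\<^sub>m n"
    using Suc by (simp add: bidiag_mult_L_mat right_mult_one_mat[OF bidiag_mat_carrier])
  finally show ?case by simp
qed simp

lemma lower_prod_inverse':
  "m < n \<Longrightarrow> lower_prod n X m * lower_prod_inv n X m = 1\<^sub>m n"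
  by (rule mat_mult_left_right_inverse[OF lower_prod_inv_carrier lower_prod_carrier lower_prod_inverse])

section \<open>Toda matrices of the rows and their intertwining\<close>

text \<open>The Toda matrix of row \<open>m\<close> fills the upper left block of size m, and
  \<open>eps_mat\<close> supplies the rest of the diagonal and the superdiagonal, so that all rows
  yield matrices of the same size.\<close>

definition toda_mat :: "nat \<Rightarrow> (nat \<Rightarrow> real) \<Rightarrow> triangle \<Rightarrow> nat \<Rightarrow> complex mat" where
  "toda_mat n lam X m = mat n n (\<lambda>(r, c).
     if r = c then complex_of_real (if r < m then p_fun lam X m (r + 1) else lam (r + 1))
     else if c = r + 1 then 1
     else if r = c + 1 \<and> r < m then - complex_of_real (tri_q X m r) else 0)"

definition toda_lower :: "nat \<Rightarrow> triangle \<Rightarrow> nat \<Rightarrow> complex mat" where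
  "toda_lower n X m = mat n n (\<lambda>(r, c).
     if r = c + 1 \<and> r < m then - complex_of_real (tri_q X m r) else 0)"

lemma toda_mat_carrier [simp]: "toda_mat n lam X m \<in> carrier_mat n n"
  and toda_lower_carrier [simp]: "toda_lower n X m \<in> carrier_mat n n"
  by (simp_all add: toda_mat_def toda_lower_def)

lemma toda_mat_1: "toda_mat n lam X 1 = eps_mat n lam"
  by (rule eq_matI) (auto simp: toda_mat_def eps_mat_def)

lemma toda_mat_n: "toda_mat n lam X n = g_map n lam X"
  by (rule eq_matI) (auto simp: toda_mat_def g_map_def tri_q_def)

lemma strict_lower_part_toda: "strict_lower_part (toda_mat n lam X m) = toda_lower n X m"
  by (rule eq_matI) (auto simp: toda_mat_def toda_lower_def strict_lower_part_def)

text \<open>One relation with two uses: it is the first subdiagonal of the intertwining identity,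
  and it turns u' = u (p^(m+1)_(i+1) - p^m_i) into a difference of two q.\<close>

lemma crit_at_sub:
  assumes i: "1 \<le> i" "i \<le> m" and crit: "crit_at lam X m i" "i < m \<Longrightarrow> crit_at lam X m (i + 1)"
  shows "tri_q X (Suc m) i + p_fun lam X (Suc m) (i + 1) * tri_u X m i
    = (if i < m then tri_q X m i else 0) + tri_u X m i * p_fun lam X m i"
proof -
  have p1: "p_fun lam X (Suc m) (i + 1)
      = lam (Suc m) + (if i < m then tri_v X m (i + 1) else 0) - tri_u X m i"
    using p_fun_u[of "i + 1" "Suc m" lam X] crit(2) i by (auto simp: crit_at_def simp del: p_fun.simps)
  have p0: "p_fun lam X m i = lam (Suc m) + tri_v X m i - tri_u X m i"
    using crit(1) by (simp add: crit_at_def)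
  have q: "tri_q X m i = tri_u X m i * tri_v X m (i + 1)" "tri_q X (Suc m) i = tri_u X m i * tri_v X m i"
    using tri_uv_shift[of X m i] tri_uv[of X m i] by simp_all
  show ?thesis unfolding p1 p0 q by (cases "i < m") (simp_all add: algebra_simps)
qed

text \<open>The identity is checked band by band. On the diagonal it is the recursion for
  \<open>p_fun\<close>, on the first subdiagonal \<open>crit_at_sub\<close>, on the second
  \<open>tri_uq\<close>; only the first subdiagonal uses the critical equations.\<close>

lemma toda_mat_intertwine:
  assumes m: "1 \<le> m" "m < n" and crit: "\<And>i. 1 \<le> i \<Longrightarrow> i \<le> m \<Longrightarrow> crit_at lam X m i"
  shows "toda_mat n lam X (Suc m) * bidiag_mat n m (tri_uc X m)
    = bidiag_mat n m (tri_uc X m) * toda_mat n lam X m"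
proof (rule eq_matI)
  let ?K = "bidiag_mat n m (tri_uc X m)"
  let ?M0 = "toda_mat n lam X m" and ?M1 = "toda_mat n lam X (Suc m)"
  let ?p0 = "p_fun lam X m" and ?p1 = "p_fun lam X (Suc m)"
  let ?u = "tri_u X m" and ?v = "tri_v X m" and ?q0 = "tri_q X m" and ?q1 = "tri_q X (Suc m)"
  fix r c assume "r < dim_row (?K * ?M0)" "c < dim_col (?K * ?M0)"
  then have rc: "r < n" "c < n" by (simp_all add: bidiag_mat_def toda_mat_def)
  have p1: "?p1 i = (if i < Suc m then ?p0 i + ?u i else lam (Suc m)) - (if 1 < i then ?u (i - 1) else 0)"
    if "1 \<le> i" "i \<le> Suc m" for i
    using p_fun_u[OF that, of lam X] by simp
  have sub: "?q1 i + ?p1 (i + 1) * ?u i = (if i < m then ?q0 i else 0) + ?u i * ?p0 i"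
    if "1 \<le> i" "i \<le> m" for i
    using crit_at_sub[OF that] crit that by simp
  have lhs: "(?M1 * ?K) $$ (r, c) = ?M1 $$ (r, c) - (if c + 1 \<le> m then ?M1 $$ (r, c + 1) * of_real (?u (c + 1)) else 0)"
    by (rule mult_bidiag_mat[OF toda_mat_carrier rc m(2)])
  have rhs: "(?K * ?M0) $$ (r, c) = ?M0 $$ (r, c) - (if 1 \<le> r \<and> r \<le> m then of_real (?u r) * ?M0 $$ (r - 1, c) else 0)"
    by (rule bidiag_mat_mult[OF toda_mat_carrier rc])
  consider "r < c" | "r = c" | "r = c + 1" | "r = c + 2" | "c + 2 < r" by linarith
  then show "(?M1 * ?K) $$ (r, c) = (?K * ?M0) $$ (r, c)"
  proof cases
    case 1
    then show ?thesis unfolding lhs rhs using rc m by (auto simp: toda_mat_def simp del: p_fun.simps)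
  next
    case 2
    then show ?thesis unfolding lhs rhs using rc m p1[of "r + 1"]
      by (cases "r = 0"; cases "r = m"; cases "r < m")
        (auto simp: toda_mat_def simp del: p_fun.simps)
  next
    case 3
    have "complex_of_real (?q1 r + ?p1 (r + 1) * ?u r) = of_real ((if r < m then ?q0 r else 0) + ?u r * ?p0 r)"
      if "r \<le> m" using sub[of r] 3 that by simp
    then show ?thesis unfolding lhs rhs using rc m 3
      by (cases "r < m"; cases "r = m")
        (auto simp: toda_mat_def algebra_simps simp del: p_fun.simps)
  next
    case 4
    have "complex_of_real (?u r * ?q0 (r - 1)) = of_real (?q1 r * ?u (r - 1))"
      using tri_uq[of X m "r - 1"] 4 by simp
    then show ?thesis unfolding lhs rhs using rc m 4
      by (auto simp: toda_mat_def simp del: p_fun.simps)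
  next
    case 5
    then show ?thesis unfolding lhs rhs using rc m by (auto simp: toda_mat_def simp del: p_fun.simps)
  qed
qed (auto simp: bidiag_mat_def toda_mat_def)

lemma lower_prod_toda:
  assumes crit: "\<And>m i. 1 \<le> i \<Longrightarrow> i \<le> m \<Longrightarrow> m < n \<Longrightarrow> crit_at lam X m i" and "m < n"
  shows "lower_prod n X m * toda_mat n lam X (Suc m) = eps_mat n lam * lower_prod n X m"
  using \<open>m < n\<close>
proof (induction m)
  case 0
  have "eps_mat n lam \<in> carrier_mat n n" by (simp add: eps_mat_def)
  then show ?case using toda_mat_1[of n lam X] by simp
next
  case (Suc m)
  let ?K = "bidiag_mat n (Suc m) (tri_uc X (Suc m))" and ?T = "L_mat n (Suc m) (tri_uc X (Suc m))"
  let ?L = "lower_prod n X m" and ?M0 = "toda_mat n lam X (Suc m)" and ?M1 = "toda_mat n lam X (Suc (Suc m))"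
  have e: "eps_mat n lam \<in> carrier_mat n n" by (simp add: eps_mat_def)
  have c: "A * B \<in> carrier_mat n n" if "A \<in> carrier_mat n n" "B \<in> carrier_mat n n" for A B :: "complex mat"
    using that by (rule mult_carrier_mat)
  have KT: "?K * ?T = 1\<^sub>m n" "?T * ?K = 1\<^sub>m n"
    using bidiag_mult_L_mat L_mat_mult_bidiag Suc.prems by auto
  have "?M1 * ?K = ?K * ?M0"
    by (rule toda_mat_intertwine) (use crit Suc.prems in auto)
  \<comment> \<open>Multiplying by \<open>?T\<close>, the inverse of \<open>?K\<close>, on both
    sides carries the intertwining from K to L_(m+1).\<close>
  then have "?T * (?M1 * ?K) * ?T = ?T * (?K * ?M0) * ?T" by simp
  then have "?T * ?M1 * (?K * ?T) = (?T * ?K) * ?M0 * ?T"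
    by (simp add: assoc_mult_mat[of _ n n _ n _ n] c)
  then have "?T * ?M1 = ?M0 * ?T"
    by (simp add: KT c right_mult_one_mat[of _ n n] left_mult_one_mat[of _ n n])
  then have "?L * ?T * ?M1 = ?L * ?M0 * ?T"
    by (simp add: assoc_mult_mat[of _ n n _ n _ n])
  then show ?case using Suc e by (simp add: assoc_mult_mat[of _ n n _ n _ n])
qed

lemma has_vector_derivative_complex_of_real:
  assumes "(f has_real_derivative D) F"
  shows "((\<lambda>s. complex_of_real (f s)) has_vector_derivative complex_of_real D) F"
  using bounded_linear.has_vector_derivative[OF bounded_linear_of_real] assms
  by (simp add: has_real_derivative_iff_has_vector_derivative)

lemma carrier_mult:
  "A \<in> carrier_mat n n \<Longrightarrow> B \<in> carrier_mat n n \<Longrightarrow> A * B \<in> carrier_mat n n"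
  by (rule mult_carrier_mat)

lemma mat_add_uminus_cancel:
  fixes A :: "'a::ab_group_add mat"
  assumes "A \<in> carrier_mat n n" "B \<in> carrier_mat n n"
  shows "A + B + - A = B"
  using assms by (intro eq_matI) auto

lemma mat_add_uminus_cancel':
  fixes A :: "'a::ab_group_add mat"
  assumes "A \<in> carrier_mat n n" "B \<in> carrier_mat n n"
  shows "A + (- A + B) = B"
  using assms by (intro eq_matI) auto

section \<open>Time derivatives of the factors along a critical flow\<close>

locale critical_flow =
  fixes n :: nat and lam :: "nat \<Rightarrow> real" and X :: "real \<Rightarrow> triangle"
  assumes fl: "\<And>m i. 1 \<le> i \<Longrightarrow> i \<le> m \<Longrightarrow> m \<le> n \<Longrightarrow> flow_at lam X m i"
    and cr: "\<And>t m i. 0 \<le> t \<Longrightarrow> 1 \<le> i \<Longrightarrow> i \<le> m \<Longrightarrow> m < n \<Longrightarrow> crit_at lam (X t) m i"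
begin

abbreviation K where "K m t \<equiv> bidiag_mat n m (tri_uc (X t) m)"
abbreviation T where "T m t \<equiv> L_mat n m (tri_uc (X t) m)"
abbreviation Lo where "Lo m t \<equiv> lower_prod n (X t) m"
abbreviation Li where "Li m t \<equiv> lower_prod_inv n (X t) m"
abbreviation Qm where "Qm m t \<equiv> toda_lower n (X t) m"
abbreviation Mm where "Mm m t \<equiv> toda_mat n lam (X t) m"

lemmas assoc = assoc_mult_mat[of _ n n _ n _ n]

lemma tri_u_deriv_crit:
  assumes "1 \<le> i" "i \<le> m" "m < n" "0 \<le> t"
  shows "((\<lambda>s. tri_u (X s) m i) has_real_derivative
    (if i < m then tri_q (X t) m i else 0) - tri_q (X t) (Suc m) i) (at t within {0..})"
proof -
  have "((\<lambda>s. tri_u (X s) m i) has_real_derivative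
      tri_u (X t) m i * (p_fun lam (X t) (m + 1) (i + 1) - p_fun lam (X t) m i)) (at t within {0..})"
    using assms fl by (intro tri_u_deriv) auto
  moreover have "tri_q (X t) (Suc m) i + p_fun lam (X t) (Suc m) (i + 1) * tri_u (X t) m i
      = (if i < m then tri_q (X t) m i else 0) + tri_u (X t) m i * p_fun lam (X t) m i"
    using assms cr by (intro crit_at_sub) auto
  ultimately show ?thesis
    by (auto elim!: DERIV_cong simp: algebra_simps simp del: p_fun.simps)
qed

text \<open>Only two bands of the right-hand side could be nonzero. On the first subdiagonal it is
  \<open>tri_u_deriv_crit\<close>; on the second it cancels by \<open>tri_uq\<close>, in accordance
  with the zeros of \<open>K\<close>.\<close>

lemma bidiag_deriv:
  assumes m: "1 \<le> m" "m < n" and t: "0 \<le> t"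
  shows "has_mat_derivative n (K m) (K m t * Qm m t + - Qm (Suc m) t * K m t) t"
  unfolding has_mat_derivative_def
proof (intro allI impI)
  fix r c assume rc: "r < n" "c < n"
  let ?D = "K m t * Qm m t + - Qm (Suc m) t * K m t"
  have "?D $$ (r, c) = (K m t * Qm m t) $$ (r, c) - (Qm (Suc m) t * K m t) $$ (r, c)"
    using rc by (simp add: bidiag_mat_def toda_lower_def del: index_mult_mat(1))
  also have "(K m t * Qm m t) $$ (r, c) = Qm m t $$ (r, c)
      - (if 1 \<le> r \<and> r \<le> m then of_real (tri_u (X t) m r) * Qm m t $$ (r - 1, c) else 0)"
    by (rule bidiag_mat_mult[OF toda_lower_carrier rc])
  also have "(Qm (Suc m) t * K m t) $$ (r, c) = Qm (Suc m) t $$ (r, c)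
      - (if c + 1 \<le> m then Qm (Suc m) t $$ (r, c + 1) * of_real (tri_u (X t) m (c + 1)) else 0)"
    by (rule mult_bidiag_mat[OF toda_lower_carrier rc m(2)])
  finally have D: "?D $$ (r, c) = Qm m t $$ (r, c)
      - (if 1 \<le> r \<and> r \<le> m then of_real (tri_u (X t) m r) * Qm m t $$ (r - 1, c) else 0)
      - (Qm (Suc m) t $$ (r, c)
      - (if c + 1 \<le> m then Qm (Suc m) t $$ (r, c + 1) * of_real (tri_u (X t) m (c + 1)) else 0))" .
  consider "r = c + 1" "r \<le> m" | "r = c + 2" "r \<le> m" | "\<not> (r = c + 1 \<and> r \<le> m)" "\<not> (r = c + 2 \<and> r \<le> m)"
    by blast
  then show "((\<lambda>s. K m s $$ (r, c)) has_vector_derivative ?D $$ (r, c)) (at t within {0..})"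
  proof cases
    case 1
    have "((\<lambda>s. - complex_of_real (tri_u (X s) m r)) has_vector_derivative
        - of_real ((if r < m then tri_q (X t) m r else 0) - tri_q (X t) (Suc m) r)) (at t within {0..})"
      using 1 m t by (intro has_vector_derivative_minus has_vector_derivative_complex_of_real tri_u_deriv_crit) auto
    moreover have "?D $$ (r, c) = - of_real ((if r < m then tri_q (X t) m r else 0) - tri_q (X t) (Suc m) r)"
      unfolding D using 1 rc m by (auto simp: toda_lower_def)
    moreover have "K m s $$ (r, c) = - complex_of_real (tri_u (X s) m r)" for s
      using 1 rc by (simp add: bidiag_mat_def)
    ultimately show ?thesis by simp
  next
    case 2
    have "complex_of_real (tri_u (X t) m r * tri_q (X t) m (r - 1))
        = of_real (tri_q (X t) (Suc m) r * tri_u (X t) m (r - 1))"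
      using tri_uq[of "X t" m "r - 1"] 2 by simp
    then have "?D $$ (r, c) = 0"
      unfolding D using 2 rc m by (auto simp: toda_lower_def)
    moreover have "K m s $$ (r, c) = 0" for s
      using 2 rc by (simp add: bidiag_mat_def)
    ultimately show ?thesis by (simp del: index_mult_mat index_add_mat)
  next
    case 3
    have "?D $$ (r, c) = 0"
      unfolding D using 3 rc m by (auto simp: toda_lower_def)
    moreover have "K m s $$ (r, c) = (if r = c then 1 else 0)" for s
      using 3 rc by (auto simp: bidiag_mat_def)
    ultimately show ?thesis by (simp del: index_mult_mat index_add_mat)
  qed
qed

text \<open>The product rule telescopes: the term with the inner Q in the derivative of K cancels
  against the derivative of the preceding product, and only the outermost Q survives. The start is
  Q_1 = 0, as row 1 has no subdiagonal.\<close>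

lemma lower_prod_inv_deriv:
  assumes "m < n" "0 \<le> t"
  shows "has_mat_derivative n (Li m) (- Qm (Suc m) t * Li m t) t"
  using assms(1)
proof (induction m)
  case 0
  have "- Qm (Suc 0) t * Li 0 t = 0\<^sub>m n n"
    by (auto simp: toda_lower_def intro!: eq_matI)
  then show ?case using has_mat_derivative_const[of "1\<^sub>m n" n t] by simp
next
  case (Suc m)
  let ?K = "K (Suc m) t" and ?Q = "Qm (Suc m) t" and ?Q' = "Qm (Suc (Suc m)) t" and ?I = "Li m t"
  have "has_mat_derivative n (\<lambda>s. K (Suc m) s * Li m s)
      ((?K * ?Q + - ?Q' * ?K) * ?I + ?K * (- ?Q * ?I)) t"
    using Suc assms(2)
    by (intro has_mat_derivative_mult bidiag_deriv)
      (auto intro!: add_carrier_mat carrier_mult simp del: uminus_mult_left_mat)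
  moreover have "(?K * ?Q + - ?Q' * ?K) * ?I + ?K * (- ?Q * ?I) = - ?Q' * (?K * ?I)"
  proof -
    have c: "?K * ?Q \<in> carrier_mat n n" "- ?Q' * ?K \<in> carrier_mat n n" "- ?Q * ?I \<in> carrier_mat n n"
      "?K * ?Q * ?I \<in> carrier_mat n n" "- ?Q' * (?K * ?I) \<in> carrier_mat n n"
      by (auto intro!: carrier_mult simp del: uminus_mult_left_mat)
    have "(?K * ?Q + - ?Q' * ?K) * ?I = ?K * ?Q * ?I + - ?Q' * ?K * ?I"
      using c by (intro add_mult_distrib_mat[of _ n n _ _ n]) auto
    also have "- ?Q' * ?K * ?I = - ?Q' * (?K * ?I)"
      by (rule assoc) auto
    finally have 1: "(?K * ?Q + - ?Q' * ?K) * ?I = ?K * ?Q * ?I + - ?Q' * (?K * ?I)" .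
    have "- ?Q * ?I = - (?Q * ?I)"
      by (rule uminus_mult_left_mat) (simp add: toda_lower_def carrier_matD[OF lower_prod_inv_carrier])
    then have "?K * (- ?Q * ?I) = - (?K * (?Q * ?I))"
      by (simp add: uminus_mult_right_mat bidiag_mat_def toda_lower_def)
    also have "\<dots> = - (?K * ?Q * ?I)"
      by (simp add: assoc)
    finally show ?thesis
      unfolding 1 by (simp only: mat_add_uminus_cancel[OF c(4,5)])
  qed
  ultimately show ?case by simp
qed

text \<open>Only the existence of a derivative is wanted here, its value being determined afterwards
  from the inverse. The number of factors \<open>m\<close> is kept apart from the row
  \<open>m'\<close> so that the induction can peel off factors.\<close>

lemma L_mat_differentiable:
  assumes "m' < n" "0 \<le> t" "m \<le> m'"
  shows "\<exists>D \<in> carrier_mat n n. has_mat_derivative n (\<lambda>s. L_mat n m (tri_uc (X s) m')) D t"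
  using assms(3)
proof (induction m)
  case 0
  show ?case
    using has_mat_derivative_const[of "1\<^sub>m n" n t] by (auto simp: L_mat_0)
next
  case (Suc m)
  then obtain D where D: "D \<in> carrier_mat n n" "has_mat_derivative n (\<lambda>s. L_mat n m (tri_uc (X s) m')) D t"
    by auto
  let ?d = "(if Suc m < m' then tri_q (X t) m' (Suc m) else 0) - tri_q (X t) (Suc m') (Suc m)"
  let ?F = "complex_of_real ?d \<cdot>\<^sub>m f_mat n (Suc m)"
  have "has_mat_derivative n (\<lambda>s. l_mat n (Suc m) (tri_uc (X s) m' (Suc m))) ?F t"
    unfolding has_mat_derivative_def
  proof (intro allI impI)
    fix i j assume ij: "i < n" "j < n"
    have "((\<lambda>s. 1\<^sub>m n $$ (i, j) + complex_of_real (tri_u (X s) m' (Suc m)) * f_mat n (Suc m) $$ (i, j))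
        has_vector_derivative 0 + complex_of_real ?d * f_mat n (Suc m) $$ (i, j)) (at t within {0..})"
      using assms Suc.prems
      by (intro has_vector_derivative_add has_vector_derivative_const has_vector_derivative_mult_left
          has_vector_derivative_complex_of_real tri_u_deriv_crit) auto
    then show "((\<lambda>s. l_mat n (Suc m) (tri_uc (X s) m' (Suc m)) $$ (i, j))
        has_vector_derivative ?F $$ (i, j)) (at t within {0..})"
      using ij by (simp add: l_mat_def f_mat_def)
  qed
  then have "has_mat_derivative n (\<lambda>s. l_mat n (Suc m) (tri_uc (X s) m' (Suc m)) * L_mat n m (tri_uc (X s) m'))
      (?F * L_mat n m (tri_uc (X t) m') + l_mat n (Suc m) (tri_uc (X t) m' (Suc m)) * D) t"
    using D by (intro has_mat_derivative_mult) auto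
  then show ?case unfolding L_mat_Suc
    by (rule bexI) (use D(1) in \<open>auto intro!: add_carrier_mat carrier_mult\<close>)
qed

lemma lower_prod_differentiable:
  assumes "m < n" "0 \<le> t"
  shows "\<exists>D \<in> carrier_mat n n. has_mat_derivative n (Lo m) D t"
  using assms(1)
proof (induction m)
  case 0
  show ?case using has_mat_derivative_const[of "1\<^sub>m n" n t] by auto
next
  case (Suc m)
  then obtain D where D: "D \<in> carrier_mat n n" "has_mat_derivative n (Lo m) D t"
    by auto
  obtain E where E: "E \<in> carrier_mat n n" "has_mat_derivative n (T (Suc m)) E t"
    using L_mat_differentiable[of "Suc m" t "Suc m"] Suc.prems assms(2) by auto
  then have "has_mat_derivative n (\<lambda>s. Lo m s * T (Suc m) s) (D * T (Suc m) t + Lo m t * E) t"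
    using D by (intro has_mat_derivative_mult) auto
  then show ?case unfolding lower_prod.simps
    by (rule bexI) (use D(1) E(1) in \<open>auto intro!: add_carrier_mat carrier_mult\<close>)
qed

text \<open>Differentiating \<open>Li * Lo = 1\<close> gives - Q + Li D = 0 for the unknown
  derivative D, and multiplying by \<open>Lo\<close> isolates D.\<close>

lemma lower_prod_deriv:
  assumes "m < n" "0 \<le> t"
  shows "has_mat_derivative n (Lo m) (Lo m t * Qm (Suc m) t) t"
proof -
  obtain D where D: "D \<in> carrier_mat n n" "has_mat_derivative n (Lo m) D t"
    using lower_prod_differentiable[OF assms] by blast
  let ?Q = "Qm (Suc m) t"
  have c: "- ?Q * Li m t \<in> carrier_mat n n"
    by (auto intro!: carrier_mult simp del: uminus_mult_left_mat)
  have "has_mat_derivative n (\<lambda>s. Li m s * Lo m s) (- ?Q * Li m t * Lo m t + Li m t * D) t"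
    by (rule has_mat_derivative_mult[OF _ _ c D(1) lower_prod_inv_deriv[OF assms] D(2)]) auto
  moreover have "- ?Q * Li m t * Lo m t = - ?Q"
    using assms(1) lower_prod_inverse
    by (subst assoc) (auto simp: lower_prod_inverse right_mult_one_mat[of _ n n] simp del: uminus_mult_left_mat)
  moreover have "Li m s * Lo m s = 1\<^sub>m n" for s
    using assms(1) by (rule lower_prod_inverse)
  ultimately have "has_mat_derivative n (\<lambda>s. 1\<^sub>m n) (- ?Q + Li m t * D) t"
    by simp
  then have "- ?Q + Li m t * D = 0\<^sub>m n n"
    by (rule has_mat_derivative_unique[OF _ has_mat_derivative_const assms(2)])
      (use D in \<open>auto intro!: add_carrier_mat carrier_mult\<close>)
  then have "?Q + (- ?Q + Li m t * D) = ?Q" by simp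
  moreover have "?Q + (- ?Q + Li m t * D) = Li m t * D"
    by (rule mat_add_uminus_cancel'[OF toda_lower_carrier carrier_mult[OF lower_prod_inv_carrier D(1)]])
  ultimately have "Lo m t * (Li m t * D) = Lo m t * ?Q" by simp
  moreover have "Lo m t * (Li m t * D) = D"
    using D(1) lower_prod_inverse'[OF assms(1)]
    by (subst assoc[symmetric]) (auto simp: left_mult_one_mat[of _ n n])
  ultimately show ?thesis using D(2) by simp
qed

end

section \<open>The candidate for the inverse image of a triangle under \<open>f_map\<close>\<close>

definition b_mat :: "nat \<Rightarrow> triangle \<Rightarrow> complex mat" where
  "b_mat n X = mat n n (\<lambda>(r, c). complex_of_real (exp (X (c + 1) 1)) * lower_prod n X c $$ (r, 0))"

lemma b_mat_carrier [simp]: "b_mat n X \<in> carrier_mat n n"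
  by (simp add: b_mat_def)

lemma eps_mat_carrier [simp]: "eps_mat n lam \<in> carrier_mat n n"
  by (simp add: eps_mat_def)

context critical_flow
begin

text \<open>The superdiagonal does not meet the first column, so M_(c+1) e_1 = p e_1 + Q e_1 with p
  the velocity of x^(c+1)_1. Hence the product rule for column \<open>c\<close> produces L_1 ... L_c
  M_(c+1) e_1, and the intertwining moves \<open>eps_mat\<close> to the left.\<close>

lemma b_mat_deriv:
  assumes t: "0 \<le> t"
  shows "has_mat_derivative n (\<lambda>s. b_mat n (X s)) (eps_mat n lam * b_mat n (X t)) t"
  unfolding has_mat_derivative_def
proof (intro allI impI)
  fix r c assume rc: "r < n" "c < n"
  let ?x = "\<lambda>s. complex_of_real (exp (X s (c + 1) 1))"
  let ?p = "p_fun lam (X t) (c + 1) 1"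
  have x: "(?x has_vector_derivative complex_of_real (exp (X t (c + 1) 1) * ?p)) (at t within {0..})"
    using rc t fl
    by (intro has_vector_derivative_complex_of_real DERIV_chain2[OF DERIV_exp] flow_atD) auto
  have "((\<lambda>s. ?x s * Lo c s $$ (r, 0)) has_vector_derivative
      ?x t * (Lo c t * Qm (Suc c) t) $$ (r, 0)
      + complex_of_real (exp (X t (c + 1) 1) * ?p) * Lo c t $$ (r, 0)) (at t within {0..})"
    using lower_prod_deriv[OF rc(2) t] rc
    by (intro has_vector_derivative_mult x) (auto simp: has_mat_derivative_def)
  moreover have "(eps_mat n lam * b_mat n (X t)) $$ (r, c) = ?x t * (Lo c t * Qm (Suc c) t) $$ (r, 0)
      + complex_of_real (exp (X t (c + 1) 1) * ?p) * Lo c t $$ (r, 0)"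
  proof -
    have n0: "0 < n" using rc by simp
    have "(eps_mat n lam * b_mat n (X t)) $$ (r, c) = (\<Sum>k<n. eps_mat n lam $$ (r, k) * (?x t * Lo c t $$ (k, 0)))"
      using rc by (simp add: index_mult_mat_sum[of _ n] b_mat_def del: index_mult_mat)
    also have "\<dots> = ?x t * (eps_mat n lam * Lo c t) $$ (r, 0)"
      unfolding index_mult_mat_sum[OF eps_mat_carrier lower_prod_carrier rc(1) n0]
      by (simp add: sum_distrib_left mult_ac)
    also have "eps_mat n lam * Lo c t = Lo c t * Mm (Suc c) t"
      using lower_prod_toda[of n lam "X t" c] cr t rc by simp
    also have "(Lo c t * Mm (Suc c) t) $$ (r, 0) =
        (\<Sum>k<n. Lo c t $$ (r, k) * Qm (Suc c) t $$ (k, 0) + (if k = 0 then Lo c t $$ (r, k) * of_real ?p else 0))"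
      unfolding index_mult_mat_sum[OF lower_prod_carrier toda_mat_carrier rc(1) n0]
      by (rule sum.cong) (auto simp: toda_mat_def toda_lower_def algebra_simps simp del: p_fun.simps)
    also have "\<dots> = (Lo c t * Qm (Suc c) t) $$ (r, 0) + Lo c t $$ (r, 0) * of_real ?p"
      unfolding index_mult_mat_sum[OF lower_prod_carrier toda_lower_carrier rc(1) n0]
      using n0 by (simp add: sum.distrib del: p_fun.simps)
    finally show ?thesis by (simp add: algebra_simps del: p_fun.simps index_mult_mat)
  qed
  ultimately show "((\<lambda>s. b_mat n (X s) $$ (r, c)) has_vector_derivative
      (eps_mat n lam * b_mat n (X t)) $$ (r, c)) (at t within {0..})"
    using rc by (simp add: b_mat_def del: index_mult_mat)
qed

end

section \<open>Minors and the Gauss decomposition\<close>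

lemma w0_mat_carrier [simp]: "w0_mat n \<in> carrier_mat n n"
  by (simp add: w0_mat_def)

lemma mult_w0_mat:
  assumes A: "A \<in> carrier_mat n n" and rc: "r < n" "c < n"
  shows "(A * w0_mat n) $$ (r, c) = (- 1) ^ c * A $$ (r, n - 1 - c)"
proof -
  have "(A * w0_mat n) $$ (r, c) = (\<Sum>k<n. if k = n - 1 - c then (- 1) ^ c * A $$ (r, k) else 0)"
    unfolding index_mult_mat_sum[OF A w0_mat_carrier rc]
    by (rule sum.cong) (use rc in \<open>auto simp: w0_mat_def\<close>)
  then show ?thesis using rc by simp
qed

lemma L_mat_row:
  assumes "m < r" "r < n" "c < n"
  shows "L_mat n m u $$ (r, c) = (if r = c then 1 else 0)"
proof -
  have "(bidiag_mat n m u * L_mat n m u) $$ (r, c) = L_mat n m u $$ (r, c)"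
    unfolding bidiag_mat_mult[OF L_mat_carrier assms(2,3)] using assms by simp
  then show ?thesis using assms by (simp add: bidiag_mult_L_mat)
qed

text \<open>The factors L_1, ..., L_m change only the rows up to m in the numbering from 0. This is
  what makes \<open>b_mat\<close> upper triangular.\<close>

lemma lower_prod_row:
  "m < r \<Longrightarrow> r < n \<Longrightarrow> c < n \<Longrightarrow> lower_prod n X m $$ (r, c) = (if r = c then 1 else 0)"
proof (induction m arbitrary: c)
  case (Suc m)
  let ?T = "L_mat n (Suc m) (tri_uc X (Suc m))"
  have "lower_prod n X (Suc m) $$ (r, c) = (\<Sum>k<n. lower_prod n X m $$ (r, k) * ?T $$ (k, c))"
    using index_mult_mat_sum[OF lower_prod_carrier L_mat_carrier Suc.prems(2,3)] by simp
  also have "\<dots> = (\<Sum>k<n. if k = r then ?T $$ (k, c) else 0)"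
    by (rule sum.cong) (use Suc in auto)
  also have "\<dots> = (if r = c then 1 else 0)"
    using Suc.prems by (simp add: L_mat_row)
  finally show ?case .
qed simp

text \<open>After cancellation K_m ... K_(m-c+1) e_1 remains. Each factor pushes the lowest nonzero
  entry down by one place and multiplies it by - u, so it ends at place c with the product of u^m_c,
  u^(m-1)_(c-1), ..., u^(m-c+1)_1, whose exponents telescope.\<close>

lemma lower_prod_shift:
  assumes "c \<le> m" "m < n"
  shows "(\<forall>i<n. c < i \<longrightarrow> (lower_prod_inv n X m * lower_prod n X (m - c)) $$ (i, 0) = 0) \<and>
    (lower_prod_inv n X m * lower_prod n X (m - c)) $$ (c, 0)
      = (- 1) ^ c * complex_of_real (exp (X (m + 1) (c + 1) - X (m + 1 - c) 1))"
  using assms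
proof (induction c arbitrary: m)
  case 0
  then show ?case by (simp add: lower_prod_inverse)
next
  case (Suc c)
  then obtain m' where m: "m = Suc m'" by (cases m) auto
  let ?Z = "lower_prod_inv n X m' * lower_prod n X (m' - c)"
  have cZ: "?Z \<in> carrier_mat n n" by (auto intro!: carrier_mult)
  have eq: "lower_prod_inv n X m * lower_prod n X (m - Suc c) = bidiag_mat n m (tri_uc X m) * ?Z"
    unfolding m by (simp add: assoc_mult_mat[of _ n n _ n _ n])
  have IH: "i < n \<Longrightarrow> c < i \<Longrightarrow> ?Z $$ (i, 0) = 0"
    "?Z $$ (c, 0) = (- 1) ^ c * complex_of_real (exp (X (m' + 1) (c + 1) - X (m' + 1 - c) 1))" for i
    using Suc.IH[of m'] Suc.prems m by auto
  have Z: "(bidiag_mat n m (tri_uc X m) * ?Z) $$ (i, 0) = ?Z $$ (i, 0)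
      - (if 1 \<le> i \<and> i \<le> m then of_real (tri_u X m i) * ?Z $$ (i - 1, 0) else 0)" if "i < n" for i
    using bidiag_mat_mult[OF cZ that, of 0 m "tri_uc X m"] that by simp
  have "of_real (tri_u X m (Suc c)) * ?Z $$ (c, 0)
      = (- 1) ^ c * complex_of_real (exp (X (m + 1) (Suc c + 1) - X (m + 1 - Suc c) 1))"
    unfolding IH(2) using Suc.prems m
    by (simp add: tri_u_def mult_exp_exp flip: of_real_mult)
  then show ?case
    unfolding eq using Suc.prems IH(1) by (auto simp: Z simp del: index_mult_mat)
qed

text \<open>The columns m, m - 1, ..., 1 of b with alternating signs, multiplied by the inverse of
  L_1 ... L_(m-1). For m = n this is the factor R; smaller m serve the minors with last column m.
  For \<open>c \<ge> m\<close> the truncated subtraction gives no meaningful column.\<close>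

definition upper_fac :: "nat \<Rightarrow> triangle \<Rightarrow> nat \<Rightarrow> complex mat" where
  "upper_fac n X m = mat n n (\<lambda>(l, c). (- 1) ^ c * complex_of_real (exp (X (m - c) 1))
     * (lower_prod_inv n X (m - 1) * lower_prod n X (m - 1 - c)) $$ (l, 0))"

lemma upper_fac_carrier [simp]: "upper_fac n X m \<in> carrier_mat n n"
  by (simp add: upper_fac_def)

lemma upper_fac_lower:
  assumes "c < m" "m \<le> n" "l < n" "c < l"
  shows "upper_fac n X m $$ (l, c) = 0"
  using lower_prod_shift[of c "m - 1" n X] assms by (simp add: upper_fac_def del: index_mult_mat)

lemma upper_fac_diag:
  assumes "c < m" "m \<le> n"
  shows "upper_fac n X m $$ (c, c) = complex_of_real (exp (X m (c + 1)))"
proof -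
  have "(lower_prod_inv n X (m - 1) * lower_prod n X (m - 1 - c)) $$ (c, 0)
      = (- 1) ^ c * complex_of_real (exp (X m (c + 1) - X (m - c) 1))"
    using lower_prod_shift[of c "m - 1" n X] assms by (simp del: index_mult_mat)
  then have "upper_fac n X m $$ (c, c) = ((- 1) ^ c * (- 1) ^ c)
      * complex_of_real (exp (X (m - c) 1) * exp (X m (c + 1) - X (m - c) 1))"
    using assms by (simp add: upper_fac_def del: index_mult_mat)
  also have "(- 1) ^ c * (- 1) ^ c = (1 :: complex)"
    by (simp flip: power_mult_distrib)
  finally show ?thesis by (simp add: mult_exp_exp)
qed

lemma b_mat_factor:
  assumes "i < n" "c < m" "m \<le> n"
  shows "(- 1) ^ c * b_mat n X $$ (i, m - 1 - c)
    = (\<Sum>l<n. lower_prod n X (m - 1) $$ (i, l) * upper_fac n X m $$ (l, c))"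
proof -
  let ?L = "lower_prod n X (m - 1)" and ?I = "lower_prod_inv n X (m - 1)" and ?L' = "lower_prod n X (m - 1 - c)"
  have n0: "0 < n" using assms by simp
  have c: "?I * ?L' \<in> carrier_mat n n" by (auto intro!: carrier_mult)
  have "?L' = ?L * (?I * ?L')"
    using assms lower_prod_inverse'[of "m - 1" n X]
    by (simp add: assoc_mult_mat[of _ n n _ n _ n, symmetric] left_mult_one_mat[of _ n n])
  then have "?L' $$ (i, 0) = (\<Sum>l<n. ?L $$ (i, l) * (?I * ?L') $$ (l, 0))"
    using index_mult_mat_sum[OF lower_prod_carrier c assms(1) n0] by metis
  moreover have "Suc (m - 1 - c) = m - c" using assms by simp
  ultimately show ?thesis
    using assms by (simp add: b_mat_def upper_fac_def sum_distrib_left mult_ac del: index_mult_mat)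
qed

text \<open>Reversing the columns of the submatrix by \<open>w0_mat k\<close> makes it a product of
  a lower unitriangular and an upper triangular block, the latter with diagonal exp (x^m_1), ...,
  exp (x^m_k).\<close>

lemma minor_b_mat:
  assumes k: "k \<le> m" "m \<le> n" "1 \<le> m"
  shows "minor m k (b_mat n X) = complex_of_real (exp (\<Sum>i=1..k. X m i))"
proof -
  define B where "B = mat k k (\<lambda>(i, j). b_mat n X $$ (i, m - k + j))"
  define Lk where "Lk = mat k k (\<lambda>(i, j). lower_prod n X (m - 1) $$ (i, j))"
  define Rk where "Rk = mat k k (\<lambda>(i, j). upper_fac n X m $$ (i, j))"
  have cB: "B \<in> carrier_mat k k" and cL: "Lk \<in> carrier_mat k k" and cR: "Rk \<in> carrier_mat k k"
    by (simp_all add: B_def Lk_def Rk_def)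
  have "B * w0_mat k = Lk * Rk"
  proof (rule eq_matI)
    fix i c assume "i < dim_row (Lk * Rk)" "c < dim_col (Lk * Rk)"
    then have ic: "i < k" "c < k" by (simp_all add: Lk_def Rk_def)
    have "(B * w0_mat k) $$ (i, c) = (- 1) ^ c * b_mat n X $$ (i, m - 1 - c)"
      using mult_w0_mat[OF cB ic] ic k by (simp add: B_def)
    also have "\<dots> = (\<Sum>l<n. lower_prod n X (m - 1) $$ (i, l) * upper_fac n X m $$ (l, c))"
      by (rule b_mat_factor) (use ic k in auto)
    \<comment> \<open>Rows i < k of a lower triangular matrix vanish in columns l \<ge> k, so the
      factorisation restricts to the upper left blocks.\<close>
    also have "\<dots> = (\<Sum>l<k. lower_prod n X (m - 1) $$ (i, l) * upper_fac n X m $$ (l, c))"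
      using lower_prod_unitri[of n X "m - 1"] ic k
      by (intro sum.mono_neutral_right) (auto simp: lower_unitri_def)
    also have "\<dots> = (Lk * Rk) $$ (i, c)"
      unfolding index_mult_mat_sum[OF cL cR ic]
      by (rule sum.cong) (use ic in \<open>auto simp: Lk_def Rk_def\<close>)
    finally show "(B * w0_mat k) $$ (i, c) = (Lk * Rk) $$ (i, c)" .
  qed (use cB cL cR in \<open>auto simp: w0_mat_def\<close>)
  then have "det B * det (w0_mat k) = det Lk * det Rk"
    using det_mult[OF cB w0_mat_carrier] det_mult[OF cL cR] by simp
  moreover have "det (w0_mat k) = 1" using det_w0_bar w0_bar_eq by metis
  moreover have "det Lk = 1"
  proof -
    have "det Lk = prod_list (diag_mat Lk)"
      using lower_prod_unitri[of n X "m - 1"] k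
      by (intro det_lower_triangular[OF _ cL]) (auto simp: Lk_def lower_unitri_def)
    also have "\<dots> = 1"
      using lower_prod_unitri[of n X "m - 1"] k
      by (intro prod_list_diag_mat_one[OF _ cL]) (auto simp: Lk_def lower_unitri_def)
    finally show ?thesis .
  qed
  moreover have "det Rk = complex_of_real (exp (\<Sum>i=1..k. X m i))"
  proof -
    have "upper_triangular Rk"
      using k by (intro upper_triangularI) (auto simp: Rk_def upper_fac_lower)
    then have "det Rk = prod_list (diag_mat Rk)" using cR by (rule det_upper_triangular)
    also have "\<dots> = (\<Prod>i<k. complex_of_real (exp (X m (i + 1))))"
      unfolding prod_list_diag_prod atLeast0LessThan
      by (rule prod.cong) (use k in \<open>auto simp: Rk_def upper_fac_diag\<close>)
    also have "\<dots> = complex_of_real (exp (\<Sum>i<k. X m (i + 1)))"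
      by (simp add: exp_sum)
    also have "(\<Sum>i<k. X m (i + 1)) = (\<Sum>i=1..k. X m i)"
      by (rule sum.reindex_bij_witness[of _ "\<lambda>i. i - 1" Suc]) auto
    finally show ?thesis .
  qed
  ultimately show ?thesis by (simp add: minor_def B_def)
qed

section \<open>Inverses and products of upper triangular matrices\<close>

lemma invertible_mat_iff_inverse:
  assumes A: "A \<in> carrier_mat n n"
  shows "invertible_mat A \<longleftrightarrow> (\<exists>B \<in> carrier_mat n n. A * B = 1\<^sub>m n \<and> B * A = 1\<^sub>m n)"
proof
  assume "invertible_mat A"
  then obtain B where B: "A * B = 1\<^sub>m n" "B * A = 1\<^sub>m (dim_row B)"
    using A by (auto simp: invertible_mat_def inverts_mat_def)
  then have "dim_col B = n" "dim_row B = n"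
    using A by (metis carrier_matD(2) index_mult_mat(3) index_one_mat(3))+
  then show "\<exists>B \<in> carrier_mat n n. A * B = 1\<^sub>m n \<and> B * A = 1\<^sub>m n"
    using B by (intro bexI[of _ B]) auto
next
  assume "\<exists>B \<in> carrier_mat n n. A * B = 1\<^sub>m n \<and> B * A = 1\<^sub>m n"
  then show "invertible_mat A"
    using A by (auto simp: invertible_mat_def inverts_mat_def)
qed

lemma invertible_mat_det:
  fixes A :: "'a::field mat"
  assumes A: "A \<in> carrier_mat n n" and "det A \<noteq> 0"
  shows "invertible_mat A"
  using det_non_zero_imp_unit[OF assms] A
  by (auto simp: invertible_mat_iff_inverse[OF A] Units_def ring_mat_simps)

text \<open>\<open>inv_mat\<close> reads a value out of an option. \<open>mat_inverse\<close>
  succeeds because the matrix is a unit, and uniqueness of inverses identifies the result.\<close>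

lemma inv_mat_eqI:
  assumes A: "A \<in> carrier_mat n n" and B: "B \<in> carrier_mat n n" and AB: "B * A = 1\<^sub>m n"
  shows "inv_mat A = B"
proof -
  have BA: "A * B = 1\<^sub>m n" using mat_mult_left_right_inverse[OF B A AB] .
  then have "A \<in> Units (ring_mat TYPE(complex) n ())"
    using A B AB by (auto simp: Units_def ring_mat_simps)
  then obtain C where C: "mat_inverse A = Some C"
    using mat_inverse(1)[OF A, of "()"] by (cases "mat_inverse A") auto
  from mat_inverse(2)[OF A this] have "C * A = 1\<^sub>m n" "A * C = 1\<^sub>m n" "C \<in> carrier_mat n n" by auto
  then have "C = B * A * C" using AB by simp
  also have "\<dots> = B" using \<open>A * C = _\<close> \<open>C \<in> _\<close> A B by (simp add: assoc_mult_mat[of _ n n _ n _ n])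
  finally show ?thesis using C by (simp add: inv_mat_def)
qed

lemma inv_mat_inverse:
  assumes A: "A \<in> carrier_mat n n" and "invertible_mat A"
  shows "inv_mat A \<in> carrier_mat n n" "A * inv_mat A = 1\<^sub>m n" "inv_mat A * A = 1\<^sub>m n"
proof -
  obtain B where B: "B \<in> carrier_mat n n" "A * B = 1\<^sub>m n" "B * A = 1\<^sub>m n"
    using assms invertible_mat_iff_inverse[OF A] by blast
  with inv_mat_eqI[OF A B(1,3)] show "inv_mat A \<in> carrier_mat n n" "A * inv_mat A = 1\<^sub>m n"
    "inv_mat A * A = 1\<^sub>m n" by simp_all
qed

text \<open>Going through the columns from left to right, the entry (i, j) of
  \<open>inv_mat R * R\<close> below the diagonal reduces to the single product of the unknown entry
  with \<open>R $$ (j, j)\<close>, which is nonzero.\<close>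

lemma borel_group_inv:
  assumes "R \<in> borel_group n"
  shows "inv_mat R \<in> borel_group n"
proof -
  have R: "R \<in> carrier_mat n n" "upper_triangular R" "invertible_mat R"
    using assms by (auto simp: borel_group_def)
  note S = inv_mat_inverse[OF R(1,3)]
  have "R $$ (j, j) \<noteq> 0" if "j < n" for j
  proof
    assume "R $$ (j, j) = 0"
    then have "det R = 0"
      using R that det_upper_triangular[OF R(2,1)] by (auto simp: diag_mat_def prod_list_zero_iff image_iff)
    moreover have "det R * det (inv_mat R) = 1"
      using det_mult[OF R(1) S(1)] S(2) by simp
    ultimately show False by simp
  qed
  note diag = this
  have zero: "inv_mat R $$ (i, j) = 0" if "j < i" "i < n" for i j
    using that
  proof (induction j arbitrary: i rule: less_induct)
    case (less j)
    have "0 = (inv_mat R * R) $$ (i, j)" using less.prems by (simp add: S(3))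
    also have "\<dots> = (\<Sum>k<n. inv_mat R $$ (i, k) * R $$ (k, j))"
      using less.prems by (intro index_mult_mat_sum S(1) R(1)) auto
    also have "\<dots> = (\<Sum>k<n. if k = j then inv_mat R $$ (i, j) * R $$ (j, j) else 0)"
    proof (rule sum.cong)
      fix k assume "k \<in> {..<n}"
      then show "inv_mat R $$ (i, k) * R $$ (k, j) = (if k = j then inv_mat R $$ (i, j) * R $$ (j, j) else 0)"
        using less R(1) upper_triangularD[OF R(2), of j k] by (cases k j rule: linorder_cases) auto
    qed simp
    also have "\<dots> = inv_mat R $$ (i, j) * R $$ (j, j)" using less.prems by simp
    finally show ?case using diag[of j] less.prems by simp
  qed
  have "upper_triangular (inv_mat R)"
    using zero S(1) by (intro upper_triangularI) auto
  moreover have "invertible_mat (inv_mat R)"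
    unfolding invertible_mat_iff_inverse[OF S(1)] using S R(1) by blast
  ultimately show ?thesis using S(1) by (simp add: borel_group_def)
qed

lemma borel_group_mult:
  assumes "A \<in> borel_group n" "B \<in> borel_group n"
  shows "A * B \<in> borel_group n"
proof -
  have A: "A \<in> carrier_mat n n" "upper_triangular A" "invertible_mat A"
    and B: "B \<in> carrier_mat n n" "upper_triangular B" "invertible_mat B"
    using assms by (auto simp: borel_group_def)
  obtain A' B' where A': "A' \<in> carrier_mat n n" "A * A' = 1\<^sub>m n" "A' * A = 1\<^sub>m n"
    and B': "B' \<in> carrier_mat n n" "B * B' = 1\<^sub>m n" "B' * B = 1\<^sub>m n"
    using A B invertible_mat_iff_inverse by metis
  have c: "A * B \<in> carrier_mat n n" "B' * A' \<in> carrier_mat n n"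
    using A B A' B' by (auto intro!: carrier_mult)
  have "B * (B' * A') = A'"
    using assoc_mult_mat[OF B(1) B'(1) A'(1)] B'(2) A'(1) by simp
  then have 1: "A * B * (B' * A') = 1\<^sub>m n"
    using assoc_mult_mat[OF A(1) B(1) mult_carrier_mat[OF B'(1) A'(1)]] A'(2) by simp
  then have "invertible_mat (A * B)"
    unfolding invertible_mat_iff_inverse[OF c(1)]
    using c mat_mult_left_right_inverse[OF c 1] by blast
  moreover have "upper_triangular (A * B)"
  proof (rule upper_triangularI)
    fix i j assume ij: "j < i" "i < dim_row (A * B)"
    then have "i < n" "j < n" using A by auto
    have "A $$ (i, k) * B $$ (k, j) = 0" if "k < n" for k
      using ij A B that upper_triangularD[OF A(2), of k i] upper_triangularD[OF B(2), of j k]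
      by (cases "k < i") auto
    then show "(A * B) $$ (i, j) = 0"
      unfolding index_mult_mat_sum[OF A(1) B(1) \<open>i < n\<close> \<open>j < n\<close>] by (intro sum.neutral) auto
  qed
  ultimately show ?thesis using c by (simp add: borel_group_def)
qed

section \<open>The inverse of \<open>f_map\<close> on \<open>P_set\<close>\<close>

lemma b_mat_in_P:
  assumes n: "1 \<le> n"
  shows "b_mat n X \<in> P_set n"
proof -
  have "upper_triangular (b_mat n X)"
  proof (rule upper_triangularI)
    fix i j assume "j < i" "i < dim_row (b_mat n X)"
    then show "b_mat n X $$ (i, j) = 0"
      using lower_prod_row[of j i n 0 X] by (simp add: b_mat_def)
  qed
  moreover have "invertible_mat (b_mat n X)"
  proof (rule invertible_mat_det[OF b_mat_carrier])
    have "mat n n (\<lambda>(i, j). b_mat n X $$ (i, n - n + j)) = b_mat n X"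
      by (rule eq_matI) (auto simp: b_mat_def)
    then show "det (b_mat n X) \<noteq> 0"
      using minor_b_mat[of n n n X] n by (simp add: minor_def)
  qed
  ultimately show ?thesis
    by (auto simp: P_set_def borel_group_def minor_b_mat)
qed

lemma triangles_eqI:
  assumes "X \<in> triangles n" "Y \<in> triangles n"
    and sums: "\<And>m k. 1 \<le> k \<Longrightarrow> k \<le> m \<Longrightarrow> m \<le> n \<Longrightarrow> (\<Sum>i=1..k. X m i) = (\<Sum>i=1..k. Y m i)"
  shows "X = Y"
proof (intro ext)
  fix m i
  show "X m i = Y m i"
  proof (cases "1 \<le> i \<and> i \<le> m \<and> m \<le> n")
    case True
    then obtain k where i: "i = Suc k" by (cases i) auto
    have "(\<Sum>i=1..k. X m i) = (\<Sum>i=1..k. Y m i)"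
      using sums[of k m] True i by (cases "k = 0") auto
    then show ?thesis using sums[of i m] True i by simp
  next
    case False
    then have "X m i = 0" "Y m i = 0"
      using assms(1,2) unfolding triangles_def mem_Collect_eq by blast+
    then show ?thesis by simp
  qed
qed

lemma f_map_b_mat:
  assumes X: "X \<in> triangles n"
  shows "f_map n (b_mat n X) = X"
  unfolding f_map_def
proof (rule the_equality)
  show "X \<in> triangles n \<and> (\<forall>m k. 1 \<le> k \<and> k \<le> m \<and> m \<le> n \<longrightarrow>
      (\<Sum>i=1..k. X m i) = ln (Re (minor m k (b_mat n X))))"
    using X by (simp add: minor_b_mat)
  show "Y = X" if "Y \<in> triangles n \<and> (\<forall>m k. 1 \<le> k \<and> k \<le> m \<and> m \<le> n \<longrightarrow>
      (\<Sum>i=1..k. Y m i) = ln (Re (minor m k (b_mat n X))))" for Y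
    using that X by (intro triangles_eqI[of _ n]) (auto simp: minor_b_mat)
qed

text \<open>The defining equations of the description \<open>f_map\<close> hold once a triangle
  satisfies them; the witness takes differences of consecutive logarithms, the empty minor
  contributing 0.\<close>

lemma f_map_sums:
  assumes "1 \<le> k" "k \<le> m" "m \<le> n"
  shows "(\<Sum>i=1..k. f_map n b m i) = ln (Re (minor m k b))"
proof -
  define g where "g m i = ln (Re (minor m i b)) - (if i = 1 then 0 else ln (Re (minor m (i - 1) b)))" for m i
  define Y :: triangle where "Y m i = (if 1 \<le> i \<and> i \<le> m \<and> m \<le> n then g m i else 0)" for m i
  have Y: "Y \<in> triangles n" by (simp add: Y_def triangles_def)
  have tele: "1 \<le> k \<Longrightarrow> k \<le> m \<Longrightarrow> m \<le> n \<Longrightarrow> (\<Sum>i=1..k. Y m i) = ln (Re (minor m k b))" for m k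
  proof (induction k)
    case (Suc k)
    then show ?case by (cases "k = 0") (auto simp: Y_def g_def)
  qed simp
  have "f_map n b = Y"
    unfolding f_map_def
    by (rule the_equality) (use Y tele in \<open>auto intro!: triangles_eqI[of _ n]\<close>)
  then show ?thesis using tele assms by simp
qed

text \<open>The entry (r, c) on or above the diagonal is the lower right corner of the minor of size
  r + 1 ending in its column. Expanding along the last row, every other entry lies further left or
  higher in the same column and is known, while the corner is multiplied by the nonzero minor of
  size r ending one column earlier.\<close>

lemma minors_determine:
  assumes b: "b \<in> carrier_mat n n" "upper_triangular b"
    and b': "b' \<in> carrier_mat n n" "upper_triangular b'"
    and minors: "\<And>m k. 1 \<le> k \<Longrightarrow> k \<le> m \<Longrightarrow> m \<le> n \<Longrightarrow> minor m k b = minor m k b' \<and> minor m k b \<noteq> 0"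
  shows "b = b'"
proof -
  have "b $$ (r, c) = b' $$ (r, c)" if "c < n" "r < n" for r c
    using that
  proof (induction c arbitrary: r rule: less_induct)
    case (less c)
    note IHc = less.IH
    have c: "c < n" by (rule less.prems(1))
    from less.prems(2) show ?case
    proof (induction r rule: less_induct)
      case (less r)
      show ?case
      proof (cases "c < r")
        case True
        then show ?thesis
          using upper_triangularD[OF b(2) True] upper_triangularD[OF b'(2) True] b(1) b'(1) less.prems by auto
      next
        case False
        define B where "B a = mat (Suc r) (Suc r) (\<lambda>(i, j). a $$ (i, Suc c - Suc r + j))" for a :: "complex mat"
        have B: "B a \<in> carrier_mat (Suc r) (Suc r)" for a by (simp add: B_def)
        have det: "minor (Suc c) (Suc r) a =
            (\<Sum>j<r. B a $$ (r, j) * cofactor (B a) r j) + a $$ (r, c) * cofactor (B a) r r" for a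
        proof -
          have "B a $$ (r, r) = a $$ (r, c)" using False by (simp add: B_def)
          then show ?thesis
            using laplace_expansion_row[OF B, of r a] by (simp add: minor_def B_def)
        qed
        have del: "mat_delete (B b) r j = mat_delete (B b') r j" if "j \<le> r" for j
        proof (rule eq_matI)
          fix i l assume "i < dim_row (mat_delete (B b') r j)" "l < dim_col (mat_delete (B b') r j)"
          then have il: "i < r" "l < r" by (simp_all add: B_def)
          have "b $$ (i, Suc c - Suc r + l') = b' $$ (i, Suc c - Suc r + l')" if "l' \<le> r" for l'
          proof (cases "l' = r")
            case True
            then show ?thesis using less.IH[of i] less.prems il False by simp
          next
            case l': False
            then have "c - r + l' < c" using that False by linarith
            then show ?thesis using IHc[of "c - r + l'" i] c less.prems il by simp
          qed
          then show "mat_delete (B b) r j $$ (i, l) = mat_delete (B b') r j $$ (i, l)"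
            using il by (simp add: mat_delete_def B_def)
        qed (simp_all add: B_def)
        then have cof: "cofactor (B b) r j = cofactor (B b') r j" if "j \<le> r" for j
          using that by (simp add: cofactor_def)
        have row: "B b $$ (r, j) = B b' $$ (r, j)" if "j < r" for j
          using IHc[of "c - r + j" r] that False c less.prems by (simp add: B_def)
        have "mat_delete (B b) r r = mat r r (\<lambda>(i, j). b $$ (i, c - r + j))"
          by (rule eq_matI) (auto simp: mat_delete_def B_def)
        then have "cofactor (B b) r r = minor c r b"
          by (simp add: cofactor_def minor_def)
        moreover have "minor c r b \<noteq> 0"
        proof (cases "r = 0")
          case True
          then show ?thesis by (simp add: minor_def det_dim_zero)
        next
          case r: False
          then show ?thesis using False c by (intro minors[THEN conjunct2]) auto
        qed
        moreover have "minor (Suc c) (Suc r) b = minor (Suc c) (Suc r) b'"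
          using minors[of "Suc r" "Suc c"] False c by simp
        ultimately show ?thesis
          unfolding det using row cof by simp
      qed
    qed
  qed
  then show ?thesis using b(1) b'(1) by (intro eq_matI) auto
qed

lemma f_map_inj: "inj_on (f_map n) (P_set n)"
proof (rule inj_onI)
  fix b b' assume b: "b \<in> P_set n" and b': "b' \<in> P_set n" and eq: "f_map n b = f_map n b'"
  have minors: "minor m k b = minor m k b' \<and> minor m k b \<noteq> 0" if "1 \<le> k" "k \<le> m" "m \<le> n" for m k
  proof -
    have real: "minor m k b \<in> \<real>" "0 < Re (minor m k b)" "minor m k b' \<in> \<real>" "0 < Re (minor m k b')"
      using b b' that by (auto simp: P_set_def)
    have "ln (Re (minor m k b)) = ln (Re (minor m k b'))"
      using f_map_sums[OF that, of b] f_map_sums[OF that, of b'] eq by simp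
    then have "Re (minor m k b) = Re (minor m k b')" using real by simp
    then have "minor m k b = minor m k b'" using real by (simp add: complex_eq_iff complex_is_Real_iff)
    moreover have "minor m k b \<noteq> 0" using real(2) by auto
    ultimately show ?thesis by simp
  qed
  show "b = b'"
    by (rule minors_determine[OF _ _ _ _ minors]) (use b b' in \<open>auto simp: P_set_def borel_group_def\<close>)
qed

lemma inv_f_map:
  assumes "1 \<le> n" "X \<in> triangles n"
  shows "inv_into (P_set n) (f_map n) X = b_mat n X"
  using inv_into_f_f[OF f_map_inj b_mat_in_P[OF assms(1), of X]] by (simp add: f_map_b_mat[OF assms(2)])

section \<open>The Gauss decomposition of \<open>b_mat n X * w0_bar n\<close>\<close>

lemma upper_fac_borel: "upper_fac n X n \<in> borel_group n"
proof -
  have ut: "upper_triangular (upper_fac n X n)"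
    by (intro upper_triangularI) (auto simp: upper_fac_lower upper_fac_def[of n X n, THEN arg_cong[of _ _ dim_row]])
  moreover have "invertible_mat (upper_fac n X n)"
  proof (rule invertible_mat_det[OF upper_fac_carrier])
    have "0 \<notin> set (diag_mat (upper_fac n X n))"
      using carrier_matD[OF upper_fac_carrier[of n X n]] by (auto simp: diag_mat_def upper_fac_diag)
    then show "det (upper_fac n X n) \<noteq> 0"
      by (simp add: det_upper_triangular[OF ut upper_fac_carrier] prod_list_zero_iff)
  qed
  ultimately show ?thesis by (simp add: borel_group_def)
qed

lemma b_mat_gauss:
  assumes n: "1 \<le> n"
  shows "gauss_decomposition n (b_mat n X * w0_bar n) (lower_prod n X (n - 1)) (upper_fac n X n)"
    and "upper_fac n X n = lower_prod_inv n X (n - 1) * (b_mat n X * w0_bar n)"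
proof -
  have eq: "b_mat n X * w0_bar n = lower_prod n X (n - 1) * upper_fac n X n"
    unfolding w0_bar_eq
  proof (rule eq_matI)
    fix i c assume "i < dim_row (lower_prod n X (n - 1) * upper_fac n X n)"
      "c < dim_col (lower_prod n X (n - 1) * upper_fac n X n)"
    then have ic: "i < n" "c < n"
      using carrier_matD[OF lower_prod_carrier[of n X]] carrier_matD[OF upper_fac_carrier[of n X]] by auto
    show "(b_mat n X * w0_mat n) $$ (i, c) = (lower_prod n X (n - 1) * upper_fac n X n) $$ (i, c)"
      unfolding mult_w0_mat[OF b_mat_carrier ic] index_mult_mat_sum[OF lower_prod_carrier upper_fac_carrier ic]
      by (rule b_mat_factor) (use ic in auto)
  qed (auto simp: w0_mat_def b_mat_def upper_fac_def carrier_matD[OF lower_prod_carrier])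
  then show "gauss_decomposition n (b_mat n X * w0_bar n) (lower_prod n X (n - 1)) (upper_fac n X n)"
    by (simp add: gauss_decomposition_def lower_prod_unitri upper_fac_borel)
  have "lower_prod_inv n X (n - 1) * (b_mat n X * w0_bar n)
      = lower_prod_inv n X (n - 1) * lower_prod n X (n - 1) * upper_fac n X n"
    unfolding eq by (simp add: assoc_mult_mat[of _ n n _ n _ n])
  then show "upper_fac n X n = lower_prod_inv n X (n - 1) * (b_mat n X * w0_bar n)"
    using n by (simp add: lower_prod_inverse left_mult_one_mat[of _ n n])
qed


section \<open>The matrix exponential and linear matrix equations\<close>

lemma pow_mat_left:
  fixes A :: "'a::semiring_1 mat"
  assumes A: "A \<in> carrier_mat n n"
  shows "A * A ^\<^sub>m k = A ^\<^sub>m k * A"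
proof (induction k)
  case (Suc k)
  have "A * (A ^\<^sub>m k * A) = A * A ^\<^sub>m k * A"
    using A pow_carrier_mat[OF A] by (simp add: assoc_mult_mat[of _ n n _ n _ n])
  then show ?case using Suc by simp
qed (use A in simp)

lemma pow_smult_mat:
  fixes A :: "'a::comm_semiring_1 mat"
  assumes A: "A \<in> carrier_mat n n"
  shows "(a \<cdot>\<^sub>m A) ^\<^sub>m k = a ^ k \<cdot>\<^sub>m A ^\<^sub>m k"
proof (induction k)
  case 0
  show ?case using A by (intro eq_matI) auto
next
  case (Suc k)
  have c: "A ^\<^sub>m k \<in> carrier_mat n n" by (rule pow_carrier_mat[OF A])
  have "(a \<cdot>\<^sub>m A) ^\<^sub>m Suc k = (a ^ k \<cdot>\<^sub>m A ^\<^sub>m k) * (a \<cdot>\<^sub>m A)" using Suc by simp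
  also have "\<dots> = a ^ k \<cdot>\<^sub>m (a \<cdot>\<^sub>m (A ^\<^sub>m k * A))"
    using mult_smult_assoc_mat[OF c smult_carrier_mat[OF A], of "a ^ k" a]
      mult_smult_distrib[OF c A, of a] by simp
  also have "\<dots> = a ^ Suc k \<cdot>\<^sub>m A ^\<^sub>m Suc k"
    using A c by (intro eq_matI) (auto simp: mult_ac)
  finally show ?case .
qed

lemma pow_mat_entry_bound:
  fixes A :: "complex mat"
  assumes A: "A \<in> carrier_mat n n"
  obtains C where "\<And>k i j. i < n \<Longrightarrow> j < n \<Longrightarrow> norm ((A ^\<^sub>m k) $$ (i, j)) \<le> C ^ k" "0 \<le> C"
proof -
  define a where "a = (\<Sum>i<n. \<Sum>j<n. norm (A $$ (i, j)))"
  have a: "norm (A $$ (i, j)) \<le> a" if "i < n" "j < n" for i j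
  proof -
    have "norm (A $$ (i, j)) \<le> (\<Sum>j<n. norm (A $$ (i, j)))"
      by (rule member_le_sum) (use that in auto)
    also have "\<dots> \<le> a"
      unfolding a_def by (rule member_le_sum[of _ _ "\<lambda>i. \<Sum>j<n. norm (A $$ (i, j))"])
        (use that in \<open>auto intro: sum_nonneg\<close>)
    finally show ?thesis .
  qed
  have a0: "0 \<le> a" by (auto simp: a_def intro!: sum_nonneg)
  \<comment> \<open>Each entry of a product is a sum of n terms, each at most C^k a; this is the
    origin of the factor n.\<close>
  define C where "C = real n * a"
  have C0: "0 \<le> C" using a0 by (simp add: C_def)
  have "norm ((A ^\<^sub>m k) $$ (i, j)) \<le> C ^ k" if "i < n" "j < n" for k i j
    using that
  proof (induction k arbitrary: j)
    case 0
    then show ?case using A by auto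
  next
    case (Suc k)
    have "(A ^\<^sub>m Suc k) $$ (i, j) = (\<Sum>l<n. (A ^\<^sub>m k) $$ (i, l) * A $$ (l, j))"
      using index_mult_mat_sum[OF pow_carrier_mat[OF A] A Suc.prems] by simp
    also have "norm \<dots> \<le> (\<Sum>l<n. C ^ k * a)"
      by (rule sum_norm_le)
        (use Suc a C0 in \<open>auto simp: norm_mult intro!: mult_mono\<close>)
    finally show ?case by (simp add: C_def mult_ac)
  qed
  then show thesis using C0 by (rule that)
qed

text \<open>The coefficients of an entry of exp (z A) as a power series in a complex variable z, so
  that termwise differentiation of power series applies; real time is a restriction.\<close>

definition exp_coeff :: "complex mat \<Rightarrow> nat \<Rightarrow> nat \<Rightarrow> nat \<Rightarrow> complex" where
  "exp_coeff A i j k = (A ^\<^sub>m k) $$ (i, j) / fact k"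

lemma exp_coeff_summable:
  assumes A: "A \<in> carrier_mat n n" and ij: "i < n" "j < n"
  shows "summable (\<lambda>k. exp_coeff A i j k * z ^ k)"
proof -
  obtain C where C: "\<And>k i j. i < n \<Longrightarrow> j < n \<Longrightarrow> norm ((A ^\<^sub>m k) $$ (i, j)) \<le> C ^ k" "0 \<le> C"
    using pow_mat_entry_bound[OF A] by blast
  show ?thesis
  proof (rule summable_comparison_test)
    show "summable (\<lambda>k. inverse (fact k) * (C * norm z) ^ k)"
      by (rule summable_exp)
    have "norm (exp_coeff A i j k * z ^ k) \<le> inverse (fact k) * (C * norm z) ^ k" for k
      using mult_right_mono[OF C(1)[OF ij, of k], of "norm z ^ k / fact k"]
      by (simp add: exp_coeff_def norm_mult norm_divide norm_power power_mult_distrib field_simps)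
    then show "\<exists>N. \<forall>k\<ge>N. norm (exp_coeff A i j k * z ^ k) \<le> inverse (fact k) * (C * norm z) ^ k"
      by blast
  qed
qed

lemma exp_mat_entry:
  assumes A: "A \<in> carrier_mat n n" and ij: "i < n" "j < n"
  shows "exp_mat (z \<cdot>\<^sub>m A) $$ (i, j) = (\<Sum>k. exp_coeff A i j k * z ^ k)"
proof -
  have "((z \<cdot>\<^sub>m A) ^\<^sub>m k) $$ (i, j) / fact k = exp_coeff A i j k * z ^ k" for k
    using ij carrier_matD[OF pow_carrier_mat[OF A, of k]]
    by (simp add: pow_smult_mat[OF A] exp_coeff_def)
  then show ?thesis using A ij by (simp add: exp_mat_def)
qed

lemma exp_mat_carrier: "A \<in> carrier_mat n n \<Longrightarrow> exp_mat A \<in> carrier_mat n n"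
  by (simp add: exp_mat_def)

lemma exp_mat_zero:
  assumes A: "A \<in> carrier_mat n n"
  shows "exp_mat (0 \<cdot>\<^sub>m A) = 1\<^sub>m n"
proof (rule eq_matI)
  fix i j assume "i < dim_row (1\<^sub>m n :: complex mat)" "j < dim_col (1\<^sub>m n :: complex mat)"
  then have ij: "i < n" "j < n" by auto
  show "exp_mat (0 \<cdot>\<^sub>m A) $$ (i, j) = 1\<^sub>m n $$ (i, j)"
    unfolding exp_mat_entry[OF A ij] powser_zero using A ij by (simp add: exp_coeff_def)
qed (use A in \<open>auto simp: exp_mat_def\<close>)

text \<open>The two forms come from splitting A^(k+1) as A^k A or as A A^k. The uniqueness argument
  takes the first for exp (- t A) and the second for exp (t A).\<close>

lemma exp_mat_deriv:
  assumes A: "A \<in> carrier_mat n n"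
  shows "has_mat_derivative n (\<lambda>s. exp_mat (complex_of_real s \<cdot>\<^sub>m A)) (exp_mat (of_real t \<cdot>\<^sub>m A) * A) t"
    and "has_mat_derivative n (\<lambda>s. exp_mat (complex_of_real s \<cdot>\<^sub>m A)) (A * exp_mat (of_real t \<cdot>\<^sub>m A)) t"
proof -
  let ?E = "exp_mat (complex_of_real t \<cdot>\<^sub>m A)"
  have cE: "?E \<in> carrier_mat n n" using A by (intro exp_mat_carrier) simp
  have D: "((\<lambda>s. exp_mat (complex_of_real s \<cdot>\<^sub>m A) $$ (i, j)) has_vector_derivative
      (\<Sum>k. diffs (exp_coeff A i j) k * of_real t ^ k)) (at t within {0..})"
    if ij: "i < n" "j < n" for i j
    unfolding exp_mat_entry[OF A ij]
    by (intro has_vector_derivative_real_field termdiffs_strong_converges_everywhere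
        exp_coeff_summable[OF A ij])
  have diffs: "diffs (exp_coeff A i j) k = (A ^\<^sub>m Suc k) $$ (i, j) / fact k" for i j k
    by (simp add: diffs_def exp_coeff_def fact_Suc del: pow_mat.simps of_nat_Suc)
  have R: "(\<Sum>k. diffs (exp_coeff A i j) k * of_real t ^ k) = (?E * A) $$ (i, j)"
    if ij: "i < n" "j < n" for i j
  proof -
    have "diffs (exp_coeff A i j) k * of_real t ^ k
        = (\<Sum>l<n. exp_coeff A i l k * of_real t ^ k * A $$ (l, j))" for k
    proof -
      have "(A ^\<^sub>m Suc k) $$ (i, j) = (\<Sum>l<n. (A ^\<^sub>m k) $$ (i, l) * A $$ (l, j))"
        using index_mult_mat_sum[OF pow_carrier_mat[OF A] A ij] by simp
      then show ?thesis
        unfolding diffs by (simp add: exp_coeff_def sum_distrib_left sum_distrib_right sum_divide_distrib mult_ac)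
    qed
    then have "(\<Sum>k. diffs (exp_coeff A i j) k * of_real t ^ k)
        = (\<Sum>k. \<Sum>l<n. exp_coeff A i l k * of_real t ^ k * A $$ (l, j))" by simp
    also have "\<dots> = (\<Sum>l<n. \<Sum>k. exp_coeff A i l k * of_real t ^ k * A $$ (l, j))"
      using exp_coeff_summable[OF A ij(1)] by (intro suminf_sum summable_mult2) auto
    also have "\<dots> = (\<Sum>l<n. ?E $$ (i, l) * A $$ (l, j))"
      using exp_coeff_summable[OF A ij(1)] ij
      by (intro sum.cong) (auto simp: exp_mat_entry[OF A ij(1)] suminf_mult2)
    finally show ?thesis unfolding index_mult_mat_sum[OF cE A ij] .
  qed
  have L: "(\<Sum>k. diffs (exp_coeff A i j) k * of_real t ^ k) = (A * ?E) $$ (i, j)"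
    if ij: "i < n" "j < n" for i j
  proof -
    have "diffs (exp_coeff A i j) k * of_real t ^ k
        = (\<Sum>l<n. A $$ (i, l) * (exp_coeff A l j k * of_real t ^ k))" for k
    proof -
      have "(A ^\<^sub>m Suc k) $$ (i, j) = (\<Sum>l<n. A $$ (i, l) * (A ^\<^sub>m k) $$ (l, j))"
        using index_mult_mat_sum[OF A pow_carrier_mat[OF A] ij] by (simp add: pow_mat_left[OF A, symmetric])
      then show ?thesis
        unfolding diffs by (simp add: exp_coeff_def sum_distrib_left sum_distrib_right sum_divide_distrib mult_ac)
    qed
    then have "(\<Sum>k. diffs (exp_coeff A i j) k * of_real t ^ k)
        = (\<Sum>k. \<Sum>l<n. A $$ (i, l) * (exp_coeff A l j k * of_real t ^ k))" by simp
    also have "\<dots> = (\<Sum>l<n. \<Sum>k. A $$ (i, l) * (exp_coeff A l j k * of_real t ^ k))"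
      using exp_coeff_summable[OF A _ ij(2)] by (intro suminf_sum summable_mult) auto
    also have "\<dots> = (\<Sum>l<n. A $$ (i, l) * ?E $$ (l, j))"
      using exp_coeff_summable[OF A _ ij(2)] ij
      by (intro sum.cong) (auto simp: exp_mat_entry[OF A _ ij(2)] suminf_mult)
    finally show ?thesis unfolding index_mult_mat_sum[OF A cE ij] .
  qed
  show "has_mat_derivative n (\<lambda>s. exp_mat (complex_of_real s \<cdot>\<^sub>m A)) (?E * A) t"
    unfolding has_mat_derivative_def
  proof (intro allI impI)
    fix i j assume ij: "i < n" "j < n"
    show "((\<lambda>s. exp_mat (complex_of_real s \<cdot>\<^sub>m A) $$ (i, j)) has_vector_derivative (?E * A) $$ (i, j))
        (at t within {0..})"
      unfolding R[OF ij, symmetric] by (rule D[OF ij])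
  qed
  show "has_mat_derivative n (\<lambda>s. exp_mat (complex_of_real s \<cdot>\<^sub>m A)) (A * ?E) t"
    unfolding has_mat_derivative_def
  proof (intro allI impI)
    fix i j assume ij: "i < n" "j < n"
    show "((\<lambda>s. exp_mat (complex_of_real s \<cdot>\<^sub>m A) $$ (i, j)) has_vector_derivative (A * ?E) $$ (i, j))
        (at t within {0..})"
      unfolding L[OF ij, symmetric] by (rule D[OF ij])
  qed
qed

lemma has_mat_derivative_zero_constant:
  assumes "\<And>t. 0 \<le> t \<Longrightarrow> has_mat_derivative n A (0\<^sub>m n n) t"
    and c: "\<And>t. A t \<in> carrier_mat n n" and t: "0 \<le> t"
  shows "A t = A 0"
proof (rule eq_matI)
  fix i j assume "i < dim_row (A 0)" "j < dim_col (A 0)"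
  then have ij: "i < n" "j < n" using c[of 0] by auto
  have "\<exists>d. \<forall>s\<in>{0..}. A s $$ (i, j) = d"
    by (rule has_derivative_zero_constant)
      (use assms(1) ij in \<open>auto simp: has_mat_derivative_def has_vector_derivative_def\<close>)
  then show "A t $$ (i, j) = A 0 $$ (i, j)" using t by auto
qed (use c[of t] c[of 0] in auto)

text \<open>Multiplying by \<open>exp (- t A)\<close> turns a solution of \<open>Y' = A Y\<close> into a constant; applied to \<open>Y\<close>
  and to \<open>exp (t A)\<close> this shows that both are inverse to the same matrix.\<close>

lemma exp_mat_unique:
  assumes A: "A \<in> carrier_mat n n" and Yc: "\<And>t. Y t \<in> carrier_mat n n"
    and Y: "\<And>t. 0 \<le> t \<Longrightarrow> has_mat_derivative n Y (A * Y t) t" and Y0: "Y 0 = 1\<^sub>m n"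
    and t: "0 \<le> t"
  shows "Y t = exp_mat (complex_of_real t \<cdot>\<^sub>m A)"
proof -
  let ?N = "\<lambda>t. exp_mat (complex_of_real t \<cdot>\<^sub>m (- A))"
  have cA: "- A \<in> carrier_mat n n" using A by simp
  have cN: "?N t \<in> carrier_mat n n" for t using A by (intro exp_mat_carrier) simp
  have inv: "?N t * Z t = 1\<^sub>m n"
    if Zc: "\<And>t. Z t \<in> carrier_mat n n" and Z: "\<And>t. 0 \<le> t \<Longrightarrow> has_mat_derivative n Z (A * Z t) t"
      and Z0: "Z 0 = 1\<^sub>m n" for Z
  proof -
    have c: "?N t * Z t \<in> carrier_mat n n" for t using cN Zc by (intro carrier_mult)
    have "has_mat_derivative n (\<lambda>s. ?N s * Z s) (0\<^sub>m n n) s" if "0 \<le> s" for s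
    proof -
      have c': "?N s * (- A) \<in> carrier_mat n n" "A * Z s \<in> carrier_mat n n" "?N s * (A * Z s) \<in> carrier_mat n n"
        using cN[of s] Zc[of s] A cA by (auto intro!: carrier_mult simp del: uminus_mult_right_mat)
      have "has_mat_derivative n (\<lambda>s. ?N s * Z s) (?N s * (- A) * Z s + ?N s * (A * Z s)) s"
        by (rule has_mat_derivative_mult[OF cN Zc c'(1,2) exp_mat_deriv(1)[OF cA] Z[OF that]])
      moreover have "?N s * (- A) * Z s = - (?N s * (A * Z s))"
      proof -
        have "?N s * (- A) * Z s = ?N s * ((- A) * Z s)"
          by (rule assoc_mult_mat[OF cN cA Zc])
        also have "(- A) * Z s = - (A * Z s)" using A Zc[of s] by (intro uminus_mult_left_mat) auto
        also have "?N s * - (A * Z s) = - (?N s * (A * Z s))"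
          using cN[of s] c'(2) by (intro uminus_mult_right_mat) auto
        finally show ?thesis .
      qed
      ultimately show ?thesis using uminus_l_inv_mat[OF c'(3)] by simp
    qed
    then have "?N t * Z t = ?N 0 * Z 0"
      by (rule has_mat_derivative_zero_constant[OF _ c t])
    then show ?thesis using Z0 exp_mat_zero[OF cA] by simp
  qed
  let ?E = "\<lambda>t. exp_mat (complex_of_real t \<cdot>\<^sub>m A)"
  have cE: "?E t \<in> carrier_mat n n" for t using A by (intro exp_mat_carrier) simp
  have NY: "?N t * Y t = 1\<^sub>m n" using inv[OF Yc Y Y0] .
  have NE: "?N t * ?E t = 1\<^sub>m n"
    using inv[OF cE exp_mat_deriv(2)[OF A]] exp_mat_zero[OF A] by simp
  have "Y t = Y t * (?N t * ?E t)" using NE Yc[of t] by simp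
  also have "\<dots> = Y t * ?N t * ?E t" by (rule assoc_mult_mat[OF Yc cN cE, symmetric])
  also have "Y t * ?N t = 1\<^sub>m n" by (rule mat_mult_left_right_inverse[OF cN Yc NY])
  finally show ?thesis using cE[of t] by simp
qed

lemma has_mat_derivative_const_mult:
  assumes "C \<in> carrier_mat n n" "\<And>s. A s \<in> carrier_mat n n" "D \<in> carrier_mat n n"
    and "has_mat_derivative n A D t"
  shows "has_mat_derivative n (\<lambda>s. C * A s) (C * D) t"
proof -
  have "has_mat_derivative n (\<lambda>s. C * A s) (0\<^sub>m n n * A t + C * D) t"
    using assms by (intro has_mat_derivative_mult has_mat_derivative_const) auto
  moreover have "0\<^sub>m n n * A t + C * D = C * D"
    using assms(2)[of t] carrier_mult[OF assms(1,3)] by simp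
  ultimately show ?thesis by simp
qed

lemma has_mat_derivative_mult_const:
  assumes "C \<in> carrier_mat n n" "\<And>s. A s \<in> carrier_mat n n" "D \<in> carrier_mat n n"
    and "has_mat_derivative n A D t"
  shows "has_mat_derivative n (\<lambda>s. A s * C) (D * C) t"
proof -
  have "has_mat_derivative n (\<lambda>s. A s * C) (D * C + A t * 0\<^sub>m n n) t"
    using assms by (intro has_mat_derivative_mult has_mat_derivative_const) auto
  moreover have "D * C + A t * 0\<^sub>m n n = D * C"
    using assms(2)[of t] carrier_mult[OF assms(3,1)] by simp
  ultimately show ?thesis by simp
qed

lemma mat_uminus_add_minus:
  fixes A :: "'a::ab_group_add mat"
  assumes "A \<in> carrier_mat n n" "B \<in> carrier_mat n n"
  shows "- A + B = B - A"
  using assms by (intro eq_matI) auto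

lemma char_poly_eps:
  "char_poly (eps_mat n lam) = (\<Prod>i=1..n. [:- complex_of_real (lam i), 1:])"
proof -
  have "upper_triangular (eps_mat n lam)"
    by (rule upper_triangularI) (auto simp: eps_mat_def)
  then have "char_poly (eps_mat n lam) = (\<Prod>a\<leftarrow>diag_mat (eps_mat n lam). [:- a, 1:])"
    by (rule char_poly_upper_triangular[OF eps_mat_carrier])
  also have "diag_mat (eps_mat n lam) = map (\<lambda>i. complex_of_real (lam (i + 1))) [0..<n]"
    by (rule nth_equalityI) (auto simp: diag_mat_def eps_mat_def)
  also have "(\<Prod>a\<leftarrow>map (\<lambda>i. complex_of_real (lam (i + 1))) [0..<n]. [:- a, 1:])
      = (\<Prod>i<n. [:- complex_of_real (lam (i + 1)), 1:])"
    using prod.distinct_set_conv_list[of "[0..<n]" "\<lambda>i. [:- complex_of_real (lam (i + 1)), 1:]"]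
    by (simp add: comp_def atLeast0LessThan)
  also have "\<dots> = (\<Prod>i=1..n. [:- complex_of_real (lam i), 1:])"
    by (rule prod.reindex_bij_witness[of _ "\<lambda>i. i - 1" Suc]) auto
  finally show ?thesis .
qed

lemma toda_mat_hessenberg: "toda_mat n lam X m \<in> tridiag_hessenberg n"
  by (auto simp: tridiag_hessenberg_def toda_mat_def)

section \<open>The Toda equation and the decompositions in time\<close>

context critical_flow
begin

context
  assumes n_pos: "1 \<le> n"
begin

abbreviation "LL \<equiv> Lo (n - 1)"
abbreviation "LI \<equiv> Li (n - 1)"
abbreviation "MM \<equiv> Mm n"
abbreviation "QQ \<equiv> Qm n"
abbreviation "RR t \<equiv> upper_fac n (X t) n"

lemma LI_LL: "LI t * LL t = 1\<^sub>m n" and LL_LI: "LL t * LI t = 1\<^sub>m n"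
  using lower_prod_inverse lower_prod_inverse' n_pos by simp_all

lemma LL_MM: "0 \<le> t \<Longrightarrow> LL t * MM t = eps_mat n lam * LL t"
  using lower_prod_toda[of n lam "X t" "n - 1"] cr n_pos by simp

lemma MM_eq: "0 \<le> t \<Longrightarrow> MM t = LI t * (eps_mat n lam * LL t)"
  unfolding LL_MM[symmetric]
  by (simp add: assoc[OF lower_prod_inv_carrier lower_prod_carrier toda_mat_carrier, symmetric]
      LI_LL left_mult_one_mat[of _ n n] del: One_nat_def)

lemma inv_LL: "inv_mat (LL t) = LI t"
  by (rule inv_mat_eqI[of _ n]) (auto simp: LI_LL simp del: One_nat_def)

lemma LL_deriv: "0 \<le> t \<Longrightarrow> has_mat_derivative n LL (LL t * QQ t) t"
  and LI_deriv: "0 \<le> t \<Longrightarrow> has_mat_derivative n LI (- QQ t * LI t) t"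
  using lower_prod_deriv[of "n - 1" t] lower_prod_inv_deriv[of "n - 1" t] n_pos by simp_all

text \<open>The Lax form is obtained by differentiating the conjugation of the constant matrix
  \<open>eps_mat\<close>, not entry by entry: the derivative of \<open>LI\<close> contributes - Q M
  and that of \<open>LL\<close> contributes M Q.\<close>

lemma MM_deriv:
  assumes t: "0 \<le> t"
  shows "has_mat_derivative n MM (MM t * QQ t - QQ t * MM t) t"
proof -
  let ?e = "eps_mat n lam"
  have c: "?e * LL s \<in> carrier_mat n n" "- QQ t * LI t \<in> carrier_mat n n"
    "LL t * QQ t \<in> carrier_mat n n" "?e * (LL t * QQ t) \<in> carrier_mat n n"
    "MM t * QQ t \<in> carrier_mat n n" "QQ t * MM t \<in> carrier_mat n n" for s
    by (auto intro!: carrier_mult simp del: uminus_mult_left_mat)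
  have "has_mat_derivative n (\<lambda>s. LI s * (?e * LL s))
      (- QQ t * LI t * (?e * LL t) + LI t * (?e * (LL t * QQ t))) t"
    using c t
    by (intro has_mat_derivative_mult has_mat_derivative_const_mult LI_deriv LL_deriv) auto
  moreover have "- QQ t * LI t * (?e * LL t) = - (QQ t * MM t)"
  proof -
    have "- QQ t * LI t * (?e * LL t) = - QQ t * (LI t * (?e * LL t))"
      by (rule assoc) (use c in auto)
    also have "\<dots> = - QQ t * MM t" by (simp only: MM_eq[OF t, symmetric])
    also have "\<dots> = - (QQ t * MM t)"
      by (rule uminus_mult_left_mat) (simp add: toda_lower_def toda_mat_def)
    finally show ?thesis .
  qed
  moreover have "LI t * (?e * (LL t * QQ t)) = MM t * QQ t"
    unfolding MM_eq[OF t] by (simp add: assoc carrier_mult)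
  ultimately have "has_mat_derivative n (\<lambda>s. LI s * (?e * LL s)) (MM t * QQ t - QQ t * MM t) t"
    using mat_uminus_add_minus[OF c(6,5)] by simp
  then show ?thesis
    by (rule has_mat_derivative_cong) (use t MM_eq in auto)
qed

text \<open>R = L^(-1) b w0 is differentiated as a product. The derivative of L^(-1) gives - Q R,
  and b' = eps b gives L^(-1) eps L R = M R.\<close>

lemma RR_deriv:
  assumes t: "0 \<le> t"
  shows "has_mat_derivative n RR ((MM t - QQ t) * RR t) t"
proof -
  let ?e = "eps_mat n lam" and ?b = "\<lambda>s. b_mat n (X s)" and ?w = "w0_bar n"
  have w: "?w \<in> carrier_mat n n" by (simp add: w0_bar_eq)
  have R: "RR s = LI s * (?b s * ?w)" for s by (rule b_mat_gauss(2)[OF n_pos])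
  have c: "?b s * ?w \<in> carrier_mat n n" "- QQ t * LI t \<in> carrier_mat n n"
    "?e * ?b t \<in> carrier_mat n n" "?e * ?b t * ?w \<in> carrier_mat n n"
    "MM t * RR t \<in> carrier_mat n n" "QQ t * RR t \<in> carrier_mat n n" for s
    using w by (auto intro!: carrier_mult simp del: uminus_mult_left_mat)
  have "has_mat_derivative n (\<lambda>s. LI s * (?b s * ?w))
      (- QQ t * LI t * (?b t * ?w) + LI t * (?e * ?b t * ?w)) t"
    using c t w
    by (intro has_mat_derivative_mult has_mat_derivative_mult_const LI_deriv b_mat_deriv) auto
  moreover have "- QQ t * LI t * (?b t * ?w) = - (QQ t * RR t)"
  proof -
    have "- QQ t * LI t * (?b t * ?w) = - QQ t * (LI t * (?b t * ?w))"
      by (rule assoc) (use c in auto)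
    also have "\<dots> = - QQ t * RR t" by (simp only: R)
    also have "\<dots> = - (QQ t * RR t)"
      by (rule uminus_mult_left_mat) (simp add: toda_lower_def upper_fac_def)
    finally show ?thesis .
  qed
  moreover have "LI t * (?e * ?b t * ?w) = MM t * RR t"
  proof -
    have "MM t * RR t = LI t * (?e * (LL t * RR t))"
      unfolding MM_eq[OF t] by (simp add: assoc carrier_mult)
    also have "LL t * RR t = ?b t * ?w"
      using b_mat_gauss(1)[OF n_pos, of "X t"] by (simp add: gauss_decomposition_def)
    also have "?e * (?b t * ?w) = ?e * ?b t * ?w"
      by (rule assoc[symmetric]) (use w in auto)
    finally show ?thesis by simp
  qed
  moreover have "- (QQ t * RR t) + MM t * RR t = (MM t - QQ t) * RR t"
    using minus_mult_distrib_mat[OF toda_mat_carrier toda_lower_carrier upper_fac_carrier]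
      mat_uminus_add_minus[OF c(6,5)] by simp
  ultimately show ?thesis unfolding R by (simp only:)
qed

abbreviation "NN t \<equiv> LI 0 * LL t"
abbreviation "rr t \<equiv> RR t * inv_mat (RR 0)"

lemma inv_RR: "inv_mat (RR 0) \<in> borel_group n" "inv_mat (RR 0) \<in> carrier_mat n n"
  "RR 0 * inv_mat (RR 0) = 1\<^sub>m n"
  using borel_group_inv[OF upper_fac_borel] inv_mat_inverse[OF upper_fac_carrier, of n "X 0" n]
    upper_fac_borel[of n "X 0"] by (auto simp: borel_group_def)

lemma NN_deriv: "0 \<le> t \<Longrightarrow> has_mat_derivative n NN (NN t * QQ t) t"
  using has_mat_derivative_const_mult[OF lower_prod_inv_carrier _ _ LL_deriv]
  by (simp add: assoc carrier_mult)

lemma rr_deriv: "0 \<le> t \<Longrightarrow> has_mat_derivative n rr ((MM t - QQ t) * rr t) t"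
  using has_mat_derivative_mult_const[OF inv_RR(2) upper_fac_carrier _ RR_deriv, of t]
    minus_carrier_mat[OF toda_lower_carrier[of n "X t" n], of "MM t"]
  by (simp add: assoc carrier_mult inv_RR)

text \<open>The terms with Q cancel in (n r)' = n Q r + n (M - Q) r = n M r, and L M = eps L moves M
  through n as M(0). So n r solves the equation that characterises exp (t M(0)).\<close>

lemma NN_rr_gauss:
  assumes t: "0 \<le> t"
  shows "gauss_decomposition n (exp_mat (complex_of_real t \<cdot>\<^sub>m MM 0)) (NN t) (rr t)"
proof -
  have cN: "NN s \<in> carrier_mat n n" and cr: "rr s \<in> carrier_mat n n" for s
    using inv_RR(2) by (auto intro!: carrier_mult)
  have cP: "MM s - QQ s \<in> carrier_mat n n" for s by (auto intro: minus_carrier_mat)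
  have "NN t * rr t = exp_mat (complex_of_real t \<cdot>\<^sub>m MM 0)"
  proof (rule exp_mat_unique[OF toda_mat_carrier _ _ _ t])
    show "NN s * rr s \<in> carrier_mat n n" for s using cN cr by (rule carrier_mult)
    show "NN 0 * rr 0 = 1\<^sub>m n" using inv_RR by (simp add: LI_LL del: One_nat_def)
    fix s :: real assume s: "0 \<le> s"
    have "has_mat_derivative n (\<lambda>s. NN s * rr s) (NN s * QQ s * rr s + NN s * ((MM s - QQ s) * rr s)) s"
      using cN cr cP by (intro has_mat_derivative_mult NN_deriv rr_deriv s carrier_mult) (auto simp: inv_RR(2))
    moreover have "NN s * QQ s * rr s + NN s * ((MM s - QQ s) * rr s) = MM 0 * (NN s * rr s)"
    proof -
      have "NN s * QQ s * rr s + NN s * ((MM s - QQ s) * rr s)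
          = NN s * (QQ s * rr s) + NN s * ((MM s - QQ s) * rr s)"
        using assoc[OF cN toda_lower_carrier cr] by simp
      also have "\<dots> = NN s * (QQ s * rr s + (MM s - QQ s) * rr s)"
        using cN cr cP by (intro mult_add_distrib_mat[of _ n n _ n, symmetric] carrier_mult) (auto simp: inv_RR(2))
      also have "QQ s * rr s + (MM s - QQ s) * rr s = (QQ s + (MM s - QQ s)) * rr s"
        using cr cP by (intro add_mult_distrib_mat[of _ n n _ _ n, symmetric]) auto
      also have "QQ s + (MM s - QQ s) = MM s"
        by (intro eq_matI) (auto simp: toda_lower_def toda_mat_def)
      also have "NN s * (MM s * rr s) = LI 0 * (LL s * MM s) * rr s"
        using cr[of s] by (simp add: assoc carrier_mult)
      also have "\<dots> = LI 0 * (eps_mat n lam * LL s) * rr s"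
        by (simp only: LL_MM[OF s])
      \<comment> \<open>The identity \<open>LL 0 * LI 0\<close> is inserted so that the left part
        becomes the conjugate \<open>MM 0\<close> and the rest becomes \<open>NN s\<close>.\<close>
      also have "\<dots> = LI 0 * (eps_mat n lam * (LL 0 * LI 0 * LL s)) * rr s"
        by (simp add: LL_LI left_mult_one_mat[of _ n n] del: One_nat_def)
      also have "\<dots> = LI 0 * (eps_mat n lam * LL 0) * (NN s * rr s)"
        using cr[of s] by (simp add: assoc carrier_mult)
      finally show ?thesis by (simp only: MM_eq[of 0, symmetric] order_refl)
    qed
    ultimately show "has_mat_derivative n (\<lambda>s. NN s * rr s) (MM 0 * (NN s * rr s)) s"
      by (simp only:)
  qed
  then show ?thesis
    using lower_unitri_mult[OF lower_prod_inv_unitri lower_prod_unitri]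
      borel_group_mult[OF upper_fac_borel inv_RR(1)]
    by (simp add: gauss_decomposition_def)
qed

lemma MM_in_M_lam:
  assumes t: "0 \<le> t"
  shows "MM t \<in> M_lam n lam"
proof -
  have "MM t = LI t * eps_mat n lam * LL t"
    using MM_eq[OF t] by (simp add: assoc)
  moreover have "{MM t, eps_mat n lam, LI t, LL t} \<subseteq> carrier_mat n n" by simp
  ultimately have "similar_mat_wit (MM t) (eps_mat n lam) (LI t) (LL t)"
    unfolding similar_mat_wit_def Let_def carrier_matD(1)[OF toda_mat_carrier]
    using LI_LL LL_LI by blast
  then have "char_poly (MM t) = char_poly (eps_mat n lam)"
    using char_poly_similar unfolding similar_mat_def by blast
  then show ?thesis by (simp add: M_lam_def toda_mat_hessenberg char_poly_eps)
qed

end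

end

section \<open>The variational principle\<close>

definition lin_part :: "nat \<Rightarrow> (nat \<Rightarrow> real) \<Rightarrow> triangle \<Rightarrow> real" where
  "lin_part n lam X = (\<Sum>m=1..n. lam m * ((\<Sum>i=1..m - 1. X (m - 1) i) - (\<Sum>i=1..m. X m i)))"

text \<open>The differential of \<open>F_lam\<close> at \<open>X\<close> applied to the direction
  \<open>H\<close>. Directions that move the bottom row are included; they yield the gradient of
  \<open>u_fun\<close>.\<close>

definition dF :: "nat \<Rightarrow> (nat \<Rightarrow> real) \<Rightarrow> triangle \<Rightarrow> triangle \<Rightarrow> real" where
  "dF n lam X H = lin_part n lam H + (\<Sum>m=1..<n. \<Sum>i=1..m.
     tri_u X m i * (H (m + 1) (i + 1) - H m i) + tri_v X m i * (H m i - H (m + 1) i))"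

definition tri_unit :: "nat \<Rightarrow> nat \<Rightarrow> triangle" where
  "tri_unit k j = (\<lambda>m i. if m = k \<and> i = j then 1 else 0)"

lemma F_lam_alt: "F_lam n lam X = lin_part n lam X + (\<Sum>m=1..<n. \<Sum>i=1..m. tri_u X m i + tri_v X m i)"
  by (simp add: F_lam_def lin_part_def F_fun_def tri_u_def tri_v_def)

lemma lin_part_add: "lin_part n lam (\<lambda>m i. H m i + c * K m i) = lin_part n lam H + c * lin_part n lam K"
  by (simp add: lin_part_def sum.distrib sum_subtractf sum_distrib_left algebra_simps)

lemma dF_add: "dF n lam X (\<lambda>m i. H m i + c * K m i) = dF n lam X H + c * dF n lam X K"
  by (simp add: dF_def lin_part_add sum.distrib sum_subtractf sum_distrib_left algebra_simps)

lemma dF_zero: "dF n lam X (\<lambda>m i. 0) = 0"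
  by (simp add: dF_def lin_part_def)

lemma dF_sum:
  "finite A \<Longrightarrow> dF n lam X (\<lambda>m i. \<Sum>p\<in>A. c p * H p m i) = (\<Sum>p\<in>A. c p * dF n lam X (H p))"
proof (induction A rule: finite_induct)
  case (insert p A)
  then show ?case
    using dF_add[of n lam X "\<lambda>m i. \<Sum>p\<in>A. c p * H p m i" "c p" "H p"] by (simp add: add.commute)
qed (simp add: dF_zero)

lemma dF_expand:
  assumes H: "H \<in> triangles n"
  shows "dF n lam X H = (\<Sum>k=1..n. \<Sum>j=1..k. H k j * dF n lam X (tri_unit k j))"
proof -
  have "H m i = (\<Sum>p\<in>Sigma {1..n} (\<lambda>k. {1..k}). H (fst p) (snd p) * tri_unit (fst p) (snd p) m i)" for m i
  proof -
    have "(\<Sum>p\<in>Sigma {1..n} (\<lambda>k. {1..k}). H (fst p) (snd p) * tri_unit (fst p) (snd p) m i)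
        = (\<Sum>p\<in>Sigma {1..n} (\<lambda>k. {1..k}). if p = (m, i) then H m i else 0)"
      by (rule sum.cong) (auto simp: tri_unit_def)
    also have "\<dots> = (if (m, i) \<in> Sigma {1..n} (\<lambda>k. {1..k}) then H m i else 0)"
      by (simp add: sum.delta)
    also have "\<dots> = H m i"
      using H by (auto simp: triangles_def)
    finally show ?thesis by simp
  qed
  then have "H = (\<lambda>m i. \<Sum>p\<in>Sigma {1..n} (\<lambda>k. {1..k}). H (fst p) (snd p) * tri_unit (fst p) (snd p) m i)"
    by (intro ext)
  then have "dF n lam X H = dF n lam X (\<lambda>m i. \<Sum>p\<in>Sigma {1..n} (\<lambda>k. {1..k}). H (fst p) (snd p) * tri_unit (fst p) (snd p) m i)"
    by (rule arg_cong)
  also have "\<dots> = (\<Sum>p\<in>Sigma {1..n} (\<lambda>k. {1..k}). H (fst p) (snd p) * dF n lam X (tri_unit (fst p) (snd p)))"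
    by (rule dF_sum) simp
  also have "\<dots> = (\<Sum>k=1..n. \<Sum>j=1..k. H k j * dF n lam X (tri_unit k j))"
    by (subst sum.Sigma) (auto simp: case_prod_beta)
  finally show ?thesis .
qed

lemma sum_tri_unit:
  "(\<Sum>m=1..<n. \<Sum>i=1..m. f m i * tri_unit a b m i) = (if 1 \<le> b \<and> b \<le> a \<and> a < n then f a b else 0)"
proof -
  have "(\<Sum>i=1..m. f m i * tri_unit a b m i) = (if m = a then (if 1 \<le> b \<and> b \<le> a then f a b else 0) else 0)" for m
  proof -
    have "(\<Sum>i=1..m. f m i * tri_unit a b m i) = (\<Sum>i=1..m. if i = b then (if m = a then f a b else 0) else 0)"
      by (rule sum.cong) (auto simp: tri_unit_def)
    then show ?thesis by auto
  qed
  then show ?thesis by auto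
qed

lemma dF_tri_unit:
  assumes kj: "1 \<le> j" "j \<le> k" "k \<le> n"
  shows "dF n lam X (tri_unit k j) = (if k < n then lam (k + 1) else 0) - lam k
    + (if 1 < j then tri_u X (k - 1) (j - 1) else 0) - (if k < n then tri_u X k j else 0)
    + (if k < n then tri_v X k j else 0) - (if j < k then tri_v X (k - 1) j else 0)"
proof -
  have row: "(\<Sum>i=1..m. tri_unit k j m i) = (if m = k then 1 else 0)" for m
  proof -
    have "(\<Sum>i=1..m. tri_unit k j m i) = (\<Sum>i=1..m. if i = j then (if m = k then 1 else 0) else 0)"
      by (rule sum.cong) (auto simp: tri_unit_def)
    then show ?thesis using kj by auto
  qed
  have "lin_part n lam (tri_unit k j)
      = (\<Sum>m=1..n. (if m = k + 1 then lam m else 0) - (if m = k then lam m else 0))"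
    unfolding lin_part_def row by (rule sum.cong) (use kj in auto)
  also have "\<dots> = (if k < n then lam (k + 1) else 0) - lam k"
    using kj by (simp add: sum_subtractf)
  finally have lin: "lin_part n lam (tri_unit k j) = (if k < n then lam (k + 1) else 0) - lam k" .
  \<comment> \<open>For j = 1 the truncated subtraction yields a unit at index 0, outside the range
    of summation, so the missing neighbour drops out by itself.\<close>
  have shift: "tri_unit k j (m + 1) (i + 1) = tri_unit (k - 1) (j - 1) m i"
    "tri_unit k j (m + 1) i = tri_unit (k - 1) j m i" if "1 \<le> m" "1 \<le> i" for m i
    using kj that by (auto simp: tri_unit_def)
  have "(\<Sum>m=1..<n. \<Sum>i=1..m. tri_u X m i * (tri_unit k j (m + 1) (i + 1) - tri_unit k j m i)
        + tri_v X m i * (tri_unit k j m i - tri_unit k j (m + 1) i))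
      = (\<Sum>m=1..<n. \<Sum>i=1..m. tri_u X m i * tri_unit (k - 1) (j - 1) m i - tri_u X m i * tri_unit k j m i
        + tri_v X m i * tri_unit k j m i - tri_v X m i * tri_unit (k - 1) j m i)"
  proof (intro sum.cong refl)
    fix m i assume "m \<in> {1..<n}" "i \<in> {1..m}"
    then have mi: "1 \<le> m" "1 \<le> i" by auto
    show "tri_u X m i * (tri_unit k j (m + 1) (i + 1) - tri_unit k j m i)
        + tri_v X m i * (tri_unit k j m i - tri_unit k j (m + 1) i)
      = tri_u X m i * tri_unit (k - 1) (j - 1) m i - tri_u X m i * tri_unit k j m i
        + tri_v X m i * tri_unit k j m i - tri_v X m i * tri_unit (k - 1) j m i"
      by (simp only: shift(1)[OF mi] shift(2)[OF mi]) (simp add: algebra_simps)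
  qed
  also have "\<dots> = (if 1 < j then tri_u X (k - 1) (j - 1) else 0) - (if k < n then tri_u X k j else 0)
    + (if k < n then tri_v X k j else 0) - (if j < k then tri_v X (k - 1) j else 0)"
    unfolding sum.distrib sum_subtractf sum_tri_unit using kj by auto
  finally show ?thesis unfolding dF_def lin by simp
qed

lemma F_lam_coordinate_deriv:
  "((\<lambda>s. F_lam n lam (X(m := (X m)(i := s)))) has_real_derivative dF n lam X (tri_unit m i)) (at (X m i))"
proof -
  have line: "((\<lambda>s. a + (s - c) * h) has_real_derivative h) (at c)" for a c h :: real
    by (auto intro!: derivative_eq_intros)
  have exp_line: "((\<lambda>s. exp (a + (s - c) * h)) has_real_derivative exp a * h) (at c)" for a c h :: real
    by (auto intro!: derivative_eq_intros)
  have upd: "X(m := (X m)(i := s)) = (\<lambda>k j. X k j + (s - X m i) * tri_unit m i k j)" for s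
    by (auto simp: tri_unit_def fun_eq_iff)
  have u: "tri_u (\<lambda>k j. X k j + d * tri_unit m i k j) k j
      = exp (X (k + 1) (j + 1) - X k j + d * (tri_unit m i (k + 1) (j + 1) - tri_unit m i k j))"
    and v: "tri_v (\<lambda>k j. X k j + d * tri_unit m i k j) k j
      = exp (X k j - X (k + 1) j + d * (tri_unit m i k j - tri_unit m i (k + 1) j))" for d k j
    by (simp_all add: tri_u_def tri_v_def algebra_simps)
  show ?thesis
    unfolding upd F_lam_alt lin_part_add dF_def u v tri_u_def[of X] tri_v_def[of X]
    by (intro DERIV_add DERIV_sum exp_line line)
qed

lemma critical_point_iff:
  "critical_point n lam X \<longleftrightarrow> (\<forall>m i. 1 \<le> i \<and> i \<le> m \<and> m < n \<longrightarrow> dF n lam X (tri_unit m i) = 0)"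
  unfolding critical_point_def using F_lam_coordinate_deriv DERIV_unique by metis

lemma exp_tangent: "exp a + exp a * (b - a) \<le> exp (b::real)"
  and exp_tangent_eq: "exp b = exp a + exp a * (b - a) \<Longrightarrow> b = (a::real)"
proof -
  have e: "exp b = exp a * exp (b - a)" by (simp add: exp_diff)
  have "exp a * (1 + (b - a)) \<le> exp a * exp (b - a)"
    using exp_ge_add_one_self[of "b - a"] by (intro mult_left_mono) auto
  then show "exp a + exp a * (b - a) \<le> exp b" unfolding e by (simp add: algebra_simps)
  assume "exp b = exp a + exp a * (b - a)"
  then have "exp a * exp (b - a) = exp a * (1 + (b - a))" unfolding e by (simp add: algebra_simps)
  then have "exp (b - a) = 1 + (b - a)" using mult_cancel_left[of "exp a"] exp_not_eq_zero by blast
  then have "ln (exp (b - a)) = exp (b - a) - 1" unfolding ln_exp by simp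
  then have "exp (b - a) = 1" by (intro ln_eq_minus_one) auto
  then show "b = a" by simp
qed

text \<open>The Bregman divergence of the exponential function: the height of the graph at b above
  the tangent at a.\<close>

definition exp_gap :: "real \<Rightarrow> real \<Rightarrow> real" where
  "exp_gap a b = exp b - exp a - exp a * (b - a)"

lemma exp_gap_nonneg: "0 \<le> exp_gap a b"
  using exp_tangent[of a b] by (simp add: exp_gap_def)

lemma exp_gap_zero: "exp_gap a b = 0 \<Longrightarrow> b = a"
  using exp_tangent_eq[of b a] by (simp add: exp_gap_def)

text \<open>The linear part cancels, leaving a sum of nonnegative divergences. Convexity is their
  sign, and strictness is their vanishing only at equal exponents.\<close>

lemma F_lam_gap:
  "F_lam n lam Y - F_lam n lam X - dF n lam X (\<lambda>m i. Y m i - X m i)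
    = (\<Sum>m=1..<n. \<Sum>i=1..m. exp_gap (X (m + 1) (i + 1) - X m i) (Y (m + 1) (i + 1) - Y m i)
      + exp_gap (X m i - X (m + 1) i) (Y m i - Y (m + 1) i))"
proof -
  have lin: "lin_part n lam (\<lambda>m i. Y m i - X m i) = lin_part n lam Y - lin_part n lam X"
    using lin_part_add[of n lam Y "- 1" X] by simp
  show ?thesis
    unfolding F_lam_alt dF_def lin exp_gap_def tri_u_def tri_v_def
    by (simp add: sum_subtractf sum.distrib algebra_simps)
qed

lemma F_lam_convex:
  "F_lam n lam X + dF n lam X (\<lambda>m i. Y m i - X m i) \<le> F_lam n lam Y"
proof -
  have "0 \<le> F_lam n lam Y - F_lam n lam X - dF n lam X (\<lambda>m i. Y m i - X m i)"
    unfolding F_lam_gap by (intro sum_nonneg add_nonneg_nonneg exp_gap_nonneg)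
  then show ?thesis by simp
qed

text \<open>At a critical point a displacement is felt only through the bottom row. Equal bottom
  rows give minimality; bottom rows differing in one entry give the slope of
  \<open>u_fun\<close>.\<close>

lemma dF_critical:
  assumes "critical_point n lam X" "X \<in> triangles n" "Y \<in> triangles n" "1 \<le> n"
  shows "dF n lam X (\<lambda>m i. Y m i - X m i) = (\<Sum>j=1..n. (Y n j - X n j) * dF n lam X (tri_unit n j))"
proof -
  have "(\<lambda>m i. Y m i - X m i) \<in> triangles n" using assms by (simp add: triangles_def)
  then have "dF n lam X (\<lambda>m i. Y m i - X m i)
      = (\<Sum>k=1..n. \<Sum>j=1..k. (Y k j - X k j) * dF n lam X (tri_unit k j))"
    by (rule dF_expand)
  also have "\<dots> = (\<Sum>k=1..n. if k = n then \<Sum>j=1..k. (Y k j - X k j) * dF n lam X (tri_unit k j) else 0)"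
    using assms(1) by (intro sum.cong) (auto simp: critical_point_iff intro!: sum.neutral)
  also have "\<dots> = (\<Sum>j=1..n. (Y n j - X n j) * dF n lam X (tri_unit n j))"
    using assms(4) by simp
  finally show ?thesis .
qed

lemma critical_point_le:
  assumes "critical_point n lam X" "X \<in> triangles_over n x" "Y \<in> triangles_over n x" "1 \<le> n"
  shows "F_lam n lam X \<le> F_lam n lam Y"
proof -
  have "dF n lam X (\<lambda>m i. Y m i - X m i) = 0"
    using assms by (subst dF_critical) (auto simp: triangles_over_def)
  then show ?thesis using F_lam_convex[of n lam X Y] by simp
qed

text \<open>Both triangles minimise, so their values agree, all divergences vanish and corresponding
  exponents coincide.\<close>

lemma critical_point_unique:
  assumes X: "critical_point n lam X" "X \<in> triangles_over n x"
    and Y: "critical_point n lam Y" "Y \<in> triangles_over n x" and n: "1 \<le> n"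
  shows "X = Y"
proof -
  have "dF n lam X (\<lambda>m i. Y m i - X m i) = 0"
    using assms by (subst dF_critical) (auto simp: triangles_over_def)
  moreover have "F_lam n lam X = F_lam n lam Y"
    using critical_point_le[OF X Y(2) n] critical_point_le[OF Y X(2) n] by simp
  ultimately have "(\<Sum>m=1..<n. \<Sum>i=1..m. exp_gap (X (m + 1) (i + 1) - X m i) (Y (m + 1) (i + 1) - Y m i)
      + exp_gap (X m i - X (m + 1) i) (Y m i - Y (m + 1) i)) = 0"
    using F_lam_gap[of n lam Y X] by simp
  then have "\<forall>m\<in>{1..<n}. (\<Sum>i=1..m. exp_gap (X (m + 1) (i + 1) - X m i) (Y (m + 1) (i + 1) - Y m i)
      + exp_gap (X m i - X (m + 1) i) (Y m i - Y (m + 1) i)) = 0"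
    by (subst (asm) sum_nonneg_eq_0_iff) (auto intro!: sum_nonneg add_nonneg_nonneg exp_gap_nonneg)
  then have row: "(\<Sum>i=1..m. exp_gap (X (m + 1) (i + 1) - X m i) (Y (m + 1) (i + 1) - Y m i)
      + exp_gap (X m i - X (m + 1) i) (Y m i - Y (m + 1) i)) = 0" if "1 \<le> m" "m < n" for m
    using that by simp
  have diff: "Y m i - Y (m + 1) i = X m i - X (m + 1) i" if "1 \<le> i" "i \<le> m" "m < n" for m i
  proof -
    have "1 \<le> m" using that by simp
    from row[OF this that(3)]
    have "exp_gap (X (m + 1) (i + 1) - X m i) (Y (m + 1) (i + 1) - Y m i)
      + exp_gap (X m i - X (m + 1) i) (Y m i - Y (m + 1) i) = 0"
      by (subst (asm) sum_nonneg_eq_0_iff) (use that in \<open>auto intro!: add_nonneg_nonneg exp_gap_nonneg\<close>)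
    then have "exp_gap (X m i - X (m + 1) i) (Y m i - Y (m + 1) i) = 0"
      by (subst (asm) add_nonneg_eq_0_iff) (auto intro!: exp_gap_nonneg)
    then show ?thesis by (rule exp_gap_zero)
  qed
  \<comment> \<open>\<open>diff\<close> determines x^m_i from x^(m+1)_i, so equality climbs from the
    common bottom row.\<close>
  have eq: "Y m i = X m i" if "1 \<le> i" "i \<le> m" "m \<le> n" for m i
    using that(3,1,2)
  proof (induction m rule: inc_induct)
    case base
    then show ?case using X Y by (auto simp: triangles_over_def)
  next
    case (step m)
    then show ?case using diff[of i m] by simp
  qed
  show "X = Y"
  proof (intro ext)
    fix m i
    show "X m i = Y m i"
    proof (cases "1 \<le> i \<and> i \<le> m \<and> m \<le> n")
      case False
      then have "X m i = 0" "Y m i = 0"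
        using X(2) Y(2) unfolding triangles_over_def triangles_def mem_Collect_eq by blast+
      then show ?thesis by simp
    qed (simp add: eq)
  qed
qed


section \<open>Existence of critical triangles by compactness\<close>

text \<open>Tychonoff's theorem. Triangles are functions on all index pairs, so compact sets of
  triangles are products, the entries outside the triangle being confined to 0.\<close>

lemma compact_functions:
  fixes S :: "'a \<Rightarrow> 'b::topological_space set"
  assumes "\<And>i. compact (S i)"
  shows "compact {f. \<forall>i. f i \<in> S i}"
proof -
  have "compactin (product_topology (\<lambda>_. euclidean) UNIV) (PiE UNIV S)"
    unfolding compactin_PiE using assms by (simp add: compactin_euclidean_iff)
  moreover have "PiE UNIV S = {f. \<forall>i. f i \<in> S i}" by auto
  ultimately show ?thesis by (simp add: euclidean_product_topology compactin_euclidean_iff)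
qed

lemma continuous_on_F_lam: "continuous_on UNIV (\<lambda>X::triangle. F_lam n lam X)"
proof -
  have "continuous_on UNIV (\<lambda>X::triangle. X m i)" for m i
    using continuous_on_product_then_coordinatewise[OF continuous_on_product_coordinates] .
  then show ?thesis unfolding F_lam_def F_fun_def by (intro continuous_intros)
qed

text \<open>Since exp E is at least E^2 / 2, dividing by E leaves E / 2 \<le> A + D when E >
  1.\<close>

lemma exp_linear_bound:
  fixes E A D :: real
  assumes "exp E \<le> A + D * E" "1 \<le> A" "0 \<le> D"
  shows "E \<le> 2 * (A + D)"
proof (cases "E \<le> 1")
  case True
  then show ?thesis using assms by simp
next
  case False
  have "E\<^sup>2 / 2 \<le> exp E"
    using exp_lower_Taylor_quadratic[of E] False by simp
  also have "\<dots> \<le> (A + D) * E"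
  proof -
    have "A * 1 \<le> A * E" using assms False by (intro mult_left_mono) auto
    then show ?thesis using assms(1) by (simp add: distrib_right)
  qed
  finally have "E * E \<le> 2 * (A + D) * E" by (simp add: power2_eq_square algebra_simps)
  then show ?thesis using False by (simp add: mult_le_cancel_right)
qed

lemma tri_uv_le_sum:
  assumes "1 \<le> i" "i \<le> m" "m < n"
  shows "tri_u Y m i + tri_v Y m i \<le> (\<Sum>m=1..<n. \<Sum>i=1..m. tri_u Y m i + tri_v Y m i)"
proof -
  have pos: "0 \<le> tri_u Y m i + tri_v Y m i" for m i
    by (simp add: tri_u_def tri_v_def add_nonneg_nonneg)
  have "tri_u Y m i + tri_v Y m i \<le> (\<Sum>i=1..m. tri_u Y m i + tri_v Y m i)"
    by (rule member_le_sum) (use assms pos in auto)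
  also have "\<dots> \<le> (\<Sum>m=1..<n. \<Sum>i=1..m. tri_u Y m i + tri_v Y m i)"
    by (rule member_le_sum[of m "{1..<n}" "\<lambda>m. \<Sum>i=1..m. tri_u Y m i + tri_v Y m i"])
      (use assms pos in \<open>auto intro!: sum_nonneg\<close>)
  finally show ?thesis .
qed

lemma lin_part_bound:
  assumes Z: "\<And>m i. 1 \<le> i \<Longrightarrow> i \<le> m \<Longrightarrow> m \<le> n \<Longrightarrow> \<bar>Y m i\<bar> \<le> Z" and "0 \<le> Z"
  shows "\<bar>lin_part n lam Y\<bar> \<le> (\<Sum>m=1..n. \<bar>lam m\<bar>) * (2 * real n) * Z"
proof -
  have row: "\<bar>\<Sum>i=1..m. Y m i\<bar> \<le> real n * Z" if "m \<le> n" for m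
  proof -
    have "\<bar>\<Sum>i=1..m. Y m i\<bar> \<le> (\<Sum>i=1..m. Z)"
      by (rule order_trans[OF sum_abs sum_mono]) (use Z that in auto)
    also have "\<dots> = real m * Z" by simp
    also have "\<dots> \<le> real n * Z" using that \<open>0 \<le> Z\<close> by (intro mult_right_mono) auto
    finally show ?thesis .
  qed
  have "\<bar>lin_part n lam Y\<bar> \<le> (\<Sum>m=1..n. \<bar>lam m\<bar> * (2 * real n * Z))"
    unfolding lin_part_def
  proof (rule order_trans[OF sum_abs sum_mono])
    fix m assume m: "m \<in> {1..n}"
    have "\<bar>(\<Sum>i=1..m - 1. Y (m - 1) i) - (\<Sum>i=1..m. Y m i)\<bar> \<le> 2 * real n * Z"
    proof -
      have "m \<le> n" "m - 1 \<le> n" using m by (simp_all add: le_diff_conv)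
      from row[OF this(1)] row[OF this(2)] show ?thesis by linarith
    qed
    then show "\<bar>lam m * ((\<Sum>i=1..m - 1. Y (m - 1) i) - (\<Sum>i=1..m. Y m i))\<bar> \<le> \<bar>lam m\<bar> * (2 * real n * Z)"
      by (simp add: abs_mult mult_left_mono)
  qed
  then show ?thesis by (simp add: sum_distrib_left sum_distrib_right mult_ac)
qed

text \<open>If all exponents are at most \<open>E\<close> then the entries grow at most linearly in \<open>E\<close>, by the
  interlacing pattern, whereas \<open>F_lam\<close> contains a term \<open>exp E\<close>.\<close>

lemma F_lam_sublevel_bounded:
  obtains R where "\<And>Y m i. Y \<in> triangles_over n x \<Longrightarrow> F_lam n lam Y \<le> c \<Longrightarrow>
    1 \<le> i \<Longrightarrow> i \<le> m \<Longrightarrow> m < n \<Longrightarrow> \<bar>Y m i\<bar> \<le> R"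
proof -
  \<comment> \<open>With entries at most B + n E the linear part is at most K (B + n E), so the sum
    of exponentials is at most |c| + K B + D E. The summand 1 in \<open>A\<close> covers the case E
    = 0.\<close>
  define B where "B = (\<Sum>i=1..n. \<bar>x i\<bar>)"
  define K where "K = (\<Sum>m=1..n. \<bar>lam m\<bar>) * (2 * real n)"
  define A where "A = 1 + \<bar>c\<bar> + K * B"
  define D where "D = K * real n"
  have B0: "0 \<le> B" and K0: "0 \<le> K" by (auto simp: B_def K_def intro!: sum_nonneg mult_nonneg_nonneg)
  have A1: "1 \<le> A" and D0: "0 \<le> D" using B0 K0 by (auto simp: A_def D_def)
  have xB: "\<bar>x i\<bar> \<le> B" if "1 \<le> i" "i \<le> n" for i
    unfolding B_def by (rule member_le_sum) (use that in auto)
  have "\<bar>Y m i\<bar> \<le> B + real n * (2 * (A + D))"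
    if Y: "Y \<in> triangles_over n x" and c: "F_lam n lam Y \<le> c" and mi: "1 \<le> i" "i \<le> m" "m < n" for Y m i
  proof -
    define I where "I = Sigma {1..<n} (\<lambda>m. {1..m})"
    \<comment> \<open>All exponents occurring in \<open>F_fun\<close>; the element 0 keeps the set
      nonempty and makes its maximum nonnegative.\<close>
    define S where "S = insert 0 ((\<lambda>(m, i). Y (m + 1) (i + 1) - Y m i) ` I
      \<union> (\<lambda>(m, i). Y m i - Y (m + 1) i) ` I)"
    define E where "E = Max S"
    have fin: "finite S" by (simp add: S_def I_def)
    have E0: "0 \<le> E" unfolding E_def by (rule Max_ge[OF fin]) (simp add: S_def)
    have up: "Y m i - Y (m + 1) i \<le> E" and low: "Y (m + 1) (i + 1) - Y m i \<le> E"
      if "1 \<le> i" "i \<le> m" "m < n" for m i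
    proof -
      have "(m, i) \<in> I" using that by (auto simp: I_def)
      then have "Y m i - Y (m + 1) i \<in> S" "Y (m + 1) (i + 1) - Y m i \<in> S"
        by (force simp: S_def)+
      then show "Y m i - Y (m + 1) i \<le> E" "Y (m + 1) (i + 1) - Y m i \<le> E"
        unfolding E_def by (auto intro: Max_ge[OF fin])
    qed
    \<comment> \<open>Up to E each entry lies between its lower neighbours, x^(m+1)_(i+1) - E \<le>
      x^m_i \<le> x^(m+1)_i + E, so each step up from the bottom row costs one E.\<close>
    have grow: "\<forall>i. 1 \<le> i \<and> i \<le> m \<longrightarrow> \<bar>Y m i\<bar> \<le> B + real (n - m) * E" if "m \<le> n" for m
      using that
    proof (induction m rule: inc_induct)
      case base
      show ?case using xB Y by (auto simp: triangles_over_def)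
    next
      case (step m)
      show ?case
      proof (intro allI impI)
        fix i assume i: "1 \<le> i \<and> i \<le> m"
        have "\<bar>Y (Suc m) i\<bar> \<le> B + real (n - Suc m) * E" "\<bar>Y (Suc m) (Suc i)\<bar> \<le> B + real (n - Suc m) * E"
          using step.IH i by auto
        moreover have "Y m i - Y (Suc m) i \<le> E" "Y (Suc m) (Suc i) - Y m i \<le> E"
          using up[of i m] low[of i m] i step.hyps by auto
        moreover have "real (n - m) * E = real (n - Suc m) * E + E"
          using step.hyps by (simp add: Suc_diff_Suc[symmetric] algebra_simps)
        ultimately show "\<bar>Y m i\<bar> \<le> B + real (n - m) * E" by linarith
      qed
    qed
    have bound: "\<bar>Y m i\<bar> \<le> B + real n * E" if "1 \<le> i" "i \<le> m" "m \<le> n" for m i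
    proof -
      have "real (n - m) * E \<le> real n * E" using E0 by (intro mult_right_mono) auto
      then show ?thesis using grow[OF that(3)] that by fastforce
    qed
    have "\<bar>lin_part n lam Y\<bar> \<le> K * (B + real n * E)"
      unfolding K_def using bound B0 E0 by (intro lin_part_bound) auto
    then have tot: "(\<Sum>m=1..<n. \<Sum>i=1..m. tri_u Y m i + tri_v Y m i) \<le> \<bar>c\<bar> + K * B + D * E"
      using c unfolding F_lam_alt by (simp add: D_def algebra_simps)
    have "exp E \<le> A + D * E"
    proof -
      have "E \<in> S" unfolding E_def by (rule Max_in[OF fin]) (simp add: S_def)
      then consider "E = 0" | m i where "1 \<le> i" "i \<le> m" "m < n" "exp E = tri_u Y m i"
        | m i where "1 \<le> i" "i \<le> m" "m < n" "exp E = tri_v Y m i"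
        by (auto simp: S_def I_def tri_u_def tri_v_def)
      then show ?thesis
      proof cases
        case 1
        then show ?thesis using A1 by simp
      next
        case 2
        then show ?thesis using tri_uv_le_sum[OF 2(1-3), of Y] tot
          by (simp add: A_def tri_v_def) (smt (verit) exp_gt_zero)
      next
        case 3
        then show ?thesis using tri_uv_le_sum[OF 3(1-3), of Y] tot
          by (simp add: A_def tri_u_def) (smt (verit) exp_gt_zero)
      qed
    qed
    then have "E \<le> 2 * (A + D)" using A1 D0 by (rule exp_linear_bound)
    then have "real n * E \<le> real n * (2 * (A + D))" by (intro mult_left_mono) auto
    then show ?thesis using bound[of i m] mi by linarith
  qed
  then show thesis by (rule that)
qed

text \<open>The box \<open>C\<close> contains the whole sublevel set of the comparison triangle
  \<open>Z\<close>, so its minimiser is minimal among all triangles with the given bottom row. Hence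
  the partial derivatives vanish even if it lies on the boundary of the box.\<close>

lemma critical_point_exists:
  obtains X where "X \<in> triangles_over n x" "critical_point n lam X"
proof -
  define Z :: triangle where "Z m i = (if m = n \<and> 1 \<le> i \<and> i \<le> n then x i else 0)" for m i
  have Z: "Z \<in> triangles_over n x" by (auto simp: Z_def triangles_over_def triangles_def)
  obtain R where R: "\<And>Y m i. Y \<in> triangles_over n x \<Longrightarrow> F_lam n lam Y \<le> F_lam n lam Z \<Longrightarrow>
    1 \<le> i \<Longrightarrow> i \<le> m \<Longrightarrow> m < n \<Longrightarrow> \<bar>Y m i\<bar> \<le> R"
    by (rule F_lam_sublevel_bounded[of n x lam "F_lam n lam Z"]) blast
  define S where "S m i = (if 1 \<le> i \<and> i \<le> m \<and> m \<le> n then if m = n then {x i} else {- R..R} else {0})" for m i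
  define C where "C = {X :: triangle. \<forall>m. X m \<in> {f. \<forall>i. f i \<in> S m i}}"
  have "compact C"
    unfolding C_def by (intro compact_functions) (simp add: S_def)
  moreover have sub: "Y \<in> C" if "Y \<in> triangles_over n x" "F_lam n lam Y \<le> F_lam n lam Z" for Y
  proof -
    have "Y m i \<in> S m i" for m i
    proof (cases "1 \<le> i \<and> i \<le> m \<and> m \<le> n")
      case True
      then show ?thesis
        using R[OF that, of i m] that(1) by (auto simp: S_def triangles_over_def abs_le_iff)
    next
      case False
      then have "Y m i = 0"
        using that(1) unfolding triangles_over_def triangles_def mem_Collect_eq by blast
      then show ?thesis unfolding S_def if_not_P[OF False] by simp
    qed
    then show ?thesis by (simp add: C_def)
  qed
  moreover have "Z \<in> C" using sub[OF Z] by simp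
  ultimately obtain X where X: "X \<in> C" and min: "\<And>Y. Y \<in> C \<Longrightarrow> F_lam n lam X \<le> F_lam n lam Y"
    using continuous_attains_inf[of C "F_lam n lam"] continuous_on_subset[OF continuous_on_F_lam]
    by (metis empty_iff subset_UNIV)
  have SX: "X m i \<in> S m i" for m i using X by (simp add: C_def)
  have Xt: "X \<in> triangles_over n x"
  proof -
    have "X m i = 0" if "\<not> (1 \<le> i \<and> i \<le> m \<and> m \<le> n)" for m i
      using SX[of m i] unfolding S_def if_not_P[OF that] by simp
    moreover have "X n i = x i" if "1 \<le> i" "i \<le> n" for i
      using SX[of n i] that by (simp add: S_def)
    ultimately show ?thesis by (auto simp: triangles_over_def triangles_def)
  qed
  have gmin: "F_lam n lam X \<le> F_lam n lam Y" if "Y \<in> triangles_over n x" for Y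
    using min[OF sub[OF that]] min[OF \<open>Z \<in> C\<close>] by linarith
  have "critical_point n lam X"
    unfolding critical_point_iff
  proof (intro allI impI)
    fix m i assume mi: "1 \<le> i \<and> i \<le> m \<and> m < n"
    have "X(m := (X m)(i := s)) \<in> triangles_over n x" for s
      using Xt mi by (auto simp: triangles_over_def triangles_def)
    then have le: "F_lam n lam X \<le> F_lam n lam (X(m := (X m)(i := s)))" for s
      by (rule gmin)
    show "dF n lam X (tri_unit m i) = 0"
      by (rule DERIV_local_min[OF F_lam_coordinate_deriv, of 1]) (use le in auto)
  qed
  with Xt show thesis by (rule that)
qed

lemma X_star_eq:
  assumes "X \<in> triangles_over n x" "critical_point n lam X" "1 \<le> n"
  shows "X_star n lam x = X"
  unfolding X_star_def
  by (rule the_equality) (use assms critical_point_unique in blast)+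

text \<open>The remainder of \<open>f\<close> at \<open>c\<close> is nonnegative by the lower bound
  and at most the remainder of \<open>\<phi>\<close> by the upper bound.\<close>

lemma DERIV_sandwich:
  fixes f \<phi> :: "real \<Rightarrow> real"
  assumes \<phi>: "(\<phi> has_real_derivative d) (at c)" and c: "\<phi> c = f c"
    and up: "\<And>s. f s \<le> \<phi> s" and low: "\<And>s. f c + (s - c) * d \<le> f s"
  shows "(f has_real_derivative d) (at c)"
proof -
  have lim: "((\<lambda>s. norm (\<phi> s - \<phi> c - d * (s - c)) / norm (s - c)) \<longlongrightarrow> 0) (at c)"
    using \<phi> by (simp add: has_field_derivative_def has_derivative_iff_norm)
  have "((\<lambda>s. norm (f s - f c - d * (s - c)) / norm (s - c)) \<longlongrightarrow> 0) (at c)"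
  proof (rule tendsto_sandwich[OF _ _ tendsto_const lim])
    have "norm (f s - f c - d * (s - c)) \<le> norm (\<phi> s - \<phi> c - d * (s - c))" for s
      using up[of s] low[of s] c by (simp add: algebra_simps)
    then show "\<forall>\<^sub>F s in at c. norm (f s - f c - d * (s - c)) / norm (s - c)
        \<le> norm (\<phi> s - \<phi> c - d * (s - c)) / norm (s - c)"
      by (intro always_eventually allI divide_right_mono) auto
  qed auto
  then show ?thesis
    by (simp add: has_field_derivative_def has_derivative_iff_norm bounded_linear_mult_right)
qed

text \<open>By convexity \<open>u_fun\<close> lies above the affine function given by the differential of \<open>F_lam\<close> at the
  critical point, and below the smooth function obtained by moving only the bottom row.\<close>

lemma u_fun_gradient:
  assumes X: "X \<in> triangles n" "critical_point n lam X" and n: "1 \<le> n"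
  shows "has_gradient n (u_fun n lam) (\<lambda>i. dF n lam X (tri_unit n i)) (X n)"
  unfolding has_gradient_def
proof
  fix i assume i: "i \<in> {1..n}"
  let ?d = "dF n lam X (tri_unit n i)"
  have over: "X \<in> triangles_over n (X n)" using X(1) by (simp add: triangles_over_def)
  have u0: "u_fun n lam (X n) = F_lam n lam X"
    using X_star_eq[OF over X(2) n] by (simp add: u_fun_def)
  have bounds: "u_fun n lam ((X n)(i := s)) \<le> F_lam n lam (X(n := (X n)(i := s)))"
    "F_lam n lam X + (s - X n i) * ?d \<le> u_fun n lam ((X n)(i := s))" for s
  proof -
    \<comment> \<open>The critical triangle over the displaced bottom row. Its minimality gives the
      upper bound, and the tangent inequality at \<open>X\<close> evaluated at it gives the lower
      one.\<close>
    obtain W where W: "W \<in> triangles_over n ((X n)(i := s))" "critical_point n lam W"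
      by (rule critical_point_exists)
    have u: "u_fun n lam ((X n)(i := s)) = F_lam n lam W"
      using X_star_eq[OF W n] by (simp add: u_fun_def)
    have "X(n := (X n)(i := s)) \<in> triangles_over n ((X n)(i := s))"
      using X(1) i by (auto simp: triangles_over_def triangles_def)
    from critical_point_le[OF W(2,1) this n]
    show "u_fun n lam ((X n)(i := s)) \<le> F_lam n lam (X(n := (X n)(i := s)))" by (simp add: u)
    have "dF n lam X (\<lambda>m i. W m i - X m i) = (\<Sum>j=1..n. (W n j - X n j) * dF n lam X (tri_unit n j))"
      using W(1) by (intro dF_critical X n) (simp add: triangles_over_def)
    also have "\<dots> = (\<Sum>j=1..n. if j = i then (s - X n i) * ?d else 0)"
      using W(1) by (intro sum.cong) (auto simp: triangles_over_def)
    also have "\<dots> = (s - X n i) * ?d" using i by simp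
    finally show "F_lam n lam X + (s - X n i) * ?d \<le> u_fun n lam ((X n)(i := s))"
      using F_lam_convex[of n lam X W] by (simp add: u)
  qed
  show "((\<lambda>s. u_fun n lam ((X n)(i := s))) has_real_derivative ?d) (at (X n i))"
    by (rule DERIV_sandwich[OF F_lam_coordinate_deriv]) (use bounds u0 in auto)
qed

section \<open>Identities on the critical set\<close>

text \<open>\<open>p_fun\<close> has two expressions, the closed formula from the row above and the
  critical equation with the row below; the partial derivative of \<open>F_lam\<close> is their
  difference up to sign.\<close>

lemma crit_critical_point:
  assumes "\<And>m i. 1 \<le> i \<Longrightarrow> i \<le> m \<Longrightarrow> m < n \<Longrightarrow> crit_at lam X m i"
  shows "critical_point n lam X"
  unfolding critical_point_iff
proof (intro allI impI)
  fix m i assume mi: "1 \<le> i \<and> i \<le> m \<and> m < n"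
  have "p_fun lam X m i = lam m + (if i < m then tri_v X (m - 1) i else 0)
      - (if 1 < i then tri_u X (m - 1) (i - 1) else 0)"
    by (rule p_fun_crit) (use mi assms in \<open>auto simp: less_imp_diff_less\<close>)
  moreover have "p_fun lam X m i = lam (m + 1) + tri_v X m i - tri_u X m i"
    using assms mi by (simp add: crit_at_def)
  ultimately show "dF n lam X (tri_unit m i) = 0"
    using mi by (simp add: dF_tri_unit)
qed

text \<open>No row lies below the bottom one, so the partial derivative consists of the terms from
  row n - 1, which form the closed formula for \<open>p_fun\<close> with the opposite sign.\<close>

lemma dF_bottom_row:
  assumes crit: "\<And>m i. 1 \<le> i \<Longrightarrow> i \<le> m \<Longrightarrow> m < n \<Longrightarrow> crit_at lam X m i" and i: "1 \<le> i" "i \<le> n"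
  shows "dF n lam X (tri_unit n i) = - p_fun lam X n i"
proof -
  have "p_fun lam X n i = lam n + (if i < n then tri_v X (n - 1) i else 0)
      - (if 1 < i then tri_u X (n - 1) (i - 1) else 0)"
    by (rule p_fun_crit) (use i crit in auto)
  then show ?thesis using i by (simp add: dF_tri_unit)
qed

lemma sum_affine: "(\<Sum>i=1..m. c - 2 * real i) = real m * c - real m * (real m + 1)"
  by (induction m) (auto simp: algebra_simps)

text \<open>The identity is proved for every truncation to the first m rows. The weights m + 1 - 2 i
  of a row sum to zero, so \<open>lam\<close> drops out.\<close>

lemma F_fun_crit:
  assumes crit: "\<And>m i. 1 \<le> i \<Longrightarrow> i \<le> m \<Longrightarrow> m < n \<Longrightarrow> crit_at lam X m i" and n: "1 \<le> n"
  shows "F_fun n X = (\<Sum>i=1..n. (real n + 1 - 2 * real i) * p_fun lam X n i)"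
proof -
  have "(\<Sum>k=1..<m. \<Sum>i=1..k. tri_u X k i + tri_v X k i)
      = (\<Sum>i=1..m. (real m + 1 - 2 * real i) * p_fun lam X m i)" if "1 \<le> m" "m \<le> n" for m
    using that
  proof (induction m rule: dec_induct)
    case base
    show ?case by simp
  next
    case (step m)
    let ?u = "tri_u X m" and ?v = "tri_v X m" and ?l = "lam (Suc m)"
    \<comment> \<open>Both rows are written with the u and v of row m and the same
      \<open>lam\<close>. Passing from row m to row m + 1 raises the coefficient of each v^m_i and
      of each u^m_i by exactly 1, which is the new part of the sum.\<close>
    have p0: "p_fun lam X m i = ?l + ?v i - ?u i" if "i \<in> {1..m}" for i
      using crit[of i m] that step by (simp add: crit_at_def)
    have p1: "p_fun lam X (Suc m) i = ?l + (if i < Suc m then ?v i else 0) - (if 1 < i then ?u (i - 1) else 0)"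
      if "i \<in> {1..Suc m}" for i
      using p_fun_crit[of i "Suc m" lam X] that crit[of i m] step by simp
    have "(\<Sum>i=1..Suc m. (real (Suc m) + 1 - 2 * real i) * p_fun lam X (Suc m) i)
      = (\<Sum>i=1..Suc m. ((real m + 2) - 2 * real i) * ?l
          + (if i < Suc m then (real m + 2 - 2 * real i) * ?v i else 0)
          - (if 1 < i then (real m + 2 - 2 * real i) * ?u (i - 1) else 0))"
      by (rule sum.cong) (auto simp: p1 algebra_simps simp del: p_fun.simps)
    also have "\<dots> = (\<Sum>i=1..Suc m. ((real m + 2) - 2 * real i)) * ?l
          + (\<Sum>i=1..Suc m. if i < Suc m then (real m + 2 - 2 * real i) * ?v i else 0)
          - (\<Sum>i=1..Suc m. if 1 < i then (real m + 2 - 2 * real i) * ?u (i - 1) else 0)"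
      by (simp only: sum_distrib_right sum.distrib[symmetric] sum_subtractf[symmetric])
    also have "(\<Sum>i=1..Suc m. ((real m + 2) - 2 * real i)) = 0"
      unfolding sum_affine by (simp add: algebra_simps)
    also have "(\<Sum>i=1..Suc m. if i < Suc m then (real m + 2 - 2 * real i) * ?v i else 0)
        = (\<Sum>i=1..m. (real m + 2 - 2 * real i) * ?v i)"
      by simp
    also have "(\<Sum>i=1..Suc m. if 1 < i then (real m + 2 - 2 * real i) * ?u (i - 1) else 0)
        = (\<Sum>i=Suc 1..Suc m. (real m + 2 - 2 * real i) * ?u (i - 1))"
      by (rule sum.mono_neutral_cong_right) auto
    also have "\<dots> = (\<Sum>i=1..m. (real m - 2 * real i) * ?u i)"
      unfolding sum.shift_bounds_cl_Suc_ivl by (rule sum.cong) (auto simp: algebra_simps)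
    finally have G1: "(\<Sum>i=1..Suc m. (real (Suc m) + 1 - 2 * real i) * p_fun lam X (Suc m) i)
      = (\<Sum>i=1..m. (real m + 2 - 2 * real i) * ?v i) - (\<Sum>i=1..m. (real m - 2 * real i) * ?u i)"
      by simp
    have "(\<Sum>i=1..m. (real m + 1 - 2 * real i) * p_fun lam X m i)
      = (\<Sum>i=1..m. (real m + 1) - 2 * real i) * ?l + (\<Sum>i=1..m. (real m + 1 - 2 * real i) * (?v i - ?u i))"
      unfolding sum_distrib_right sum.distrib[symmetric]
      by (rule sum.cong) (auto simp: p0 algebra_simps simp del: p_fun.simps)
    also have "(\<Sum>i=1..m. (real m + 1) - 2 * real i) = 0"
      unfolding sum_affine by (simp add: algebra_simps)
    finally have "(\<Sum>i=1..m. ?u i + ?v i) + (\<Sum>i=1..m. (real m + 1 - 2 * real i) * p_fun lam X m i)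
        = (\<Sum>i=1..m. (real m + 2 - 2 * real i) * ?v i) - (\<Sum>i=1..m. (real m - 2 * real i) * ?u i)"
      by (simp add: sum.distrib[symmetric] sum_subtractf[symmetric] algebra_simps)
    then show ?case
      using G1 step by (simp del: p_fun.simps sum.cl_ivl_Suc)
  qed
  from this[OF n order_refl] show ?thesis by (simp add: F_fun_def tri_u_def tri_v_def)
qed

text \<open>Each u^(m-1)_i is added in entry i and subtracted in entry i + 1 of row m, so the row
  sum grows by \<open>lam m\<close> alone.\<close>

lemma p_fun_row_sum:
  assumes m: "2 \<le> m"
  shows "(\<Sum>i=1..m. p_fun lam X m i) - (\<Sum>i=1..m - 1. p_fun lam X (m - 1) i) = lam m"
proof -
  obtain k where k: "m = Suc k" "1 \<le> k" using m by (cases m) auto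
  let ?u = "tri_u X k" and ?p = "p_fun lam X k"
  have "(\<Sum>i=1..Suc k. p_fun lam X (Suc k) i)
      = (\<Sum>i=1..Suc k. if i < Suc k then ?p i + ?u i else lam (Suc k))
      - (\<Sum>i=1..Suc k. if 1 < i then ?u (i - 1) else 0)"
    unfolding sum_subtractf[symmetric]
  proof (rule sum.cong)
    fix i assume "i \<in> {1..Suc k}"
    then show "p_fun lam X (Suc k) i = (if i < Suc k then ?p i + ?u i else lam (Suc k))
        - (if 1 < i then ?u (i - 1) else 0)"
      using p_fun_u[of i "Suc k" lam X] by simp
  qed simp
  also have "(\<Sum>i=1..Suc k. if i < Suc k then ?p i + ?u i else lam (Suc k))
      = (\<Sum>i=1..k. ?p i + ?u i) + lam (Suc k)"
    by simp
  also have "(\<Sum>i=1..Suc k. if 1 < i then ?u (i - 1) else 0) = (\<Sum>i=Suc 1..Suc k. ?u (i - 1))"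
    by (rule sum.mono_neutral_cong_right) auto
  also have "\<dots> = (\<Sum>i=1..k. ?u i)"
    unfolding sum.shift_bounds_cl_Suc_ivl by simp
  finally show ?thesis using k by (simp add: sum.distrib del: p_fun.simps sum.cl_ivl_Suc)
qed

section \<open>Transfer from the constructed solution to the given paths\<close>

theorem theorem8p4:
  fixes n :: nat
    and lam :: "nat \<Rightarrow> real"
    and X0 :: triangle
    and X :: "real \<Rightarrow> triangle"
    and M b L Q P :: "real \<Rightarrow> complex mat"
  assumes n_pos: "n \<ge> 1"
    and X0: "X0 \<in> T_lam n lam"
    and X: "\<And>t. t \<ge> 0 \<Longrightarrow> X t = flow n lam t X0"
    and M: "\<And>t. t \<ge> 0 \<Longrightarrow> M t = g_map n lam (X t)"
    and b: "\<And>t. t \<ge> 0 \<Longrightarrow> b t = inv_into (P_set n) (f_map n) (X t)"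
    and L: "\<And>t. t \<ge> 0 \<Longrightarrow> L t = ordered_prod n
          (map (\<lambda>m. L_mat n m (\<lambda>i. complex_of_real (exp (X t (m + 1) (i + 1) - X t m i)))) [1..<n])"
    and Q: "\<And>t. t \<ge> 0 \<Longrightarrow> Q t = strict_lower_part (M t)"
    and P: "\<And>t. t \<ge> 0 \<Longrightarrow> P t = M t - Q t"
  shows
    "((\<forall>t\<ge>0. M t = inv_mat (L t) * eps_mat n lam * L t)
      \<and> (\<exists>R nn r :: real \<Rightarrow> complex mat.
            (\<forall>t\<ge>0. nn t = inv_mat (L 0) * L t \<and> r t = R t * inv_mat (R 0))
          \<and> (\<forall>t\<ge>0. gauss_decomposition n (b t * w0_bar n) (L t) (R t))
          \<and> (\<forall>t\<ge>0. gauss_decomposition n (exp_mat (complex_of_real t \<cdot>\<^sub>m M 0)) (nn t) (r t))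
          \<and> (\<forall>t\<ge>0. has_mat_derivative n L (L t * Q t) t
                 \<and> has_mat_derivative n R (P t * R t) t
                 \<and> has_mat_derivative n nn (nn t * Q t) t
                 \<and> has_mat_derivative n r (P t * r t) t))
      \<and> toda_solution n M \<and> (\<forall>t\<ge>0. M t \<in> M_lam n lam))
   \<and> (\<forall>t\<ge>0. lam 1 = tri_deriv X t 1 1
        \<and> (\<forall>m. 2 \<le> m \<and> m \<le> n \<longrightarrow>
             lam m = (\<Sum>i=1..m. tri_deriv X t m i) - (\<Sum>i=1..m - 1. tri_deriv X t (m - 1) i)))
   \<and> (\<forall>t\<ge>0. F_fun n (X t) = (\<Sum>i=1..n. (real n + 1 - 2 * real i) * tri_deriv X t n i)
        \<and> has_gradient n (u_fun n lam) (\<lambda>i. - tri_deriv X t n i) (X t n))"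
proof -
  have X0_tri: "X0 \<in> triangles n" using X0 by (simp add: T_lam_def)
  obtain Y where Y_flow: "\<And>m i. 1 \<le> i \<Longrightarrow> i \<le> m \<Longrightarrow> m \<le> n \<Longrightarrow> flow_at lam Y m i"
    and Y_tri: "\<And>t. Y t \<in> triangles n" and Y0: "Y 0 = X0"
    and Y_eq: "\<And>t. 0 \<le> t \<Longrightarrow> flow n lam t X0 = Y t"
    by (rule flow_eq[OF n_pos X0_tri, of lam]) blast
  have XY: "X t = Y t" if "0 \<le> t" for t using X Y_eq that by simp
  interpret critical_flow n lam Y
  proof
    show "flow_at lam Y m i" if "1 \<le> i" "i \<le> m" "m \<le> n" for m i
      using Y_flow that .
    show "crit_at lam (Y t) m i" if "0 \<le> t" "1 \<le> i" "i \<le> m" "m < n" for t m i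
      by (rule crit_at_invariant[of n]) (use that X0 Y0 Y_flow in \<open>auto simp: T_lam_iff_crit\<close>)
  qed
  \<comment> \<open>The given \<open>X\<close> agrees with the solution \<open>Y\<close> for t \<ge>
    0 only; derivatives within \<open>{0..}\<close> see nothing else, so they carry over.\<close>
  have flow_X: "flow_at lam X m i" if "1 \<le> i" "i \<le> m" "m \<le> n" for m i
    unfolding flow_at_def
  proof (intro allI impI)
    fix t :: real assume t: "0 \<le> t"
    show "((\<lambda>s. X s m i) has_real_derivative p_fun lam (X t) m i) (at t within {0..})"
      unfolding XY[OF t]
      by (rule has_field_derivative_transform_within[OF flow_atD[OF Y_flow[OF that] t], of 1])
        (use t XY in auto)
  qed
  have D: "tri_deriv X t m i = p_fun lam (Y t) m i" if "0 \<le> t" "1 \<le> i" "i \<le> m" "m \<le> n" for t m i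
    using flow_at_tri_deriv[OF flow_X] that XY by simp
  have MM: "M t = MM t" if "0 \<le> t" for t
    using M XY that by (simp add: toda_mat_n)
  have bb: "b t = b_mat n (Y t)" if "0 \<le> t" for t
    using b XY that inv_f_map[OF n_pos Y_tri] by simp
  have LL: "L t = LL t" if "0 \<le> t" for t
    using lower_prod_eq[of n "Y t" "n - 1"] L[OF that] XY[OF that] n_pos by (simp add: tri_u_def)
  have QQ: "Q t = QQ t" if "0 \<le> t" for t
    using Q MM that by (simp add: strict_lower_part_toda)
  have PP: "P t = MM t - QQ t" if "0 \<le> t" for t
    using P MM QQ that by simp
  note facts = MM LL QQ PP bb inv_LL[OF n_pos]
  have part1: "\<forall>t\<ge>0. M t = inv_mat (L t) * eps_mat n lam * L t"
    using MM_eq[OF n_pos] by (simp add: facts assoc del: One_nat_def)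
  have part2: "\<exists>R nn r :: real \<Rightarrow> complex mat.
            (\<forall>t\<ge>0. nn t = inv_mat (L 0) * L t \<and> r t = R t * inv_mat (R 0))
          \<and> (\<forall>t\<ge>0. gauss_decomposition n (b t * w0_bar n) (L t) (R t))
          \<and> (\<forall>t\<ge>0. gauss_decomposition n (exp_mat (complex_of_real t \<cdot>\<^sub>m M 0)) (nn t) (r t))
          \<and> (\<forall>t\<ge>0. has_mat_derivative n L (L t * Q t) t
                 \<and> has_mat_derivative n R (P t * R t) t
                 \<and> has_mat_derivative n nn (nn t * Q t) t
                 \<and> has_mat_derivative n r (P t * r t) t)"
  \<comment> \<open>The goals below instantiate the witnesses: \<open>RR\<close> is
    \<open>upper_fac\<close> of the solution, while \<open>NN\<close> and \<open>rr\<close> are the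
    normalised factors, equal to the identity at time 0.\<close>
  proof (intro exI conjI allI impI)
    fix t :: real assume t: "0 \<le> t"
    show "NN t = inv_mat (L 0) * L t" using t by (simp only: facts order_refl)
    show "rr t = RR t * inv_mat (RR 0)" ..
    show "gauss_decomposition n (b t * w0_bar n) (L t) (RR t)"
      using t b_mat_gauss(1)[OF n_pos] by (simp only: facts)
    show "gauss_decomposition n (exp_mat (complex_of_real t \<cdot>\<^sub>m M 0)) (NN t) (rr t)"
      using NN_rr_gauss[OF n_pos t] by (simp only: facts order_refl)
    show "has_mat_derivative n L (L t * Q t) t"
      using t LL_deriv[OF n_pos t] has_mat_derivative_cong[of n LL _ t L] by (simp only: facts)
    show "has_mat_derivative n RR (P t * RR t) t"
      using t RR_deriv[OF n_pos t] by (simp only: facts)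
    show "has_mat_derivative n NN (NN t * Q t) t"
      using t NN_deriv[OF n_pos t] by (simp only: facts)
    show "has_mat_derivative n rr (P t * rr t) t"
      using t rr_deriv[OF n_pos t] by (simp only: facts)
  qed
  have part3: "toda_solution n M"
    unfolding toda_solution_def
  proof (intro allI impI conjI)
    fix t :: real assume t: "0 \<le> t"
    show "M t \<in> tridiag_hessenberg n" using MM[OF t] toda_mat_hessenberg by simp
    show "has_mat_derivative n M (M t * strict_lower_part (M t) - strict_lower_part (M t) * M t) t"
      unfolding MM[OF t] strict_lower_part_toda
      by (rule has_mat_derivative_cong[OF MM_deriv[OF n_pos t]]) (use MM t in auto)
  qed
  have part4: "\<forall>t\<ge>0. M t \<in> M_lam n lam"
    using MM MM_in_M_lam[OF n_pos] by simp
  have part5: "\<forall>t\<ge>0. lam 1 = tri_deriv X t 1 1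
        \<and> (\<forall>m. 2 \<le> m \<and> m \<le> n \<longrightarrow>
             lam m = (\<Sum>i=1..m. tri_deriv X t m i) - (\<Sum>i=1..m - 1. tri_deriv X t (m - 1) i))"
  proof (intro allI impI conjI)
    fix t :: real assume t: "0 \<le> t"
    show "lam 1 = tri_deriv X t 1 1" using D[OF t, of 1 1] n_pos by simp
    fix m assume m: "2 \<le> m \<and> m \<le> n"
    have "(\<Sum>i=1..m. tri_deriv X t m i) = (\<Sum>i=1..m. p_fun lam (Y t) m i)"
      "(\<Sum>i=1..m - 1. tri_deriv X t (m - 1) i) = (\<Sum>i=1..m - 1. p_fun lam (Y t) (m - 1) i)"
      using m by (auto intro!: sum.cong D[OF t])
    then show "lam m = (\<Sum>i=1..m. tri_deriv X t m i) - (\<Sum>i=1..m - 1. tri_deriv X t (m - 1) i)"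
      using p_fun_row_sum[of m lam "Y t"] m by simp
  qed
  have part6: "\<forall>t\<ge>0. F_fun n (X t) = (\<Sum>i=1..n. (real n + 1 - 2 * real i) * tri_deriv X t n i)
        \<and> has_gradient n (u_fun n lam) (\<lambda>i. - tri_deriv X t n i) (X t n)"
  proof (intro allI impI conjI)
    fix t :: real assume t: "0 \<le> t"
    have crit: "crit_at lam (Y t) m i" if "1 \<le> i" "i \<le> m" "m < n" for m i
      by (rule cr[OF t that])
    have "(\<Sum>i=1..n. (real n + 1 - 2 * real i) * tri_deriv X t n i)
        = (\<Sum>i=1..n. (real n + 1 - 2 * real i) * p_fun lam (Y t) n i)"
      by (rule sum.cong) (auto simp: D[OF t])
    then show "F_fun n (X t) = (\<Sum>i=1..n. (real n + 1 - 2 * real i) * tri_deriv X t n i)"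
      using F_fun_crit[OF crit n_pos] XY[OF t] by simp
    have "has_gradient n (u_fun n lam) (\<lambda>i. dF n lam (Y t) (tri_unit n i)) (Y t n)"
      by (rule u_fun_gradient[OF Y_tri crit_critical_point[OF crit] n_pos])
    moreover have "dF n lam (Y t) (tri_unit n i) = - tri_deriv X t n i" if "i \<in> {1..n}" for i
      using dF_bottom_row[of n lam "Y t" i, OF crit] D[OF t, of i n] that by simp
    ultimately show "has_gradient n (u_fun n lam) (\<lambda>i. - tri_deriv X t n i) (X t n)"
      using XY[OF t] by (simp add: has_gradient_def)
  qed
  show ?thesis
    using part1 part2 part3 part4 part5 part6 by blast
qed

end
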